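(* Let $A(\mathbb{D})$ be the disk algebra, regarded as a uniform algebra on the unit circle $\mathbb{T}$, and let $f\in C(\mathbb{T})_+$, i.e. $f$ is a nonnegative continuous function on $\mathbb{T}$. The following are equivalent: (i) $\log f$ is integrable on $\mathbb{T}$; (ii) $f=|\phi|$ for a function $\phi\in H^\infty\setminus\{0\}$; (iii) $\overline{A(\mathbb{D})f}$ is a rigged module over $A(\mathbb{D})$; (iv) $f\in\mathcal{R}(\mathbb{T})$. Moreover, every singly generated rigged module over $A(\mathbb{D})$ is $A(\mathbb{D})$-isometric to one of the form in (iii).
   Context: Write $A=A(\mathbb{D})$. $H^\infty$ is the algebra of bounded analytic functions on the open unit disk $\mathbb{D}$, identified with their boundary values on $\mathbb{T}$ (so the equality in (ii) is between functions on $\mathbb{T}$, almost everywhere). The closure in (iii) is taken in $C(\mathbb{T})$. $A$ and submodules of $C(\mathbb{T})$ carry the operator space structure inherited from $C(\mathbb{T})$. A left operator module over $A$ is a complete operator space $X$ which is a unital left $A$-module with $\|[\sum_k a_{ik}x_{kj}]\|\le\|[a_{ij}]\|\|[x_{ij}]\|$ for all matrices over $A$ and $X$. It is singly generated if $Ax$ is dense in $X$ for some $x\in X$. $A$-isometric means isomorphic via a surjective isometric $A$-module map. $R_n(A)$ is the space $A^{(n)}$ of $n$-tuples with entries in $A$, with the operator space structure of the first row of $M_n(A)$. A left operator module $X$ is ($A$-)rigged if there exist a net of natural numbers $n_\alpha$ and completely contractive $A$-module maps $\phi_\alpha:X\to R_{n_\alpha}(A)$, $\psi_\alpha:R_{n_\alpha}(A)\to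 X$ such that $\psi_\alpha(\phi_\alpha(x))\to x$ for all $x\in X$ and, for every $\beta$, $\phi_\beta\circ\psi_\alpha\circ\phi_\alpha\to\phi_\beta$ in completely bounded norm. An $A$-tuple is an element of $A^{(n)}$ for some $n$, regarded as a function $\mathbb{T}\to\mathbb{C}^n$; $H\cdot K=\sum_ih_ik_i$ for $A$-tuples $H=(h_i)$, $K=(k_i)$ of equal length, and $\|\cdot\|_2$ is the Euclidean norm. For a closed subset $E\subset\mathbb{T}$, $\mathcal{R}_E(\mathbb{T})$ is the set of $f\in C(\mathbb{T})$ which vanish exactly on $E$ and for which there are two sequences $H_n,K_n$ of $A$-tuples ($H_n$ and $K_n$ of the same length) such that $\|K_n(w)\|_2\le f(w)\le\|H_n(w)\|_2^{-1}$ for all $w\in\mathbb{T}$ (interpreting $\frac10=\infty$), and $H_n(w)\cdot K_n(w)\to1$ uniformly on compact subsets of $\mathbb{T}\setminus E$. $\mathcal{R}(\mathbb{T})$ is the union of all the classes $\mathcal{R}_E(\mathbb{T})$.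
   Formalization: For f = 0 the equivalence fails: (i), (ii) are false, while (iii), (iv) hold (the zero module is rigged and 0 lies in R(T)). So (i)⇔(ii) and (iii)⇔(iv) are proved for all f, and (i)⇔(iii) only for f not identically zero. *)

theory Defs
  imports
    "HOL-Complex_Analysis.Complex_Analysis"
    "HOL-Library.Function_Algebras"
begin

section \<open>The circle, the disk algebra and bounded analytic functions\<close>

abbreviation circle :: "complex set" where
  "circle \<equiv> sphere 0 1"

text \<open>
  A complex function on the circle is represented by a function on \<open>complex\<close> that vanishes off the
  circle, so that equality of functions on the circle is equality in HOL and the vector space
  operations are the pointwise ones. The unit of the algebra \<open>C_circle\<close> is \<open>indicator circle\<close>.
\<close>

definition C_circle :: "(complex \<Rightarrow> complex) set" where
  "C_circle = {g. continuous_on circle g \<and> (\<forall>z. z \<notin> circle \<longrightarrow> g z = 0)}"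

text \<open>Nonnegative continuous functions; nothing is required (or used) off the circle.\<close>

definition C_circle_nonneg :: "(complex \<Rightarrow> real) set" where
  "C_circle_nonneg = {f. continuous_on circle f \<and> (\<forall>w\<in>circle. 0 \<le> f w)}"

definition disk_algebra :: "(complex \<Rightarrow> complex) set" where
  "disk_algebra = {a \<in> C_circle. \<exists>F. continuous_on (cball 0 1) F \<and> F holomorphic_on ball 0 1
      \<and> (\<forall>w\<in>circle. a w = F w)}"

text \<open>Arc length on the circle. The space of this measure is \<open>circle\<close>, not all of \<open>complex\<close>.\<close>

definition circle_measure :: "complex measure" where
  "circle_measure = distr (restrict_space lborel {0..<2*pi}) (restrict_space borel circle) cis"

text \<open>
  Since \<open>ln 0 = 0\<close> in HOL, the convention \<open>log 0 = -\<infinity>\<close> makes it necessary to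
  demand separately that \<open>f\<close> is positive almost everywhere.
\<close>

definition log_integrable :: "(complex \<Rightarrow> real) \<Rightarrow> bool" where
  "log_integrable f \<longleftrightarrow>
     (AE w in circle_measure. f w > 0) \<and> integrable circle_measure (\<lambda>w. ln (f w))"

definition H_infinity :: "(complex \<Rightarrow> complex) set" where
  "H_infinity = {\<phi>. \<phi> holomorphic_on ball 0 1 \<and> bounded (\<phi> ` ball 0 1)}"

definition has_boundary_values :: "(complex \<Rightarrow> complex) \<Rightarrow> (complex \<Rightarrow> complex) \<Rightarrow> bool" where
  "has_boundary_values \<phi> b \<longleftrightarrow>
     (AE w in circle_measure. ((\<lambda>r. \<phi> (complex_of_real r * w)) \<longlongrightarrow> b w) (at_left 1))"


section \<open>Operator spaces\<close>

text \<open>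
  An \<open>m \<times> n\<close> matrix is a function \<open>nat \<Rightarrow> nat \<Rightarrow> _\<close> of which only the entries
  with row index \<open>< m\<close> and column index \<open>< n\<close> matter. \<open>mat_norm\<close> is the operator norm
  of a scalar matrix between Euclidean spaces.
\<close>

definition mat_norm :: "nat \<Rightarrow> nat \<Rightarrow> (nat \<Rightarrow> nat \<Rightarrow> complex) \<Rightarrow> real" where
  "mat_norm m n a =
     (SUP v\<in>{v. L2_set (\<lambda>j. cmod (v j)) {..<n} \<le> 1}.
        L2_set (\<lambda>i. cmod (\<Sum>j<n. a i j * v j)) {..<m})"

text \<open>
  Data of an operator space: the vectors form a subset \<open>car\<close> of an ambient abelian group, whose
  addition is used; \<open>mnorm X n\<close> is the norm of \<open>M\<^sub>n(X)\<close>. An operator module has in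
  addition an action of the disk algebra.
\<close>

record 'x opspace =
  car :: "'x set"
  scl :: "complex \<Rightarrow> 'x \<Rightarrow> 'x"
  mnorm :: "nat \<Rightarrow> (nat \<Rightarrow> nat \<Rightarrow> 'x) \<Rightarrow> real"

record 'x opmodule = "'x opspace" +
  act :: "(complex \<Rightarrow> complex) \<Rightarrow> 'x \<Rightarrow> 'x"

definition mats :: "('x, 'z) opspace_scheme \<Rightarrow> nat \<Rightarrow> nat \<Rightarrow> (nat \<Rightarrow> nat \<Rightarrow> 'x) set" where
  "mats X m n = {x. \<forall>i<m. \<forall>j<n. x i j \<in> car X}"

definition vnorm :: "('x, 'z) opspace_scheme \<Rightarrow> 'x \<Rightarrow> real" where
  "vnorm X x = mnorm X 1 (\<lambda>_ _. x)"

text \<open>Complete abstract operator spaces, that is, Ruan's axioms together with completeness.\<close>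

locale operator_space =
  fixes X :: "('x::ab_group_add, 'z) opspace_scheme"
  assumes zero_closed: "0 \<in> car X"
    and add_closed: "\<lbrakk>u \<in> car X; v \<in> car X\<rbrakk> \<Longrightarrow> u + v \<in> car X"
    and scl_closed: "u \<in> car X \<Longrightarrow> scl X c u \<in> car X"
    and scl_one: "u \<in> car X \<Longrightarrow> scl X 1 u = u"
    and scl_mult: "u \<in> car X \<Longrightarrow> scl X (c * d) u = scl X c (scl X d u)"
    and scl_add_left: "u \<in> car X \<Longrightarrow> scl X (c + d) u = scl X c u + scl X d u"
    and scl_add_right: "\<lbrakk>u \<in> car X; v \<in> car X\<rbrakk> \<Longrightarrow> scl X c (u + v) = scl X c u + scl X c v"
    and mnorm_nonneg: "x \<in> mats X n n \<Longrightarrow> 0 \<le> mnorm X n x"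
    and mnorm_eq_0_iff: "x \<in> mats X n n \<Longrightarrow> mnorm X n x = 0 \<longleftrightarrow> (\<forall>i<n. \<forall>j<n. x i j = 0)"
    and mnorm_scl: "x \<in> mats X n n \<Longrightarrow> mnorm X n (\<lambda>i j. scl X c (x i j)) = cmod c * mnorm X n x"
    and mnorm_triangle: "\<lbrakk>x \<in> mats X n n; y \<in> mats X n n\<rbrakk>
        \<Longrightarrow> mnorm X n (\<lambda>i j. x i j + y i j) \<le> mnorm X n x + mnorm X n y"
    and mnorm_direct_sum: "\<lbrakk>x \<in> mats X m m; y \<in> mats X n n\<rbrakk>
        \<Longrightarrow> mnorm X (m + n) (\<lambda>i j. if i < m \<and> j < m then x i j
              else if m \<le> i \<and> m \<le> j then y (i - m) (j - m) else 0)
            = max (mnorm X m x) (mnorm X n y)"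
    and mnorm_mult: "x \<in> mats X n n
        \<Longrightarrow> mnorm X m (\<lambda>i j. \<Sum>k<n. \<Sum>l<n. scl X (\<alpha> i k * \<beta> l j) (x k l))
            \<le> mat_norm m n \<alpha> * mnorm X n x * mat_norm n m \<beta>"
    and complete: "\<lbrakk>\<And>k::nat. s k \<in> car X;
          \<And>e. e > 0 \<Longrightarrow> \<exists>N. \<forall>k\<ge>N. \<forall>l\<ge>N. vnorm X (s k - s l) < e\<rbrakk>
        \<Longrightarrow> \<exists>u\<in>car X. (\<lambda>k. vnorm X (s k - u)) \<longlonglongrightarrow> 0"

text \<open>The norm of \<open>M\<^sub>n(C_circle)\<close>, and hence of \<open>M\<^sub>n\<close> of any of its subspaces.\<close>

definition C_mnorm :: "nat \<Rightarrow> (nat \<Rightarrow> nat \<Rightarrow> complex \<Rightarrow> complex) \<Rightarrow> real" where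
  "C_mnorm n g = (SUP w\<in>circle. mat_norm n n (\<lambda>i j. g i j w))"

text \<open>The completely bounded norm of \<open>T\<close>, which is \<open>\<infinity>\<close> if \<open>T\<close> is not completely bounded.\<close>

definition cb_norm ::
  "('x, 'u) opspace_scheme \<Rightarrow> ('y, 'v) opspace_scheme \<Rightarrow> ('x \<Rightarrow> 'y) \<Rightarrow> ennreal" where
  "cb_norm X Y T = (SUP n. SUP x\<in>{x \<in> mats X n n. mnorm X n x \<le> 1}.
      ennreal (mnorm Y n (\<lambda>i j. T (x i j))))"


section \<open>Operator modules over the disk algebra\<close>

locale left_operator_module = operator_space X
  for X :: "('x::ab_group_add, 'z) opmodule_scheme" +
  assumes act_closed: "\<lbrakk>a \<in> disk_algebra; u \<in> car X\<rbrakk> \<Longrightarrow> act X a u \<in> car X"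
    and act_add_left: "\<lbrakk>a \<in> disk_algebra; b \<in> disk_algebra; u \<in> car X\<rbrakk>
        \<Longrightarrow> act X (a + b) u = act X a u + act X b u"
    and act_add_right: "\<lbrakk>a \<in> disk_algebra; u \<in> car X; v \<in> car X\<rbrakk>
        \<Longrightarrow> act X a (u + v) = act X a u + act X a v"
    and act_scl: "\<lbrakk>a \<in> disk_algebra; u \<in> car X\<rbrakk> \<Longrightarrow> act X (\<lambda>z. c * a z) u = scl X c (act X a u)"
    and act_mult: "\<lbrakk>a \<in> disk_algebra; b \<in> disk_algebra; u \<in> car X\<rbrakk>
        \<Longrightarrow> act X (a * b) u = act X a (act X b u)"
    and act_unit: "u \<in> car X \<Longrightarrow> act X (indicator circle) u = u"
    and act_contractive: "\<lbrakk>\<forall>i<n. \<forall>k<n. p i k \<in> disk_algebra; x \<in> mats X n n\<rbrakk>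
        \<Longrightarrow> mnorm X n (\<lambda>i j. \<Sum>k<n. act X (p i k) (x k j)) \<le> C_mnorm n p * mnorm X n x"

definition module_map ::
  "('x::ab_group_add, 'u) opmodule_scheme \<Rightarrow> ('y::ab_group_add, 'v) opmodule_scheme
    \<Rightarrow> ('x \<Rightarrow> 'y) \<Rightarrow> bool" where
  "module_map X Y T \<longleftrightarrow>
     (\<forall>x\<in>car X. T x \<in> car Y) \<and>
     (\<forall>x\<in>car X. \<forall>y\<in>car X. T (x + y) = T x + T y) \<and>
     (\<forall>a\<in>disk_algebra. \<forall>x\<in>car X. T (act X a x) = act Y a (T x))"

definition cc_module_map ::
  "('x::ab_group_add, 'u) opmodule_scheme \<Rightarrow> ('y::ab_group_add, 'v) opmodule_scheme
    \<Rightarrow> ('x \<Rightarrow> 'y) \<Rightarrow> bool" where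
  "cc_module_map X Y T \<longleftrightarrow> module_map X Y T \<and> cb_norm X Y T \<le> 1"

definition A_isometric ::
  "('x::ab_group_add, 'u) opmodule_scheme \<Rightarrow> ('y::ab_group_add, 'v) opmodule_scheme \<Rightarrow> bool" where
  "A_isometric X Y \<longleftrightarrow>
     (\<exists>T. module_map X Y T \<and> T ` car X = car Y \<and> (\<forall>x\<in>car X. vnorm Y (T x) = vnorm X x))"

definition singly_generated :: "('x::ab_group_add, 'z) opmodule_scheme \<Rightarrow> bool" where
  "singly_generated X \<longleftrightarrow>
     (\<exists>x\<in>car X. \<forall>y\<in>car X. \<forall>e>0. \<exists>a\<in>disk_algebra. vnorm X (y - act X a x) < e)"

text \<open>
  The closure of \<open>A(D) f\<close> in \<open>C_circle\<close>, as an operator module with the structure inherited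
  from \<open>C_circle\<close>.
\<close>

definition closed_submodule :: "(complex \<Rightarrow> real) \<Rightarrow> (complex \<Rightarrow> complex) opmodule" where
  "closed_submodule f =
     \<lparr> car = {g \<in> C_circle. \<forall>e>0. \<exists>a\<in>disk_algebra. \<forall>w\<in>circle. cmod (g w - a w * f w) < e},
       scl = (\<lambda>c g z. c * g z),
       mnorm = C_mnorm,
       act = (\<lambda>a g. a * g) \<rparr>"

text \<open>
  \<open>R\<^sub>n(A(D))\<close>, with \<open>n\<close>-tuples extended by \<open>0\<close>. An \<open>m \<times> m\<close> matrix over it is viewed
  as an \<open>m \<times> m\<close> block matrix whose blocks are \<open>n \<times> n\<close> and have their nonzero entries
  in the first row: entry \<open>(r, s)\<close> lies in block \<open>(r div n, s div n)\<close>, at place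
  \<open>(r mod n, s mod n)\<close>.
\<close>

definition row_module :: "nat \<Rightarrow> (nat \<Rightarrow> complex \<Rightarrow> complex) opmodule" where
  "row_module n =
     \<lparr> car = {v. (\<forall>k<n. v k \<in> disk_algebra) \<and> (\<forall>k\<ge>n. v k = 0)},
       scl = (\<lambda>c v k z. c * v k z),
       mnorm = (\<lambda>m x. C_mnorm (m * n)
          (\<lambda>r s. if r mod n = 0 then x (r div n) (s div n) (s mod n) else 0)),
       act = (\<lambda>a v k. a * v k) \<rparr>"


section \<open>Rigged modules\<close>

text \<open>A net is a family indexed by a set \<open>I\<close> that is directed by the preorder \<open>le\<close>.\<close>

definition directed_set :: "'i set \<Rightarrow> ('i \<Rightarrow> 'i \<Rightarrow> bool) \<Rightarrow> bool" where
  "directed_set I le \<longleftrightarrow> I \<noteq> {} \<and> (\<forall>i\<in>I. le i i) \<and>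
     (\<forall>i\<in>I. \<forall>j\<in>I. \<forall>k\<in>I. le i j \<longrightarrow> le j k \<longrightarrow> le i k) \<and>
     (\<forall>i\<in>I. \<forall>j\<in>I. \<exists>k\<in>I. le i k \<and> le j k)"

definition net_filter :: "'i set \<Rightarrow> ('i \<Rightarrow> 'i \<Rightarrow> bool) \<Rightarrow> 'i filter" where
  "net_filter I le = (INF i\<in>I. principal {j \<in> I. le i j})"

lemma eventually_net_filter:
  assumes "directed_set I le"
  shows "eventually P (net_filter I le) \<longleftrightarrow> (\<exists>i\<in>I. \<forall>j\<in>I. le i j \<longrightarrow> P j)"
proof -
  have "eventually P (net_filter I le) \<longleftrightarrow> (\<exists>i\<in>I. eventually P (principal {j \<in> I. le i j}))"
    unfolding net_filter_def
  proof (rule eventually_INF_base)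
    show "I \<noteq> {}" using assms by (simp add: directed_set_def)
    fix i j assume ij: "i \<in> I" "j \<in> I"
    then obtain k where k: "k \<in> I" "le i k" "le j k"
      using assms unfolding directed_set_def by blast
    have "{l \<in> I. le k l} \<subseteq> {l \<in> I. le i l} \<inter> {l \<in> I. le j l}"
      using assms ij k unfolding directed_set_def by blast
    with k show "\<exists>x\<in>I. principal {j \<in> I. le x j}
        \<le> inf (principal {j \<in> I. le i j}) (principal {l \<in> I. le j l})"
      by auto
  qed
  then show ?thesis by (auto simp: eventually_principal)
qed

definition rigging ::
  "('x::ab_group_add, 'z) opmodule_scheme \<Rightarrow> 'i set \<Rightarrow> ('i \<Rightarrow> 'i \<Rightarrow> bool) \<Rightarrow> ('i \<Rightarrow> nat)
    \<Rightarrow> ('i \<Rightarrow> 'x \<Rightarrow> nat \<Rightarrow> complex \<Rightarrow> complex)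
    \<Rightarrow> ('i \<Rightarrow> (nat \<Rightarrow> complex \<Rightarrow> complex) \<Rightarrow> 'x) \<Rightarrow> bool" where
  "rigging X I le n \<phi> \<psi> \<longleftrightarrow>
     directed_set I le \<and>
     (\<forall>i\<in>I. 1 \<le> n i \<and> cc_module_map X (row_module (n i)) (\<phi> i)
                    \<and> cc_module_map (row_module (n i)) X (\<psi> i)) \<and>
     (\<forall>x\<in>car X. ((\<lambda>i. vnorm X (\<psi> i (\<phi> i x) - x)) \<longlongrightarrow> 0) (net_filter I le)) \<and>
     (\<forall>j\<in>I. ((\<lambda>i. cb_norm X (row_module (n j)) (\<lambda>x. \<phi> j (\<psi> i (\<phi> i x)) - \<phi> j x)) \<longlongrightarrow> 0)
              (net_filter I le))"

text \<open>
  HOL cannot quantify existentially over the index type of the net. The index type used here is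
  large enough to re-index any net as in the definition of a rigged module: see
  \<open>rigging_imp_rigged\<close> below.
\<close>

type_synonym 'x factorization =
  "nat \<times> ('x \<Rightarrow> nat \<Rightarrow> complex \<Rightarrow> complex) \<times> ((nat \<Rightarrow> complex \<Rightarrow> complex) \<Rightarrow> 'x)"

definition rigged :: "('x::ab_group_add, 'z) opmodule_scheme \<Rightarrow> bool" where
  "rigged X \<longleftrightarrow> left_operator_module X \<and>
     (\<exists>(I :: ('x factorization set \<times> 'x factorization) set) le n \<phi> \<psi>. rigging X I le n \<phi> \<psi>)"

lemma tendsto_net_transfer:
  fixes l :: "'b::topological_space"
  assumes ev: "\<And>P. eventually (\<lambda>i. P (t i)) F \<Longrightarrow> eventually (\<lambda>p. P (snd p)) G"
    and "((\<lambda>i. g (t i)) \<longlongrightarrow> l) F"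
  shows "((\<lambda>p. g (snd p)) \<longlongrightarrow> l) G"
  unfolding tendsto_def
proof (intro allI impI)
  fix S assume "open S" "l \<in> S"
  with assms(2) have "eventually (\<lambda>i. g (t i) \<in> S) F"
    by (rule topological_tendstoD)
  then show "eventually (\<lambda>p. g (snd p) \<in> S) G"
    by (rule ev)
qed

lemma rigging_imp_rigged:
  fixes X :: "('x::ab_group_add, 'z) opmodule_scheme" and I :: "'i set"
  assumes X: "left_operator_module X" and R: "rigging X I le n \<phi> \<psi>"
  shows "rigged X"
proof -
  define t :: "'i \<Rightarrow> 'x factorization" where "t = (\<lambda>i. (n i, \<phi> i, \<psi> i))"
  define J :: "('x factorization set \<times> 'x factorization) set" where
    "J = {(E, s). s \<in> E \<and> s \<in> t ` I \<and> (\<exists>i\<in>I. \<forall>j\<in>I. le i j \<longrightarrow> t j \<in> E)}"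
  define leJ :: "('x factorization set \<times> 'x factorization)
      \<Rightarrow> ('x factorization set \<times> 'x factorization) \<Rightarrow> bool" where
    "leJ = (\<lambda>p q. fst q \<subseteq> fst p)"
  note R = R[unfolded rigging_def]
  note dI = R[THEN conjunct1] and ccI = R[THEN conjunct2, THEN conjunct1]
    and limI = R[THEN conjunct2, THEN conjunct2, THEN conjunct1]
    and cbI = R[THEN conjunct2, THEN conjunct2, THEN conjunct2]
  have dJ: "directed_set J leJ"
    unfolding directed_set_def
  proof (intro conjI ballI impI)
    obtain i where "i \<in> I" using dI by (auto simp: directed_set_def)
    then have "(UNIV, t i) \<in> J" by (auto simp: J_def)
    then show "J \<noteq> {}" by blast
  next
    fix p q assume "p \<in> J" "q \<in> J"
    then obtain i j where i: "i \<in> I" "\<forall>k\<in>I. le i k \<longrightarrow> t k \<in> fst p"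
      and j: "j \<in> I" "\<forall>k\<in>I. le j k \<longrightarrow> t k \<in> fst q"
      by (auto simp: J_def)
    obtain k where k: "k \<in> I" "le i k" "le j k"
      using dI i j unfolding directed_set_def by blast
    have sub: "\<forall>l\<in>I. le k l \<longrightarrow> t l \<in> fst p \<inter> fst q"
      using dI i j k unfolding directed_set_def by blast
    have "le k k" using dI k by (simp add: directed_set_def)
    then have "(fst p \<inter> fst q, t k) \<in> J"
      using sub k unfolding J_def by blast
    moreover have "leJ p (fst p \<inter> fst q, t k)" "leJ q (fst p \<inter> fst q, t k)"
      by (simp_all add: leJ_def)
    ultimately show "\<exists>r\<in>J. leJ p r \<and> leJ q r" by blast
  qed (auto simp: leJ_def)
  have ev: "eventually (\<lambda>p. P (snd p)) (net_filter J leJ)"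
    if "eventually (\<lambda>i. P (t i)) (net_filter I le)" for P
  proof -
    from that obtain i where i: "i \<in> I" "\<forall>j\<in>I. le i j \<longrightarrow> P (t j)"
      unfolding eventually_net_filter[OF dI] by blast
    have "le i i" using dI i(1) by (simp add: directed_set_def)
    then have "P (t i)" using i by blast
    have "\<exists>i\<in>I. \<forall>j\<in>I. le i j \<longrightarrow> t j \<in> {s. P s}"
      by (rule bexI[OF _ i(1)]) (use i(2) in simp)
    then have "({s. P s}, t i) \<in> J"
      using \<open>P (t i)\<close> i(1) by (simp add: J_def)
    moreover have "\<forall>p\<in>J. leJ ({s. P s}, t i) p \<longrightarrow> P (snd p)"
      by (simp add: J_def leJ_def subset_iff split_beta)
    ultimately show ?thesis unfolding eventually_net_filter[OF dJ] by (rule bexI[rotated])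
  qed
  have J: "\<exists>i\<in>I. snd p = t i" if "p \<in> J" for p
    using that by (auto simp: J_def)
  have "rigging X J leJ (\<lambda>p. fst (snd p)) (\<lambda>p. fst (snd (snd p))) (\<lambda>p. snd (snd (snd p)))"
    unfolding rigging_def
  proof (intro conjI ballI)
    show "directed_set J leJ" by (rule dJ)
  next
    fix p assume "p \<in> J"
    with J obtain i where i: "i \<in> I" "snd p = t i" by blast
    have ti: "fst (t i) = n i" "fst (snd (t i)) = \<phi> i" "snd (snd (t i)) = \<psi> i"
      by (simp_all add: t_def)
    show "1 \<le> fst (snd p)"
      and "cc_module_map X (row_module (fst (snd p))) (fst (snd (snd p)))"
      and "cc_module_map (row_module (fst (snd p))) X (snd (snd (snd p)))"
      using ccI[rule_format, OF i(1)] by (simp_all add: i(2) ti)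
  next
    fix x assume "x \<in> car X"
    then have "((\<lambda>i. vnorm X (\<psi> i (\<phi> i x) - x)) \<longlongrightarrow> 0) (net_filter I le)"
      by (rule limI[rule_format])
    then have "((\<lambda>i. vnorm X (snd (snd (t i)) (fst (snd (t i)) x) - x)) \<longlongrightarrow> 0) (net_filter I le)"
      by (simp only: t_def fst_conv snd_conv)
    then show "((\<lambda>p. vnorm X (snd (snd (snd p)) (fst (snd (snd p)) x) - x)) \<longlongrightarrow> 0)
        (net_filter J leJ)"
      by (rule tendsto_net_transfer[rotated, where t = t and g = "\<lambda>s. vnorm X (snd (snd s) (fst (snd s) x) - x)"]) (rule ev)
  next
    fix p assume "p \<in> J"
    with J obtain j where j: "j \<in> I" "snd p = t j" by blast
    from j(1) have "((\<lambda>i. cb_norm X (row_module (n j)) (\<lambda>x. \<phi> j (\<psi> i (\<phi> i x)) - \<phi> j x)) \<longlongrightarrow> 0)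
        (net_filter I le)"
      by (rule cbI[rule_format])
    then have "((\<lambda>i. cb_norm X (row_module (fst (t j)))
        (\<lambda>x. fst (snd (t j)) (snd (snd (t i)) (fst (snd (t i)) x)) - fst (snd (t j)) x)) \<longlongrightarrow> 0)
        (net_filter I le)"
      by (simp only: t_def fst_conv snd_conv)
    then show "((\<lambda>q. cb_norm X (row_module (fst (snd p)))
        (\<lambda>x. fst (snd (snd p)) (snd (snd (snd q)) (fst (snd (snd q)) x)) - fst (snd (snd p)) x))
        \<longlongrightarrow> 0) (net_filter J leJ)"
      unfolding j(2)
      by (rule tendsto_net_transfer[rotated, where t = t
        and g = "\<lambda>s. cb_norm X (row_module (fst (t j)))
        (\<lambda>x. fst (snd (t j)) (snd (snd s) (fst (snd s) x)) - fst (snd (t j)) x)"])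
        (rule ev)
  qed
  then show ?thesis using X unfolding rigged_def by (intro conjI exI)
qed


section \<open>The class of the approximation in modulus\<close>

text \<open>
  The lengths \<open>d n\<close> of the tuples may vary with \<open>n\<close>. The quotient is taken in \<open>ereal\<close>, where
  \<open>1 / 0 = \<infinity>\<close>.
\<close>

definition R_class_on :: "complex set \<Rightarrow> (complex \<Rightarrow> real) set" where
  "R_class_on E = {f. continuous_on circle f \<and> (\<forall>w\<in>circle. f w = 0 \<longleftrightarrow> w \<in> E) \<and>
     (\<exists>(d :: nat \<Rightarrow> nat) (H :: nat \<Rightarrow> nat \<Rightarrow> complex \<Rightarrow> complex) K.
        (\<forall>n. 1 \<le> d n \<and> (\<forall>k<d n. H n k \<in> disk_algebra \<and> K n k \<in> disk_algebra)) \<and>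
        (\<forall>n. \<forall>w\<in>circle. L2_set (\<lambda>k. cmod (K n k w)) {..<d n} \<le> f w \<and>
            ereal (f w) \<le> 1 / ereal (L2_set (\<lambda>k. cmod (H n k w)) {..<d n})) \<and>
        (\<forall>C. compact C \<and> C \<subseteq> circle - E \<longrightarrow>
            uniform_limit C (\<lambda>n w. \<Sum>k<d n. H n k w * K n k w) (\<lambda>_. 1) sequentially))}"

definition R_class :: "(complex \<Rightarrow> real) set" where
  "R_class = (\<Union>E\<in>{E. closed E \<and> E \<subseteq> circle}. R_class_on E)"

end

theory Submission
  imports Defs
begin

text \<open>
  Each condition on \<open>f \<noteq> 0\<close> is tied to the integrability of \<open>log f\<close>.

  If a nonzero bounded analytic function has boundary values of modulus at most \<open>f\<close>, then
  \<open>log f\<close> is integrable: continuous functions on the circle are uniformly close to real parts of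
  disk algebra functions, so the maximum principle for \<open>\<phi> exp (- F)\<close> with \<open>Re F\<close> close to
  \<open>log (|\<phi>| + \<epsilon>)\<close> gives Jensen's inequality. Conversely \<open>f\<close> is the modulus of the
  exponential of the Herglotz transform of \<open>log f\<close>, whose radial limits exist by Fatou's theorem.

  If \<open>log f\<close> is integrable, write \<open>log f\<close> as \<open>max (log f) (- n)\<close> minus the sum over
  \<open>k \<ge> n\<close> of the layers \<open>v\<^sub>k = max (log f) (- k) - max (log f) (- k - 1)\<close>. The dilated Herglotz
  transforms of the layers lie in the disk algebra, and they sum uniformly off the zeros of \<open>f\<close>,
  because the layers have summable means and supports shrinking to those zeros. Exponentiating
  gives tuples of length 1 showing that \<open>f\<close> belongs to the class \<open>R\<close>.

  Tuples \<open>H, K\<close> as in the class \<open>R\<close> yield the maps \<open>x \<mapsto> x K / f\<close> and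
  \<open>a \<mapsto> (a \<cdot> H) f\<close>. Replacing \<open>K\<close> by \<open>(H \<cdot> K) K\<close> makes \<open>K / f\<close> small near the zeros
  of \<open>f\<close>, which gives the convergence in completely bounded norm. Conversely, a contractive module
  map on the submodule generated by \<open>f\<close> sends \<open>f\<close> to a tuple of pointwise norm at most
  \<open>f\<close>, since \<open>1 / (f + \<epsilon>)\<close> is nearly the modulus of a disk algebra function; its nonzero
  entries make \<open>log f\<close> integrable.

  If \<open>x\<close> generates a rigged module, the pointwise norms of the tuples \<open>\<phi>\<^sub>\<alpha> x\<close> converge
  uniformly to their supremum \<open>f\<close>, and \<open>\<parallel>a x\<parallel> = sup |a| f\<close> for all \<open>a\<close>. Hence
  \<open>a x \<mapsto> a f\<close> extends to an isometry.
\<close>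

section \<open>Integration over the circle\<close>

text \<open>The obstacle is that the outer function with modulus \<open>f\<close> need not be
  continuous up to the circle, since the harmonic conjugate of a continuous function need not be
  continuous. In general no element of the disk algebra has modulus exactly \<open>f\<close>, so the
  argument works with approximation in modulus throughout. Dilated Herglotz transforms lie in the
  disk algebra and their real parts converge uniformly; their imaginary parts are under control only
  away from the support of the transformed function. This is why the unbounded part of
  \<open>log f\<close> is cut into layers that live near the zeros of \<open>f\<close>. The zero
  function stands apart: it generates the zero module, which is rigged, and it belongs to the class
  with \<open>E = circle\<close>, but its logarithm is not integrable. Integrability of the
  logarithm is therefore compared with riggedness for nonzero \<open>f\<close>.\<close>

lemma space_circle_measure: "space circle_measure = circle"
  by (simp add: circle_measure_def space_restrict_space)

lemma sets_circle_measure: "sets circle_measure = sets (restrict_space borel circle)"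
  by (simp add: circle_measure_def)

lemma measurable_cis_circle:
  "cis \<in> measurable (restrict_space lborel {0..<2*pi}) (restrict_space borel circle)"
proof (rule measurable_restrict_space2)
  have "cis \<in> borel_measurable borel"
    by (intro borel_measurable_continuous_onI continuous_intros)
  then show "cis \<in> borel_measurable (restrict_space lborel {0..<2*pi})"
    by (simp add: measurable_restrict_space1)
qed auto

lemma borel_measurable_circle_measure_cont:
  fixes g :: "complex \<Rightarrow> 'b::{topological_space}"
  assumes "continuous_on circle g"
  shows "g \<in> borel_measurable circle_measure"
  using borel_measurable_continuous_on_restrict[OF assms]
  by (simp add: measurable_cong_sets[OF sets_circle_measure refl])

lemma emeasure_circle_measure: "emeasure circle_measure circle = ennreal (2*pi)"
proof -
  have "emeasure circle_measure circle =
      emeasure (restrict_space lborel {0..<2*pi}) (cis -` circle \<inter> space (restrict_space lborel {0..<2*pi}))"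
    unfolding circle_measure_def
    by (subst emeasure_distr[OF measurable_cis_circle]) (auto simp: sets_restrict_space_iff)
  also have "cis -` circle \<inter> space (restrict_space lborel {0..<2*pi}) = {0..<2*pi}"
    by (auto simp: space_restrict_space)
  also have "emeasure (restrict_space lborel {0..<2*pi}) {0..<2*pi} = ennreal (2*pi)"
    by (subst emeasure_restrict_space) auto
  finally show ?thesis .
qed

lemma finite_measure_circle_measure: "finite_measure circle_measure"
  by (rule finite_measureI) (simp add: space_circle_measure emeasure_circle_measure)

interpretation CM: finite_measure circle_measure
  by (rule finite_measure_circle_measure)

lemma measure_circle_measure: "measure circle_measure circle = 2*pi"
  by (simp add: measure_def emeasure_circle_measure)

lemma integrable_circle_cont:
  fixes g :: "complex \<Rightarrow> 'b::{banach,second_countable_topology}"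
  assumes "continuous_on circle g"
  shows "integrable circle_measure g"
proof -
  have "compact (g ` circle)"
    using assms by (intro compact_continuous_image) auto
  then obtain B where B: "\<forall>x\<in>g ` circle. norm x \<le> B"
    using compact_imp_bounded bounded_iff by blast
  show ?thesis
    by (rule CM.integrable_const_bound[where B=B])
       (use B assms in \<open>auto simp: space_circle_measure intro!: borel_measurable_circle_measure_cont AE_I2\<close>)
qed

lemma integral_circle_eq:
  fixes g :: "complex \<Rightarrow> 'b::{banach,second_countable_topology}"
  assumes "g \<in> borel_measurable circle_measure"
  shows "(LINT w|circle_measure. g w) = (LINT t:{0..<2*pi}|lborel. g (cis t))"
proof -
  have "(LINT w|circle_measure. g w) = integral\<^sup>L (restrict_space lborel {0..<2*pi}) (\<lambda>t. g (cis t))"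
    unfolding circle_measure_def
    by (rule integral_distr[OF measurable_cis_circle])
       (use assms in \<open>simp add: measurable_cong_sets[OF sets_circle_measure refl]\<close>)
  also have "\<dots> = (LINT t:{0..<2*pi}|lborel. g (cis t))"
    unfolding set_lebesgue_integral_def by (rule integral_restrict_space) auto
  finally show ?thesis .
qed

lemma Arg2pi_cis: "0 \<le> t \<Longrightarrow> t < 2*pi \<Longrightarrow> Arg2pi (cis t) = t"
  by (rule Arg2pi_unique[of 1]) (auto simp: cis_conv_exp)

text \<open>\<open>Arg2pi\<close> jumps across the nonnegative real axis. That ray is closed and the
  function is constantly 0 on it, so measurability is glued from continuity on the ray and on its
  complement.\<close>

lemma borel_measurable_Arg2pi: "Arg2pi \<in> borel_measurable borel"
proof -
  have c: "closed (\<real>\<^sub>\<ge>\<^sub>0 :: complex set)"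
    by (rule closed_nonneg_Reals_complex)
  have "continuous_on (- \<real>\<^sub>\<ge>\<^sub>0) Arg2pi"
    by (intro continuous_at_imp_continuous_on ballI continuous_at_Arg2pi) auto
  moreover have "continuous_on \<real>\<^sub>\<ge>\<^sub>0 Arg2pi"
  proof (rule continuous_on_eq[of _ "\<lambda>_. 0"])
    fix x :: complex assume "x \<in> \<real>\<^sub>\<ge>\<^sub>0"
    then show "0 = Arg2pi x"
      by (auto elim!: nonneg_Reals_cases simp: Arg2pi_of_real)
  qed auto
  ultimately have "(\<lambda>z. if z \<in> - \<real>\<^sub>\<ge>\<^sub>0 then Arg2pi z else Arg2pi z) \<in> borel_measurable borel"
    using c by (intro borel_measurable_continuous_on_if) auto
  then show ?thesis by simp
qed

text \<open>\<open>cis\<close> on the parameter interval has the measurable inverse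
  \<open>Arg2pi\<close>, which carries a null set of parameters to a measurable null set on the
  circle. Pulling back along \<open>cis\<close> gives the other direction.\<close>

lemma AE_circle_measure_iff:
  "(AE w in circle_measure. P w) \<longleftrightarrow> (AE t in lborel. t \<in> {0..<2*pi} \<longrightarrow> P (cis t))"
proof
  assume "AE w in circle_measure. P w"
  then have "AE t in restrict_space lborel {0..<2*pi}. P (cis t)"
    unfolding circle_measure_def by (rule AE_distrD[OF measurable_cis_circle])
  then show "AE t in lborel. t \<in> {0..<2*pi} \<longrightarrow> P (cis t)"
    by (subst (asm) AE_restrict_space_iff) auto
next
  assume "AE t in lborel. t \<in> {0..<2*pi} \<longrightarrow> P (cis t)"
  then obtain N where N: "N \<in> null_sets lborel" "{t. \<not> (t \<in> {0..<2*pi} \<longrightarrow> P (cis t))} \<subseteq> N"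
    by (auto elim!: AE_E simp: null_sets_def)
  define N' where "N' = {w \<in> circle. Arg2pi w \<in> N}"
  have Nb: "N \<in> sets borel" using N by auto
  have "Arg2pi -` N \<inter> space borel \<in> sets borel"
    by (rule measurable_sets[OF borel_measurable_Arg2pi Nb])
  then have N's: "N' \<in> sets circle_measure"
    unfolding N'_def sets_circle_measure sets_restrict_space
    by (intro image_eqI[where x="Arg2pi -` N \<inter> space borel"]) auto
  have "emeasure circle_measure N' = emeasure (restrict_space lborel {0..<2*pi})
         (cis -` N' \<inter> space (restrict_space lborel {0..<2*pi}))"
    unfolding circle_measure_def
    by (subst emeasure_distr[OF measurable_cis_circle])
       (use N's in \<open>auto simp: sets_circle_measure\<close>)
  also have "cis -` N' \<inter> space (restrict_space lborel {0..<2*pi}) = N \<inter> {0..<2*pi}"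
    by (auto simp: space_restrict_space N'_def Arg2pi_cis)
  also have "emeasure (restrict_space lborel {0..<2*pi}) (N \<inter> {0..<2*pi}) = emeasure lborel (N \<inter> {0..<2*pi})"
    by (subst emeasure_restrict_space) auto
  also have "\<dots> = 0"
    using N(1) by (intro null_setsD1 null_set_Int2) auto
  finally have null: "N' \<in> null_sets circle_measure" using N's by auto
  show "AE w in circle_measure. P w"
  proof (rule AE_I'[OF null])
    show "{w \<in> space circle_measure. \<not> P w} \<subseteq> N'"
    proof
      fix w assume w: "w \<in> {w \<in> space circle_measure. \<not> P w}"
      then have w1: "w \<in> circle" "\<not> P w" by (auto simp: space_circle_measure)
      have "cis (Arg2pi w) = w"
        using w1(1) Arg2pi_eq[of w] by (simp add: cis_conv_exp)
      moreover have "Arg2pi w \<in> {0..<2*pi}" using Arg2pi_ge_0 Arg2pi_lt_2pi by auto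
      ultimately have "Arg2pi w \<in> N" using N(2) w1(2) by auto
      then show "w \<in> N'" using w1 by (simp add: N'_def)
    qed
  qed
qed

text \<open>Normalised so that constants are their own mean; holomorphic functions then have their
  value at 0 as mean.\<close>

definition cmean :: "(complex \<Rightarrow> 'b::{banach,second_countable_topology}) \<Rightarrow> 'b" where
  "cmean g = (LINT w|circle_measure. g w) /\<^sub>R (2*pi)"

lemma cmean_const: "cmean (\<lambda>_. c) = (c::'b::{banach,second_countable_topology})"
  by (simp add: cmean_def space_circle_measure measure_circle_measure)

text \<open>Joins two integrals: the measure on the circle comes from a half-open parameter
  interval, contour integrals from the Henstock-Kurzweil integral over the closed one. The
  additional endpoint is a null set.\<close>

lemma circle_integral_eq_integral:
  fixes g :: "complex \<Rightarrow> complex"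
  assumes "continuous_on circle g"
  shows "(LINT w|circle_measure. g w) = integral {0..2*pi} (\<lambda>t. g (cis t))"
proof -
  have c: "continuous_on {0..2*pi} (\<lambda>t. g (cis t))"
    by (rule continuous_on_compose2[OF assms]) (auto intro!: continuous_intros)
  have si: "set_integrable lborel {0..2*pi} (\<lambda>t. g (cis t))"
    unfolding set_integrable_def using c by (intro borel_integrable_compact) auto
  have "(LINT w|circle_measure. g w) = (LINT t:{0..<2*pi}|lborel. g (cis t))"
    by (intro integral_circle_eq borel_measurable_circle_measure_cont assms)
  also have "\<dots> = (LINT t:{0..2*pi}|lborel. g (cis t))"
    unfolding set_lebesgue_integral_def
  proof (rule integral_cong_AE)
    show "(\<lambda>t. indicat_real {0..<2*pi} t *\<^sub>R g (cis t)) \<in> borel_measurable lborel"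
      by (intro borel_measurable_integrable set_integrable_subset[OF si, of "{0..<2*pi}", unfolded set_integrable_def]) auto
    show "(\<lambda>t. indicat_real {0..2*pi} t *\<^sub>R g (cis t)) \<in> borel_measurable lborel"
      using si by (intro borel_measurable_integrable) (auto simp: set_integrable_def)
    show "AE t in lborel. indicat_real {0..<2*pi} t *\<^sub>R g (cis t) = indicat_real {0..2*pi} t *\<^sub>R g (cis t)"
      using AE_lborel_singleton[of "2*pi"] by eventually_elim (auto simp: indicator_def)
  qed
  also have "\<dots> = integral {0..2*pi} (\<lambda>t. g (cis t))"
    using si by (rule set_borel_integral_eq_integral)
  finally show ?thesis .
qed

text \<open>On the unit circle \<open>dw = i w dt\<close>, which is where the factor
  \<open>w\<close> inside the mean comes from. Cauchy's integral formulas become statements about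
  means through this identity.\<close>

lemma has_contour_integral_circle_cmean:
  assumes g: "continuous_on circle g"
  shows "(g has_contour_integral 2 * of_real pi * \<i> * cmean (\<lambda>w. w * g w)) (circlepath 0 1)"
proof -
  have c: "continuous_on circle (\<lambda>w. w * g w)" by (intro continuous_intros g)
  have ct: "continuous_on {0..2*pi} (\<lambda>t. cis t * g (cis t))"
    by (intro continuous_intros continuous_on_compose2[OF g]) auto
  have "((\<lambda>t. cis t * g (cis t)) has_integral (2 * of_real pi) * cmean (\<lambda>w. w * g w)) {0..2*pi}"
    using integrable_integral[OF integrable_continuous_interval[OF ct]]
    by (simp add: cmean_def circle_integral_eq_integral[OF c] scaleR_conv_of_real flip: mult.assoc)
  from has_integral_mult_right[OF this, of \<i>]
  have "((\<lambda>t. g (cis t) * \<i> * cis t) has_integral 2 * of_real pi * \<i> * cmean (\<lambda>w. w * g w)) {0..2*pi}"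
    by (simp add: mult_ac)
  then show ?thesis
    unfolding circlepath_def by (subst has_contour_integral_part_circlepath_iff) auto
qed

lemma cauchy_mean:
  assumes F: "continuous_on (cball 0 1) F" "F holomorphic_on ball 0 1" and z: "norm z < 1"
  shows "cmean (\<lambda>w. w / (w - z) * F w) = F z"
proof -
  have "((\<lambda>u. F u / (u - z)) has_contour_integral 2 * of_real pi * \<i> * F z) (circlepath 0 1)"
    by (rule Cauchy_integral_circlepath) (use assms in auto)
  moreover have "continuous_on circle (\<lambda>u. F u / (u - z))"
    using z by (auto intro!: continuous_intros continuous_on_subset[OF F(1)])
  from has_contour_integral_circle_cmean[OF this]
  have "((\<lambda>u. F u / (u - z)) has_contour_integral 2 * of_real pi * \<i> * cmean (\<lambda>w. w * (F w / (w - z)))) (circlepath 0 1)" .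
  ultimately have "2 * of_real pi * \<i> * F z = 2 * of_real pi * \<i> * cmean (\<lambda>w. w * (F w / (w - z)))"
    by (rule has_contour_integral_unique)
  then show ?thesis by simp
qed

lemma mean_value_holomorphic:
  assumes "continuous_on (cball 0 1) F" "F holomorphic_on ball 0 1"
  shows "cmean F = F 0"
proof -
  have "cmean (\<lambda>w. w / (w - 0) * F w) = cmean F"
    unfolding cmean_def
    by (subst Bochner_Integration.integral_cong) (auto simp: space_circle_measure)
  then show ?thesis using cauchy_mean[OF assms, of 0] by simp
qed

section \<open>The Herglotz transform\<close>

lemma cmean_Re:
  assumes "integrable circle_measure g"
  shows "Re (cmean g) = cmean (\<lambda>w. Re (g w))"
  using assms by (simp add: cmean_def)

lemma cmean_add:
  assumes "integrable circle_measure f" "integrable circle_measure g"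
  shows "cmean (\<lambda>w. f w + g w) = cmean f + cmean g"
  using assms by (simp add: cmean_def scaleR_add_right)

lemma cmean_diff:
  assumes "integrable circle_measure f" "integrable circle_measure g"
  shows "cmean (\<lambda>w. f w - g w) = cmean f - cmean g"
  using assms by (simp add: cmean_def scaleR_diff_right)

lemma cmean_mult_left:
  fixes c :: "'b::{real_normed_field,banach,second_countable_topology}"
  shows "cmean (\<lambda>w. c * f w) = c * cmean f"
  by (simp add: cmean_def)

lemma cmean_mono:
  fixes f g :: "complex \<Rightarrow> real"
  assumes "integrable circle_measure f" "integrable circle_measure g" "\<And>w. w \<in> circle \<Longrightarrow> f w \<le> g w"
  shows "cmean f \<le> cmean g"
  using assms by (auto simp: cmean_def space_circle_measure intro!: divide_right_mono integral_mono)

lemma cmean_norm_le: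
  assumes "integrable circle_measure f"
  shows "norm (cmean f) \<le> cmean (\<lambda>w. norm (f w))"
  using integral_norm_bound[of circle_measure f]
  by (auto simp: cmean_def intro!: mult_left_mono)

lemma cmean_cong:
  assumes "\<And>w. w \<in> circle \<Longrightarrow> f w = g w"
  shows "cmean f = cmean g"
  unfolding cmean_def using assms by (subst Bochner_Integration.integral_cong) (auto simp: space_circle_measure)

lemma cmean_le_bound:
  fixes f :: "complex \<Rightarrow> 'b::{banach,second_countable_topology}"
  assumes "integrable circle_measure f" "integrable circle_measure h" "\<And>w. w \<in> circle \<Longrightarrow> norm (f w) \<le> h w"
  shows "norm (cmean f) \<le> cmean h"
  by (rule order_trans[OF cmean_norm_le[OF assms(1)] cmean_mono[OF integrable_norm[OF assms(1)] assms(2,3)]])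

lemma integrable_circle_mult_cont:
  fixes u :: "complex \<Rightarrow> real" and g :: "complex \<Rightarrow> complex"
  assumes "integrable circle_measure u" "continuous_on circle g"
  shows "integrable circle_measure (\<lambda>w. g w * of_real (u w))"
proof -
  have "compact (g ` circle)"
    using assms by (intro compact_continuous_image) auto
  then obtain B where B: "\<forall>x\<in>g ` circle. norm x \<le> B"
    using compact_imp_bounded bounded_iff by blast
  have [measurable]: "g \<in> borel_measurable circle_measure" "u \<in> borel_measurable circle_measure"
    using assms by (auto intro: borel_measurable_circle_measure_cont)
  show ?thesis
  proof (rule Bochner_Integration.integrable_bound)
    show "integrable circle_measure (\<lambda>w. B * u w)" using assms by auto
    show "AE x in circle_measure. norm (g x * complex_of_real (u x)) \<le> norm (B * u x)"
    proof (rule AE_I2)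
      fix x assume "x \<in> space circle_measure"
      then have "norm (g x) \<le> B" using B by (auto simp: space_circle_measure)
      then show "norm (g x * complex_of_real (u x)) \<le> norm (B * u x)"
        by (simp add: norm_mult abs_mult mult_right_mono)
    qed
  qed measurable
qed

lemma integrable_circle_mult_cont_real:
  fixes u g :: "complex \<Rightarrow> real"
  assumes "integrable circle_measure u" "continuous_on circle g"
  shows "integrable circle_measure (\<lambda>w. g w * u w)"
  using integrable_Re[OF integrable_circle_mult_cont[OF assms(1), of "\<lambda>w. of_real (g w)"]] assms(2)
  by (simp add: continuous_on_of_real)

text \<open>The Herglotz transform. Its real part in the open disk is the Poisson integral of
  \<open>u\<close>, so its exponential is a holomorphic function whose modulus on the circle is
  prescribed by \<open>u\<close>.\<close>

definition herglotz :: "(complex \<Rightarrow> real) \<Rightarrow> complex \<Rightarrow> complex" where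
  "herglotz u z = cmean (\<lambda>w. (w + z) / (w - z) * of_real (u w))"

text \<open>The Poisson kernel, written as a real part to match the Herglotz kernel;
  \<open>poisson_eq\<close> recovers the usual quotient for \<open>w\<close> on the circle.\<close>

definition poisson :: "complex \<Rightarrow> complex \<Rightarrow> real" where
  "poisson z w = Re ((w + z) / (w - z))"

lemma continuous_on_herglotz_kernel:
  "norm z < 1 \<Longrightarrow> continuous_on circle (\<lambda>w. (w + z) / (w - z))"
  by (auto intro!: continuous_intros)

lemma continuous_on_poisson: "norm z < 1 \<Longrightarrow> continuous_on circle (poisson z)"
  unfolding poisson_def by (intro continuous_on_Re continuous_on_herglotz_kernel)

lemma poisson_eq:
  assumes "norm w = 1"
  shows "poisson z w = (1 - (norm z)\<^sup>2) / (norm (w - z))\<^sup>2"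
proof -
  have "(w + z) / (w - z) = (w + z) * cnj (w - z) / (of_real ((norm (w - z))\<^sup>2))"
    by (cases "w = z") (simp_all only: complex_norm_square, simp_all)
  then have "poisson z w = Re ((w + z) * cnj (w - z)) / (norm (w - z))\<^sup>2"
    unfolding poisson_def by (simp only: Re_divide_of_real)
  also have "Re ((w + z) * cnj (w - z)) = (norm w)\<^sup>2 - (norm z)\<^sup>2"
    by (simp only: cmod_power2) (simp add: algebra_simps power2_eq_square)
  finally show ?thesis using assms by simp
qed

lemma poisson_nonneg: "norm w = 1 \<Longrightarrow> norm z < 1 \<Longrightarrow> 0 \<le> poisson z w"
  by (simp add: poisson_eq power_le_one)

text \<open>As a function of \<open>w\<close>, \<open>F\<close> is holomorphic with value 1 at the
  origin, and on the circle its conjugate is the Herglotz kernel because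
  \<open>cnj w = 1 / w\<close>. The mean value property then gives the total mass 1.\<close>

lemma cmean_poisson:
  assumes "norm z < 1"
  shows "cmean (poisson z) = 1"
proof -
  define F where "F = (\<lambda>w. (1 + cnj z * w) / (1 - cnj z * w))"
  have ne: "1 - cnj z * w \<noteq> 0" if "norm w \<le> 1" for w
  proof
    assume "1 - cnj z * w = 0"
    then have "norm (cnj z * w) = 1" by (metis eq_iff_diff_eq_0 norm_one)
    moreover have "norm (cnj z * w) \<le> norm z * 1"
      unfolding norm_mult using that by (intro mult_mono) auto
    ultimately show False using assms by simp
  qed
  have c: "continuous_on (cball 0 1) F" unfolding F_def using ne by (auto intro!: continuous_intros)
  have h: "F holomorphic_on ball 0 1" unfolding F_def using ne by (auto intro!: holomorphic_intros)
  have "cmean F = 1" using mean_value_holomorphic[OF c h] by (simp add: F_def)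
  moreover have "integrable circle_measure F"
    by (rule integrable_circle_cont, rule continuous_on_subset[OF c]) auto
  ultimately have "cmean (\<lambda>w. Re (F w)) = 1" by (metis cmean_Re one_complex.sel(1))
  moreover have "Re (F w) = poisson z w" if w: "w \<in> circle" for w
  proof -
    have w1: "cnj w * w = 1" "w * cnj w = 1" using w complex_norm_square[of w] by (auto simp: mult.commute)
    have "cnj (F w) = (1 + z * cnj w) / (1 - z * cnj w)" by (simp add: F_def)
    also have "\<dots> = ((1 + z * cnj w) * w) / ((1 - z * cnj w) * w)"
      using w by (subst mult_divide_mult_cancel_right) auto
    also have "\<dots> = (w + z) / (w - z)"
    proof -
      have "(1 + z * cnj w) * w = w + z * (cnj w * w)" "(1 - z * cnj w) * w = w - z * (cnj w * w)"
        by (simp_all add: algebra_simps)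
      then show ?thesis by (simp only: w1 mult_1_right)
    qed
    finally have "Re (cnj (F w)) = poisson z w" by (simp add: poisson_def)
    then show ?thesis by simp
  qed
  ultimately show ?thesis using cmean_cong[of "\<lambda>w. Re (F w)" "poisson z"] by simp
qed

lemma integrable_herglotz:
  assumes "integrable circle_measure u" "norm z < 1"
  shows "integrable circle_measure (\<lambda>w. (w + z) / (w - z) * of_real (u w))"
  by (intro integrable_circle_mult_cont assms continuous_on_herglotz_kernel)

lemma Re_herglotz:
  assumes "integrable circle_measure u" "norm z < 1"
  shows "Re (herglotz u z) = cmean (\<lambda>w. poisson z w * u w)"
  unfolding herglotz_def poisson_def
  by (subst cmean_Re[OF integrable_herglotz[OF assms]]) (simp only: times_complex.sel Re_complex_of_real Im_complex_of_real mult_zero_right diff_zero)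

text \<open>The kernel equals \<open>2 / (1 - z / w) - 1\<close>: subtracting 1 from twice a
  geometric series turns its constant coefficient 2 into 1.\<close>

lemma herglotz_kernel_sums:
  fixes w z :: complex
  assumes "norm w = 1" "norm z < 1"
  shows "(\<lambda>n. (if n = 0 then 1 else 2) * (z / w) ^ n) sums ((w + z) / (w - z))"
proof -
  have w: "w \<noteq> 0" "w \<noteq> z" using assms by auto
  have lt: "norm (z / w) < 1" using assms by (simp add: norm_divide)
  have "(\<lambda>n. 2 * (z / w) ^ n - (if n = 0 then 1 else 0)) sums (2 * (1 / (1 - z / w)) - 1)"
    using sums_single[of 0 "\<lambda>_. 1::complex"]
    by (intro sums_diff sums_mult geometric_sums lt) (simp add: eq_commute)
  moreover have "2 * (1 / (1 - z / w)) - 1 = (w + z) / (w - z)"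
    using w by (simp add: field_simps)
  moreover have "(\<lambda>n. 2 * (z / w) ^ n - (if n = 0 then 1 else 0)) =
      (\<lambda>n. (if n = 0 then 1 else 2) * (z / w) ^ n)"
    by (rule ext) simp
  ultimately show ?thesis by simp
qed

text \<open>The series of the integrand is dominated by \<open>2 * norm z ^ n * |u w|\<close>, so it
  can be integrated term by term. The resulting power series is what makes the transform
  holomorphic.\<close>

lemma herglotz_sums:
  assumes u: "integrable circle_measure u" and z: "norm z < 1"
  shows "(\<lambda>n. cmean (\<lambda>w. (if n = 0 then 1 else 2) * (1 / w) ^ n * of_real (u w)) * z ^ n)
           sums herglotz u z"
proof -
  define f where "f = (\<lambda>n w. (if n = 0 then 1 else 2) * (z / w) ^ n * complex_of_real (u w))"
  have fi: "integrable circle_measure (f n)" for n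
    unfolding f_def using u by (intro integrable_circle_mult_cont) (auto intro!: continuous_intros)
  have nf: "norm (f n w) \<le> 2 * norm z ^ n * \<bar>u w\<bar>" if "w \<in> circle" for n w
    using that by (simp add: f_def norm_mult norm_divide norm_power)
  have geo: "summable (\<lambda>n. 2 * norm z ^ n * c)" for c :: real
    using z by (intro summable_mult summable_mult2 summable_geometric) auto
  have s1: "AE w in circle_measure. summable (\<lambda>n. norm (f n w))"
    using nf by (intro AE_I2 summable_comparison_test'[OF geo]) (auto simp: space_circle_measure)
  have "(LINT w|circle_measure. norm (f n w)) \<le> 2 * norm z ^ n * (LINT w|circle_measure. \<bar>u w\<bar>)" for n
  proof -
    have "(LINT w|circle_measure. norm (f n w)) \<le> (LINT w|circle_measure. 2 * norm z ^ n * \<bar>u w\<bar>)"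
      using fi u nf by (intro integral_mono) (auto simp: space_circle_measure)
    then show ?thesis by simp
  qed
  then have s2: "summable (\<lambda>n. LINT w|circle_measure. norm (f n w))"
    by (intro summable_comparison_test'[OF geo]) auto
  have "(\<lambda>n. integral\<^sup>L circle_measure (f n)) sums (LINT w|circle_measure. (\<Sum>n. f n w))"
    by (rule sums_integral[OF fi s1 s2])
  also have "(LINT w|circle_measure. (\<Sum>n. f n w)) =
      (LINT w|circle_measure. (w + z) / (w - z) * of_real (u w))"
  proof (rule Bochner_Integration.integral_cong)
    fix w assume "w \<in> space circle_measure"
    then have "norm w = 1" by (auto simp: space_circle_measure)
    from sums_mult2[OF herglotz_kernel_sums[OF this z], of "of_real (u w)"]
    show "(\<Sum>n. f n w) = (w + z) / (w - z) * complex_of_real (u w)"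
      by (simp add: f_def sums_iff)
  qed auto
  finally have "(\<lambda>n. integral\<^sup>L circle_measure (f n) /\<^sub>R (2*pi)) sums herglotz u z"
    unfolding herglotz_def cmean_def by (rule sums_scaleR_right)
  moreover have "integral\<^sup>L circle_measure (f n) /\<^sub>R (2*pi) =
      cmean (\<lambda>w. (if n = 0 then 1 else 2) * (1 / w) ^ n * of_real (u w)) * z ^ n" for n
  proof -
    have "f n = (\<lambda>w. z ^ n * ((if n = 0 then 1 else 2) * (1 / w) ^ n * of_real (u w)))"
      by (simp add: f_def power_divide fun_eq_iff)
    then show ?thesis by (simp add: cmean_def del: power_one_over)
  qed
  ultimately show ?thesis by simp
qed

lemma holomorphic_herglotz:
  assumes "integrable circle_measure u"
  shows "herglotz u holomorphic_on ball 0 1"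
proof (rule power_series_holomorphic)
  fix w :: complex assume "w \<in> ball 0 1"
  then show "(\<lambda>n. cmean (\<lambda>v. (if n = 0 then 1 else 2) * (1 / v) ^ n * of_real (u v)) * (w - 0) ^ n)
      sums herglotz u w"
    using herglotz_sums[OF assms, of w] by simp
qed

text \<open>Passing from \<open>z\<close> to \<open>r * z\<close> moves it by at most
  \<open>1 - r\<close>, and \<open>1 - r\<close> is itself at most the distance from
  \<open>w\<close> to the new point. Kernels at \<open>r * z\<close> can thus be estimated by
  distances to \<open>z\<close>, uniformly in \<open>r\<close>.\<close>

lemma norm_diff_radius:
  fixes w z :: complex
  assumes "norm w = 1" "norm z \<le> 1" "0 \<le> r" "r \<le> 1"
  shows "norm (w - z) \<le> 2 * norm (w - of_real r * z)"
proof -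
  have rz: "norm (of_real r * z) \<le> r"
    using assms mult_left_le[of "norm z" r] by (simp add: norm_mult)
  have "1 - r \<le> norm (w - of_real r * z)"
    using norm_triangle_ineq2[of w "of_real r * z"] assms rz by linarith
  moreover have "norm (w - z) \<le> norm (w - of_real r * z) + norm (of_real r * z - z)"
    using norm_triangle_ineq[of "w - of_real r * z" "of_real r * z - z"] by simp
  moreover have "norm (of_real r * z - z) = (1 - r) * norm z"
  proof -
    have "of_real r * z - z = - (of_real (1 - r) * z)" by (simp add: algebra_simps)
    then show ?thesis using assms by (simp add: norm_mult del: of_real_diff)
  qed
  moreover have "(1 - r) * norm z \<le> 1 - r"
    using assms by (intro mult_left_le) auto
  ultimately show ?thesis by linarith
qed

text \<open>The constant 8 is 2 from \<open>1 - r^2 \<le> 2 * (1 - r)\<close> times 4 from halving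
  the distance in the squared denominator.\<close>

lemma poisson_le:
  assumes "norm w = 1" "norm w0 = 1" "0 \<le> r" "r < 1" "0 < d" "d \<le> norm (w - w0)"
  shows "poisson (of_real r * w0) w \<le> 8 * (1 - r) / d\<^sup>2"
proof -
  have h: "d / 2 \<le> norm (w - of_real r * w0)"
    using norm_diff_radius[of w w0 r] assms by linarith
  have "poisson (of_real r * w0) w = (1 - r\<^sup>2) / (norm (w - of_real r * w0))\<^sup>2"
    using assms by (simp add: poisson_eq norm_mult)
  also have "\<dots> \<le> (1 - r\<^sup>2) / (d / 2)\<^sup>2"
    using h assms by (intro divide_left_mono power_mono mult_pos_pos) (auto simp: power_le_one)
  also have "\<dots> \<le> (2 * (1 - r)) / (d / 2)\<^sup>2"
  proof (intro divide_right_mono)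
    have "1 - r\<^sup>2 = (1 + r) * (1 - r)" by (simp add: algebra_simps power2_eq_square)
    also have "\<dots> \<le> 2 * (1 - r)" using assms by (intro mult_right_mono) auto
    finally show "1 - r\<^sup>2 \<le> 2 * (1 - r)" .
  qed auto
  also have "\<dots> = 8 * (1 - r) / d\<^sup>2" by (simp add: power2_eq_square)
  finally show ?thesis .
qed

text \<open>The kernel has total mass 1, so points within \<open>d\<close> of \<open>w0\<close>
  contribute at most \<open>e\<close>; elsewhere it is at most \<open>8 * (1 - r) / d^2\<close>.
  Closeness is asked for near the single point \<open>w0\<close> only, so the bound serves for
  continuous \<open>u\<close> as well as for merely integrable \<open>u\<close>.\<close>

lemma herglotz_radial_approx:
  assumes u: "integrable circle_measure u" and w0: "w0 \<in> circle" and r: "0 \<le> r" "r < 1" and d: "0 < d"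
    and close: "\<And>w. w \<in> circle \<Longrightarrow> norm (w - w0) < d \<Longrightarrow> \<bar>u w - u w0\<bar> \<le> e" and e: "0 \<le> e"
  shows "\<bar>Re (herglotz u (of_real r * w0)) - u w0\<bar> \<le> e + 8 * (1 - r) / d\<^sup>2 * (cmean (\<lambda>w. \<bar>u w\<bar>) + \<bar>u w0\<bar>)"
proof -
  let ?z = "of_real r * w0"
  let ?c = "8 * (1 - r) / d\<^sup>2"
  have z: "norm ?z < 1" using w0 r by (simp add: norm_mult)
  have c0: "0 \<le> ?c" using r by simp
  have ip: "integrable circle_measure (poisson ?z)"
    by (intro integrable_circle_cont continuous_on_poisson z)
  have ipu: "integrable circle_measure (\<lambda>w. poisson ?z w * u w)"
    by (intro integrable_circle_mult_cont_real u continuous_on_poisson z)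
  have "Re (herglotz u ?z) - u w0 = cmean (\<lambda>w. poisson ?z w * u w) - cmean (\<lambda>w. u w0 * poisson ?z w)"
    by (simp add: Re_herglotz[OF u z] cmean_mult_left cmean_poisson[OF z])
  also have "\<dots> = cmean (\<lambda>w. poisson ?z w * u w - u w0 * poisson ?z w)"
    by (subst cmean_diff) (use ip ipu in auto)
  also have "norm \<dots> \<le> cmean (\<lambda>w. e * poisson ?z w + ?c * (\<bar>u w\<bar> + \<bar>u w0\<bar>))"
  proof (rule cmean_le_bound)
    show "integrable circle_measure (\<lambda>w. poisson ?z w * u w - u w0 * poisson ?z w)"
      using ip ipu by auto
    show "integrable circle_measure (\<lambda>w. e * poisson ?z w + ?c * (\<bar>u w\<bar> + \<bar>u w0\<bar>))"
      using ip u integrable_circle_cont[of "\<lambda>_. \<bar>u w0\<bar>"]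
      by (intro Bochner_Integration.integrable_add integrable_mult_right) auto
    fix w assume w: "w \<in> circle"
    have P0: "0 \<le> poisson ?z w" using w z by (intro poisson_nonneg) auto
    have "norm (poisson ?z w * u w - u w0 * poisson ?z w) = poisson ?z w * \<bar>u w - u w0\<bar>"
    proof -
      have "poisson ?z w * u w - u w0 * poisson ?z w = poisson ?z w * (u w - u w0)"
        by (simp add: right_diff_distrib)
      then show ?thesis using P0 by (simp only: real_norm_def abs_mult abs_of_nonneg)
    qed
    also have "\<dots> \<le> e * poisson ?z w + ?c * (\<bar>u w\<bar> + \<bar>u w0\<bar>)"
    proof (cases "norm (w - w0) < d")
      case True
      then have "poisson ?z w * \<bar>u w - u w0\<bar> \<le> poisson ?z w * e"
        using close[OF w] P0 by (intro mult_left_mono) auto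
      moreover have "0 \<le> ?c * (\<bar>u w\<bar> + \<bar>u w0\<bar>)" using c0 by (intro mult_nonneg_nonneg) auto
      ultimately show ?thesis unfolding mult.commute[of e] by linarith
    next
      case False
      then have "poisson ?z w \<le> ?c" using w w0 r d by (intro poisson_le) auto
      then have "poisson ?z w * \<bar>u w - u w0\<bar> \<le> ?c * (\<bar>u w\<bar> + \<bar>u w0\<bar>)"
        using c0 by (intro mult_mono) auto
      moreover have "0 \<le> e * poisson ?z w" using e P0 by (intro mult_nonneg_nonneg)
      ultimately show ?thesis by linarith
    qed
    finally show "norm (poisson ?z w * u w - u w0 * poisson ?z w) \<le> e * poisson ?z w + ?c * (\<bar>u w\<bar> + \<bar>u w0\<bar>)" .
  qed
  also have "\<dots> = e + ?c * (cmean (\<lambda>w. \<bar>u w\<bar>) + \<bar>u w0\<bar>)"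
  proof -
    have "cmean (\<lambda>w. \<bar>u w\<bar> + \<bar>u w0\<bar>) = cmean (\<lambda>w. \<bar>u w\<bar>) + \<bar>u w0\<bar>"
      using u integrable_circle_cont[of "\<lambda>_. \<bar>u w0\<bar>"] by (subst cmean_add) (auto simp: cmean_const)
    moreover have "cmean (\<lambda>w. e * poisson ?z w + ?c * (\<bar>u w\<bar> + \<bar>u w0\<bar>)) =
        cmean (\<lambda>w. e * poisson ?z w) + cmean (\<lambda>w. ?c * (\<bar>u w\<bar> + \<bar>u w0\<bar>))"
      using ip u integrable_circle_cont[of "\<lambda>_. \<bar>u w0\<bar>"]
      by (intro cmean_add integrable_mult_right Bochner_Integration.integrable_add) auto
    ultimately show ?thesis
      by (simp only: cmean_mult_left cmean_poisson[OF z] mult_1_right)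
  qed
  finally show ?thesis by simp
qed

text \<open>Where \<open>u\<close> is nonzero, \<open>w\<close> has distance at least
  \<open>d / 2\<close> from the dilated point, so the kernel is at most \<open>2 / (d / 2)\<close>.
  Unlike an estimate of the Poisson kernel this controls the imaginary part too, and it does not
  depend on \<open>r\<close>.\<close>

lemma herglotz_bound_off_support:
  assumes u: "integrable circle_measure u" and z: "norm z = 1" and r: "0 \<le> r" "r < 1" and d: "0 < d"
    and supp: "\<And>w. w \<in> circle \<Longrightarrow> norm (w - z) < d \<Longrightarrow> u w = 0"
  shows "norm (herglotz u (of_real r * z)) \<le> 4 / d * cmean (\<lambda>w. \<bar>u w\<bar>)"
proof -
  have z1: "norm (of_real r * z) < 1" using z r by (simp add: norm_mult)
  have "norm (herglotz u (of_real r * z)) \<le> cmean (\<lambda>w. 4 / d * \<bar>u w\<bar>)"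
    unfolding herglotz_def
  proof (rule cmean_le_bound[OF integrable_herglotz[OF u z1]])
    show "integrable circle_measure (\<lambda>w. 4 / d * \<bar>u w\<bar>)" using u by auto
    fix w assume w: "w \<in> circle"
    show "norm ((w + of_real r * z) / (w - of_real r * z) * of_real (u w)) \<le> 4 / d * \<bar>u w\<bar>"
    proof (cases "norm (w - z) < d")
      case True then show ?thesis using supp[OF w] by simp
    next
      case False
      have "d / 2 \<le> norm (w - of_real r * z)"
        using norm_diff_radius[of w z r] w z r False by auto
      moreover have "norm (w + of_real r * z) \<le> 2"
        using norm_triangle_ineq[of w "of_real r * z"] w z1 by auto
      ultimately have "norm (w + of_real r * z) / norm (w - of_real r * z) \<le> 2 / (d / 2)"
        using d by (intro frac_le) auto
      from mult_right_mono[OF this abs_ge_zero[of "u w"]]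
      show ?thesis by (simp add: norm_mult norm_divide)
    qed
  qed
  then show ?thesis by (simp only: cmean_mult_left)
qed

lemma holomorphic_herglotz_dilate:
  assumes u: "integrable circle_measure u" and r: "0 < r" "r < 1"
  shows "(\<lambda>z. herglotz u (of_real r * z)) holomorphic_on ball 0 (1 / r)"
proof -
  have "(herglotz u \<circ> (\<lambda>z. of_real r * z)) holomorphic_on ball 0 (1 / r)"
    by (rule holomorphic_on_compose_gen[OF _ holomorphic_herglotz[OF u]])
       (use r in \<open>auto intro!: holomorphic_intros simp: norm_mult field_simps\<close>)
  then show ?thesis by (simp add: o_def)
qed

text \<open>Uniform continuity supplies one \<open>d\<close>, and boundedness one error factor
  \<open>C\<close>, for all points of the circle at once; a radius close to 1 then makes the far
  part of the Poisson integral small everywhere.\<close>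

lemma herglotz_dilate_approx:
  assumes u: "continuous_on circle u" and e: "0 < e"
  obtains r where "0 < r" "r < 1"
    "\<And>w. w \<in> circle \<Longrightarrow> \<bar>Re (herglotz u (of_real r * w)) - u w\<bar> < e"
proof -
  have ui: "integrable circle_measure u" by (rule integrable_circle_cont[OF u])
  have "uniformly_continuous_on circle u"
    by (rule compact_uniformly_continuous[OF u]) auto
  then obtain d where d: "0 < d" "\<And>w w'. w \<in> circle \<Longrightarrow> w' \<in> circle \<Longrightarrow> dist w' w < d \<Longrightarrow> dist (u w') (u w) < e / 2"
    unfolding uniformly_continuous_on_def using e by (metis half_gt_zero)
  have "compact (u ` circle)"
    using u by (intro compact_continuous_image) auto
  then obtain B where B: "\<And>w. w \<in> circle \<Longrightarrow> \<bar>u w\<bar> \<le> B"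
    using compact_imp_bounded bounded_iff by (metis imageI real_norm_def)
  define C where "C = cmean (\<lambda>w. \<bar>u w\<bar>) + B"
  have C: "0 \<le> C"
  proof -
    have "0 \<le> B" using B[of 1] by simp
    moreover have "cmean (\<lambda>w. 0::real) \<le> cmean (\<lambda>w. \<bar>u w\<bar>)"
      using ui by (intro cmean_mono) auto
    ultimately show ?thesis by (simp add: C_def cmean_const)
  qed
  have "((\<lambda>r. e / 2 + 8 * (1 - r) / d\<^sup>2 * C) \<longlongrightarrow> e / 2 + 8 * (1 - 1) / d\<^sup>2 * C) (at_left 1)"
    by (intro tendsto_intros) (use d in auto)
  then have "eventually (\<lambda>r. e / 2 + 8 * (1 - r) / d\<^sup>2 * C < e) (at_left 1)"
    by (rule order_tendstoD) (use e in auto)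
  moreover have "eventually (\<lambda>r::real. r \<in> {0<..<1}) (at_left 1)"
    by (rule eventually_at_left_real) simp
  ultimately have "eventually (\<lambda>r. e / 2 + 8 * (1 - r) / d\<^sup>2 * C < e \<and> r \<in> {0<..<1}) (at_left 1)"
    by (rule eventually_conj)
  then obtain r where r: "e / 2 + 8 * (1 - r) / d\<^sup>2 * C < e" "0 < r" "r < 1"
    using eventually_happens trivial_limit_at_left_real by fastforce
  show ?thesis
  proof (rule that[OF r(2,3)])
    fix w assume w: "w \<in> circle"
    have "\<bar>Re (herglotz u (of_real r * w)) - u w\<bar> \<le> e / 2 + 8 * (1 - r) / d\<^sup>2 * (cmean (\<lambda>w. \<bar>u w\<bar>) + \<bar>u w\<bar>)"
    proof (rule herglotz_radial_approx[OF ui w _ r(3) d(1)])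
      fix w' assume "w' \<in> circle" "norm (w' - w) < d"
      then show "\<bar>u w' - u w\<bar> \<le> e / 2" using d(2)[OF w, of w'] by (simp add: dist_norm)
    qed (use r e in auto)
    also have "\<dots> \<le> e / 2 + 8 * (1 - r) / d\<^sup>2 * C"
      using B[OF w] r by (intro add_left_mono mult_left_mono) (auto simp: C_def)
    finally show "\<bar>Re (herglotz u (of_real r * w)) - u w\<bar> < e" using r(1) by linarith
  qed
qed

text \<open>Functions on the closed disk, unlike the elements of \<open>disk_algebra\<close>, which
  vanish off the circle: the maximum principle evaluates at interior points. \<open>circ\<close>
  translates to \<open>disk_algebra\<close>.\<close>

definition in_A :: "(complex \<Rightarrow> complex) \<Rightarrow> bool" where
  "in_A F \<longleftrightarrow> continuous_on (cball 0 1) F \<and> F holomorphic_on ball 0 1"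

lemma in_A_herglotz_dilate:
  assumes "integrable circle_measure u" "0 < r" "r < 1"
  shows "in_A (\<lambda>z. herglotz u (of_real r * z))"
proof -
  note h = holomorphic_herglotz_dilate[OF assms]
  have "cball 0 1 \<subseteq> ball (0::complex) (1 / r)" 
  proof
    fix z :: complex assume "z \<in> cball 0 1"
    moreover have "1 < 1 / r" using assms by simp
    ultimately show "z \<in> ball 0 (1 / r)" by simp
  qed
  then show ?thesis unfolding in_A_def
    using h by (meson ball_subset_cball holomorphic_on_imp_continuous_on holomorphic_on_subset order_trans)
qed

text \<open>Adding \<open>e / 2\<close> to a two-sided approximation with error \<open>e / 2\<close>
  makes it one-sided, so that \<open>exp (- F)\<close> has modulus at most \<open>exp (- u)\<close>
  without an error factor.\<close>

lemma Re_approx_in_A: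
  fixes u :: "complex \<Rightarrow> real"
  assumes "continuous_on circle u" "0 < e"
  obtains F where "in_A F" "\<And>w. w \<in> circle \<Longrightarrow> u w \<le> Re (F w)" "\<And>w. w \<in> circle \<Longrightarrow> Re (F w) \<le> u w + e"
proof -
  obtain r where r: "0 < r" "r < 1"
    "\<And>w. w \<in> circle \<Longrightarrow> \<bar>Re (herglotz u (of_real r * w)) - u w\<bar> < e / 2"
    using herglotz_dilate_approx[OF assms(1), of "e / 2"] assms(2) by auto
  define F where "F = (\<lambda>z. herglotz u (of_real r * z) + of_real (e / 2))"
  have "in_A F"
    using in_A_herglotz_dilate[OF integrable_circle_cont[OF assms(1)] r(1,2)]
    unfolding in_A_def F_def by (auto intro!: continuous_intros holomorphic_intros)
  moreover have "u w \<le> Re (F w) \<and> Re (F w) \<le> u w + e" if "w \<in> circle" for w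
    using r(3)[OF that] unfolding F_def plus_complex.sel Re_complex_of_real by arith
  ultimately show ?thesis using that by blast
qed

section \<open>Jensen's inequality\<close>

text \<open>On the circle the Poisson kernel is the sum of the Cauchy kernel
  \<open>w / (w - z)\<close> and of \<open>cnj z * w / (1 - cnj z * w)\<close>. The second summand
  times \<open>F\<close> is holomorphic and vanishes at 0, so only Cauchy's formula
  contributes.\<close>

lemma poisson_formula:
  assumes F: "in_A F" and z: "norm z < 1"
  shows "cmean (\<lambda>w. of_real (poisson z w) * F w) = F z"
proof -
  have Fc: "continuous_on (cball 0 1) F" and Fh: "F holomorphic_on ball 0 1"
    using F by (auto simp: in_A_def)
  have Fcc: "continuous_on circle F" by (rule continuous_on_subset[OF Fc]) auto
  have ne: "1 - cnj z * w \<noteq> 0" if "norm w \<le> 1" for w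
  proof
    assume "1 - cnj z * w = 0"
    then have "norm (cnj z * w) = 1" by (metis eq_iff_diff_eq_0 norm_one)
    moreover have "norm (cnj z * w) \<le> norm z * 1"
      unfolding norm_mult using that by (intro mult_mono) auto
    ultimately show False using z by simp
  qed
  define G where "G = (\<lambda>w. cnj z * w / (1 - cnj z * w) * F w)"
  have Gc: "continuous_on (cball 0 1) G" unfolding G_def using ne Fc by (auto intro!: continuous_intros)
  have Gh: "G holomorphic_on ball 0 1" unfolding G_def using ne Fh by (auto intro!: holomorphic_intros)
  have ci: "continuous_on circle (\<lambda>w. w / (w - z) * F w)"
    using z Fcc by (auto intro!: continuous_intros)
  have "of_real (poisson z w) * F w = w / (w - z) * F w + G w" if w: "w \<in> circle" for w
  proof -
    have w1: "w * cnj w = 1" using w complex_norm_square[of w] by auto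
    have wz: "w \<noteq> z" "w \<noteq> 0" using w z by auto
    have q: "1 - cnj z * w = w * cnj (w - z)" using w1 by (simp add: algebra_simps)
    have "of_real (poisson z w) = (1 - of_real ((norm z)\<^sup>2)) / (of_real ((norm (w - z))\<^sup>2) :: complex)"
      using w by (simp add: poisson_eq)
    also have "\<dots> = (w * cnj w - z * cnj z) / ((w - z) * cnj (w - z))"
      by (simp only: complex_norm_square w1)
    also have "\<dots> = (w * cnj (w - z) + cnj z * (w - z)) / ((w - z) * cnj (w - z))"
      by (simp add: algebra_simps)
    also have "\<dots> = w / (w - z) + cnj z * w / (1 - cnj z * w)"
      unfolding q using wz by (simp add: add_divide_distrib)
    finally show ?thesis by (simp add: G_def algebra_simps)
  qed
  then have "cmean (\<lambda>w. of_real (poisson z w) * F w) = cmean (\<lambda>w. w / (w - z) * F w + G w)"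
    by (rule cmean_cong)
  also have "\<dots> = cmean (\<lambda>w. w / (w - z) * F w) + cmean G"
    by (intro cmean_add integrable_circle_cont ci continuous_on_subset[OF Gc]) auto
  also have "\<dots> = F z"
    by (subst cauchy_mean[OF Fc Fh z], subst mean_value_holomorphic[OF Gc Gh]) (simp add: G_def)
  finally show ?thesis .
qed

lemma Re_poisson_formula:
  assumes F: "in_A F" and z: "norm z < 1"
  shows "Re (F z) = cmean (\<lambda>w. poisson z w * Re (F w))"
proof -
  have Fc: "continuous_on circle F" by (rule continuous_on_subset[of "cball 0 1"]) (use F in \<open>auto simp: in_A_def\<close>)
  have "integrable circle_measure (\<lambda>w. of_real (poisson z w) * F w)"
    using Fc z by (intro integrable_circle_cont continuous_intros continuous_on_poisson)
  from cmean_Re[OF this] show ?thesis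
    by (simp add: poisson_formula[OF F z])
qed

lemma norm_poisson_formula_le:
  assumes F: "in_A F" and z: "norm z < 1" and B: "\<And>w. w \<in> circle \<Longrightarrow> norm (F w) \<le> B"
  shows "norm (F z) \<le> B"
proof -
  have Fc: "continuous_on circle F" by (rule continuous_on_subset[of "cball 0 1"]) (use F in \<open>auto simp: in_A_def\<close>)
  have "norm (cmean (\<lambda>w. of_real (poisson z w) * F w)) \<le> cmean (\<lambda>w. B * poisson z w)"
  proof (rule cmean_le_bound)
    show "integrable circle_measure (\<lambda>w. of_real (poisson z w) * F w)"
      using Fc z by (intro integrable_circle_cont continuous_intros continuous_on_poisson)
    show "integrable circle_measure (\<lambda>w. B * poisson z w)"
      using z by (intro integrable_circle_cont continuous_intros continuous_on_poisson)
    fix w assume w: "w \<in> circle"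
    have "0 \<le> poisson z w" using w z by (intro poisson_nonneg) auto
    then show "norm (of_real (poisson z w) * F w) \<le> B * poisson z w"
      using mult_left_mono[OF B[OF w], of "poisson z w"] by (simp add: norm_mult mult.commute)
  qed
  then show ?thesis by (simp add: poisson_formula[OF F z] cmean_mult_left cmean_poisson[OF z])
qed

text \<open>\<open>G * exp (- F)\<close> has modulus at most 1 on the circle, hence at
  \<open>z\<close>. The summand \<open>e\<close> keeps the logarithm continuous at zeros of
  \<open>G\<close>; \<open>z\<close> is arbitrary because \<open>G\<close> may vanish at the
  origin.\<close>

lemma ln_norm_le_poisson:
  assumes G: "in_A G" and z: "norm z < 1" and nz: "G z \<noteq> 0" and e: "0 < e"
  shows "ln (norm (G z)) \<le> cmean (\<lambda>w. poisson z w * ln (norm (G w) + e))"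
proof (rule field_le_epsilon)
  fix \<delta> :: real assume d: "0 < \<delta>"
  have Gc: "continuous_on circle G" by (rule continuous_on_subset[of "cball 0 1"]) (use G in \<open>auto simp: in_A_def\<close>)
  have pos: "0 < norm (G w) + e" for w using e by (simp add: add_nonneg_pos)
  define u where "u = (\<lambda>w. ln (norm (G w) + e))"
  have u: "continuous_on circle u" unfolding u_def
    using Gc pos by (intro continuous_intros) (auto simp: less_imp_neq[symmetric])
  obtain F where F: "in_A F" "\<And>w. w \<in> circle \<Longrightarrow> u w \<le> Re (F w)" "\<And>w. w \<in> circle \<Longrightarrow> Re (F w) \<le> u w + \<delta>"
    using Re_approx_in_A[OF u d] by blast
  have Fc: "continuous_on circle F" by (rule continuous_on_subset[of "cball 0 1"]) (use F in \<open>auto simp: in_A_def\<close>)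
  have "in_A (\<lambda>w. G w * exp (- F w))"
    using F(1) G by (auto simp: in_A_def intro!: continuous_intros holomorphic_intros)
  then have "norm (G z * exp (- F z)) \<le> 1"
  proof (rule norm_poisson_formula_le[OF _ z])
    fix w assume w: "w \<in> circle"
    have "norm (G w) \<le> exp (u w)" using pos[of w] e by (simp add: u_def)
    also have "\<dots> \<le> exp (Re (F w))" using F(2)[OF w] by simp
    finally show "norm (G w * exp (- F w)) \<le> 1" by (simp add: norm_divide exp_minus divide_simps)
  qed
  then have "norm (G z) \<le> exp (Re (F z))" by (simp add: norm_divide exp_minus divide_simps)
  then have "ln (norm (G z)) \<le> ln (exp (Re (F z)))" using nz by (subst ln_le_cancel_iff) auto
  then have "ln (norm (G z)) \<le> Re (F z)" by simp
  also have "\<dots> = cmean (\<lambda>w. poisson z w * Re (F w))" by (rule Re_poisson_formula[OF F(1) z])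
  also have "\<dots> \<le> cmean (\<lambda>w. poisson z w * u w + \<delta> * poisson z w)"
  proof (rule cmean_mono)
    show "integrable circle_measure (\<lambda>w. poisson z w * Re (F w))"
      using Fc z by (intro integrable_circle_cont continuous_intros continuous_on_poisson)
    show "integrable circle_measure (\<lambda>w. poisson z w * u w + \<delta> * poisson z w)"
      using u z by (intro integrable_circle_cont continuous_intros continuous_on_poisson)
    fix w assume w: "w \<in> circle"
    have "0 \<le> poisson z w" using w z by (intro poisson_nonneg) auto
    from mult_left_mono[OF F(3)[OF w] this]
    show "poisson z w * Re (F w) \<le> poisson z w * u w + \<delta> * poisson z w" by (simp add: algebra_simps)
  qed
  also have "\<dots> = cmean (\<lambda>w. poisson z w * u w) + cmean (\<lambda>w. \<delta> * poisson z w)"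
    using u z by (intro cmean_add integrable_circle_cont continuous_intros continuous_on_poisson)
  also have "\<dots> = cmean (\<lambda>w. poisson z w * ln (norm (G w) + e)) + \<delta>"
    by (simp add: cmean_mult_left cmean_poisson[OF z] u_def)
  finally show "ln (norm (G z)) \<le> cmean (\<lambda>w. poisson z w * ln (norm (G w) + e)) + \<delta>" .
qed

lemma in_A_dilate:
  assumes "\<phi> holomorphic_on ball 0 1" "0 \<le> r" "r < 1"
  shows "in_A (\<lambda>z. \<phi> (of_real r * z))"
proof -
  have s: "norm (of_real r * z) < 1" if "norm z \<le> 1" for z :: complex
  proof -
    have "norm (of_real r * z) \<le> r * 1" unfolding norm_mult using that assms by (intro mult_mono) auto
    then show ?thesis using assms by simp
  qed
  have c: "continuous_on (ball 0 1) \<phi>" using assms(1) by (rule holomorphic_on_imp_continuous_on)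
  have "continuous_on (cball 0 1) (\<lambda>z. \<phi> (of_real r * z))"
    by (rule continuous_on_compose2[OF c]) (use s in \<open>auto intro!: continuous_intros\<close>)
  moreover have "(\<phi> \<circ> (\<lambda>z. of_real r * z)) holomorphic_on ball 0 1"
    by (rule holomorphic_on_compose_gen[OF _ assms(1)]) (use s in \<open>auto intro!: holomorphic_intros\<close>)
  ultimately show ?thesis by (simp add: in_A_def o_def)
qed

text \<open>Jensen's inequality on the circles of radius \<open>r k\<close> passes to the limit by
  Fatou's lemma. It is taken at a point \<open>z\<close> with \<open>\<phi> z \<noteq> 0\<close>;
  the Poisson kernel at \<open>z\<close> is a positive continuous weight, which does not affect
  integrability.\<close>

lemma log_integrable_of_boundary_values:
  assumes f: "continuous_on circle f" "\<And>w. w \<in> circle \<Longrightarrow> 0 \<le> f w"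
    and \<phi>: "\<phi> \<in> H_infinity" and nz: "z \<in> ball 0 1" "\<phi> z \<noteq> 0"
    and b: "has_boundary_values \<phi> b" and le: "AE w in circle_measure. cmod (b w) \<le> f w"
  shows "log_integrable f"
proof -
  have z: "norm z < 1" using nz(1) by simp
  have hol: "\<phi> holomorphic_on ball 0 1" using \<phi> by (simp add: H_infinity_def)
  obtain M where M: "\<And>w. w \<in> ball 0 1 \<Longrightarrow> norm (\<phi> w) \<le> M"
    using \<phi> unfolding H_infinity_def bounded_iff by blast
  have "compact (f ` circle)" using f(1) by (intro compact_continuous_image) auto
  then obtain B where B: "\<And>w. w \<in> circle \<Longrightarrow> norm (f w) \<le> B"
    using compact_imp_bounded bounded_iff by (metis imageI)
  have M0: "0 \<le> M" using order_trans[OF norm_ge_zero M[of 0]] by simp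
  \<comment> \<open>\<open>L\<close> is above every logarithm that occurs: \<open>M\<close> and the
    1, which bounds \<open>e k\<close>, serve \<open>ln (norm (G k w) + e k)\<close>, and
    \<open>B\<close> serves \<open>ln (f w)\<close>. This makes \<open>h k\<close> nonnegative, as
    Fatou's lemma demands, and likewise \<open>L - ln (f w)\<close> where \<open>f\<close> is
    positive.\<close>
  define L where "L = ln (max M B + 1)"
  have mx: "0 < max M B + 1" using M0 by simp
  define P where "P = poisson z"
  have P: "continuous_on circle P" unfolding P_def using z by (rule continuous_on_poisson)
  have Ppos: "0 < P w" if "w \<in> circle" for w
  proof -
    have "w \<noteq> z" using that z by auto
    moreover have "(norm z)\<^sup>2 < 1" using z by (simp add: power_less_one_iff abs_square_less_1)
    ultimately show ?thesis using that by (simp add: P_def poisson_eq)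
  qed
  define r where "r = (\<lambda>k::nat. 1 - 1 / (real k + 2))"
  have r: "0 \<le> r k" "r k < 1" for k by (auto simp: r_def field_simps)
  define G where "G = (\<lambda>k w. \<phi> (of_real (r k) * w))"
  define e where "e = (\<lambda>k::nat. 1 / (real k + 1))"
  have e: "0 < e k" "e k \<le> 1" for k by (auto simp: e_def)
  have G: "in_A (G k)" for k unfolding G_def by (rule in_A_dilate[OF hol r])
  have Gc: "continuous_on circle (G k)" for k
    by (rule continuous_on_subset[of "cball 0 1"]) (use G in \<open>auto simp: in_A_def\<close>)
  define h where "h = (\<lambda>k w. P w * (L - ln (norm (G k w) + e k)))"
  have lt1: "0 < norm (G k w) + e k" for k w using e(1)[of k] by (simp add: add_nonneg_pos)
  have uc: "continuous_on circle (\<lambda>w. ln (norm (G k w) + e k))" for k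
    using Gc lt1 by (intro continuous_intros) (auto simp: less_imp_neq[symmetric])
  have hc: "continuous_on circle (h k)" for k
    unfolding h_def by (intro continuous_intros P uc)
  have h0: "0 \<le> h k w" if w: "w \<in> circle" for k w
  proof -
    have "norm (G k w) \<le> M" unfolding G_def using w r[of k] by (intro M) (auto simp: norm_mult)
    then have "ln (norm (G k w) + e k) \<le> L"
      unfolding L_def using lt1[of k w] e(2)[of k] mx by (subst ln_le_cancel_iff) auto
    then show ?thesis using Ppos[OF w] by (simp add: h_def)
  qed
  have rz: "(\<lambda>k. G k z) \<longlonglongrightarrow> \<phi> z"
  proof -
    have "r \<longlonglongrightarrow> 1" unfolding r_def by real_asymp
    then have "(\<lambda>k. of_real (r k) * z) \<longlonglongrightarrow> of_real 1 * z" by (intro tendsto_intros)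
    then have "(\<lambda>k. of_real (r k) * z) \<longlonglongrightarrow> z" by simp
    moreover have "isCont \<phi> z"
      using continuous_on_eq_continuous_at[OF open_ball, of 0 1 \<phi>] hol nz(1) holomorphic_on_imp_continuous_on by blast
    ultimately show ?thesis unfolding G_def by (rule isCont_tendsto_compose[rotated])
  qed
  define c where "c = norm (\<phi> z) / 2"
  have c: "0 < c" using nz by (simp add: c_def)
  have "eventually (\<lambda>k. c < norm (G k z)) sequentially"
    using tendsto_norm[OF rz] nz(2) by (intro order_tendstoD(1)) (auto simp: c_def)
  then have bound: "eventually (\<lambda>k. (\<integral>\<^sup>+w. ennreal (h k w) \<partial>circle_measure) \<le> ennreal (2 * pi * (L - ln c))) sequentially"
  proof eventually_elim
    case (elim k)
    then have "ln c \<le> ln (norm (G k z))" using c by (subst ln_le_cancel_iff) auto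
    also have "\<dots> \<le> cmean (\<lambda>w. P w * ln (norm (G k w) + e k))"
      unfolding P_def using elim c by (intro ln_norm_le_poisson[OF G z] e) auto
    finally have "L - cmean (\<lambda>w. P w * ln (norm (G k w) + e k)) \<le> L - ln c" by simp
    moreover have "cmean (h k) = L - cmean (\<lambda>w. P w * ln (norm (G k w) + e k))"
    proof -
      have "cmean (h k) = cmean (\<lambda>w. L * P w - P w * ln (norm (G k w) + e k))"
        by (simp add: h_def algebra_simps)
      also have "\<dots> = cmean (\<lambda>w. L * P w) - cmean (\<lambda>w. P w * ln (norm (G k w) + e k))"
        by (intro cmean_diff integrable_circle_cont continuous_intros P uc)
      finally show ?thesis using cmean_poisson[OF z] by (simp add: cmean_mult_left P_def)
    qed
    ultimately have "cmean (h k) \<le> L - ln c" by simp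
    then have "integral\<^sup>L circle_measure (h k) \<le> 2 * pi * (L - ln c)"
      by (simp add: cmean_def field_simps)
    moreover have "(\<integral>\<^sup>+w. ennreal (h k w) \<partial>circle_measure) = ennreal (integral\<^sup>L circle_measure (h k))"
      using h0 by (intro nn_integral_eq_integral integrable_circle_cont hc) (auto simp: space_circle_measure)
    ultimately show ?case by (simp add: ennreal_leI)
  qed
  \<comment> \<open>The value \<open>\<infinity>\<close> at zeros of \<open>f\<close> stands for
    \<open>- log 0\<close>; with \<open>ln 0 = 0\<close> the divergence there would be lost.
    Finiteness of the integral of \<open>T\<close> then gives positivity of \<open>f\<close> almost
    everywhere.\<close>
  define T where "T = (\<lambda>w. if f w > 0 then ennreal (P w * (L - ln (f w))) else \<infinity>)"
  have [measurable]: "f \<in> borel_measurable circle_measure" "P \<in> borel_measurable circle_measure"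
    "\<And>k. h k \<in> borel_measurable circle_measure"
    using f(1) P hc by (auto intro: borel_measurable_circle_measure_cont)
  have [measurable]: "T \<in> borel_measurable circle_measure"
    unfolding T_def by measurable
  have "filterlim r (at_left 1) sequentially"
    unfolding r_def by real_asymp
  have "AE w in circle_measure. T w \<le> liminf (\<lambda>k. ennreal (h k w))"
    using b[unfolded has_boundary_values_def] le AE_space
  proof eventually_elim
    case (elim w)
    then have w: "w \<in> circle" by (simp add: space_circle_measure)
    have lim: "(\<lambda>k. norm (G k w) + e k) \<longlonglongrightarrow> norm (b w) + 0"
    proof (intro tendsto_add tendsto_norm)
      show "(\<lambda>k. G k w) \<longlonglongrightarrow> b w"
        unfolding G_def using filterlim_compose[OF elim(1) \<open>filterlim r (at_left 1) sequentially\<close>] .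
      show "e \<longlonglongrightarrow> 0" unfolding e_def by real_asymp
    qed
    show ?case
      unfolding le_Liminf_iff
    proof (intro allI impI)
      fix y assume y: "y < T w"
      then have yf: "y < \<infinity>" using order_less_le_trans[OF y top_greatest] by simp
      define y' where "y' = enn2real y"
      have y': "y = ennreal y'" "0 \<le> y'" using yf by (auto simp: y'_def less_top)
      \<comment> \<open>Exponentiating treats zeros of \<open>f\<close> together with positive
        values, as the right-hand side is always positive. The inequality is inherited by the radial
        limit \<open>b w\<close>, whose modulus is at most \<open>f w\<close>.\<close>
      have "f w < exp (L - y' / P w)"
      proof (cases "f w > 0")
        case True
        with y have "ennreal y' < ennreal (P w * (L - ln (f w)))" by (simp add: T_def y'(1))
        then have "y' < P w * (L - ln (f w))" using y'(2) by (simp add: ennreal_less_iff)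
        then have "ln (f w) < L - y' / P w" using Ppos[OF w] by (simp add: field_simps)
        then show ?thesis using True exp_less_cancel_iff[of "ln (f w)" "L - y' / P w"] by simp
      next
        case False
        then show ?thesis by (simp add: order_le_less_trans[OF _ exp_gt_zero])
      qed
      then have "norm (b w) + 0 < exp (L - y' / P w)" using elim(2) by simp
      from order_tendstoD(2)[OF lim this]
      show "eventually (\<lambda>k. y < ennreal (h k w)) sequentially"
      proof eventually_elim
        case (elim k)
        then have "ln (norm (G k w) + e k) < L - y' / P w"
          using lt1[of k w] ln_less_cancel_iff[of "norm (G k w) + e k" "exp (L - y' / P w)"] by simp
        then have "y' < h k w" using Ppos[OF w] by (simp add: h_def field_simps)
        then show ?case using y' by (simp add: ennreal_less_iff)
      qed
    qed
  qed
  then have "(\<integral>\<^sup>+w. T w \<partial>circle_measure) \<le> (\<integral>\<^sup>+w. liminf (\<lambda>k. ennreal (h k w)) \<partial>circle_measure)"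
    by (rule nn_integral_mono_AE)
  also have "\<dots> \<le> liminf (\<lambda>k. \<integral>\<^sup>+w. ennreal (h k w) \<partial>circle_measure)"
    by (rule nn_integral_liminf) measurable
  also have "\<dots> \<le> ennreal (2 * pi * (L - ln c))"
    by (rule Liminf_le[OF _ bound]) simp
  finally have Tfin: "(\<integral>\<^sup>+w. T w \<partial>circle_measure) < \<infinity>" by (simp add: order_le_less_trans)
  then have "AE w in circle_measure. T w \<noteq> \<infinity>"
    by (intro nn_integral_PInf_AE) auto
  then have pos: "AE w in circle_measure. f w > 0"
    by eventually_elim (auto simp: T_def split: if_splits)
  have i1: "integrable circle_measure (\<lambda>w. P w * (L - ln (f w)))"
  proof (rule integrableI_nonneg)
    show "AE w in circle_measure. 0 \<le> P w * (L - ln (f w))"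
      using pos AE_space
    proof eventually_elim
      case (elim w)
      then have w: "w \<in> circle" by (simp add: space_circle_measure)
      have "ln (f w) \<le> L" unfolding L_def using elim B[OF w] mx by (subst ln_le_cancel_iff) auto
      then show ?case using Ppos[OF w] by simp
    qed
    have "(\<integral>\<^sup>+w. ennreal (P w * (L - ln (f w))) \<partial>circle_measure) = (\<integral>\<^sup>+w. T w \<partial>circle_measure)"
      using pos by (intro nn_integral_cong_AE) (auto simp: T_def elim: eventually_mono)
    then show "(\<integral>\<^sup>+w. ennreal (P w * (L - ln (f w))) \<partial>circle_measure) < \<infinity>" using Tfin by simp
  qed measurable
  have "continuous_on circle (\<lambda>w. 1 / P w)"
    using Ppos P by (intro continuous_intros) (auto simp: less_imp_neq[symmetric])
  from integrable_circle_mult_cont_real[OF i1 this]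
  have "integrable circle_measure (\<lambda>w. L - ln (f w))"
    by (rule Bochner_Integration.integrable_cong[THEN iffD1, rotated 2]) (use Ppos in \<open>force simp: space_circle_measure\<close>)+
  from Bochner_Integration.integrable_diff[OF integrable_circle_cont[of "\<lambda>_. L"] this]
  have "integrable circle_measure (\<lambda>w. ln (f w))" by simp
  with pos show ?thesis by (simp add: log_integrable_def)
qed

text \<open>The continuous extension of \<open>k\<close> to the disk is a bounded analytic function
  with radial limits everywhere on the circle. It is nonzero somewhere inside, since vanishing in
  the open disk would force vanishing at \<open>w1\<close>.\<close>

lemma log_integrable_of_disk_algebra_le:
  assumes f: "continuous_on circle f" "\<And>w. w \<in> circle \<Longrightarrow> 0 \<le> f w"
    and k: "k \<in> disk_algebra" "k w1 \<noteq> 0" and le: "\<And>w. w \<in> circle \<Longrightarrow> norm (k w) \<le> f w"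
  shows "log_integrable f"
proof -
  obtain F where F: "continuous_on (cball 0 1) F" "F holomorphic_on ball 0 1" "\<And>w. w \<in> circle \<Longrightarrow> k w = F w"
    using k(1) unfolding disk_algebra_def by blast
  have w1: "w1 \<in> circle" using k unfolding disk_algebra_def C_circle_def by blast
  have "\<exists>z\<in>ball 0 1. F z \<noteq> 0"
  proof (rule ccontr)
    assume "\<not> ?thesis"
    then have F0: "F z = 0" if "z \<in> ball 0 1" for z using that by blast
    have "F w1 = 0"
      by (rule continuous_constant_on_closure[of "ball 0 1" F 0]) (use F(1) F0 w1 in auto)
    then show False using F(3)[OF w1] k(2) by simp
  qed
  then obtain z where z: "z \<in> ball 0 1" "F z \<noteq> 0" by auto
  have "compact (F ` cball 0 1)" using F(1) by (intro compact_continuous_image) auto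
  then have "bounded (F ` ball 0 1)" by (meson ball_subset_cball bounded_subset compact_imp_bounded image_mono)
  then have H: "F \<in> H_infinity" using F(2) by (simp add: H_infinity_def)
  have "((\<lambda>r. F (of_real r * w)) \<longlongrightarrow> k w) (at_left 1)" if w: "w \<in> circle" for w
  proof -
    have "continuous_on {0..1} (\<lambda>r. F (complex_of_real r * w))"
      by (rule continuous_on_compose2[OF F(1)]) (use w in \<open>auto intro!: continuous_intros simp: norm_mult\<close>)
    then have "((\<lambda>r. F (complex_of_real r * w)) \<longlongrightarrow> F (complex_of_real 1 * w)) (at 1 within {0..1})"
      unfolding continuous_on_def by (rule bspec) simp
    moreover have "at_left (1::real) \<le> at 1 within {0..1}"
      unfolding at_within_Icc_at_left[OF zero_less_one] by simp
    ultimately show ?thesis using F(3)[OF w] by (simp add: filterlim_mono)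
  qed
  then have "has_boundary_values F k"
    by (auto simp: has_boundary_values_def space_circle_measure intro!: AE_I2)
  then show ?thesis
    using le by (intro log_integrable_of_boundary_values[OF f H z]) (auto simp: space_circle_measure)
qed

section \<open>Integrable logarithms and the class R\<close>

definition circ :: "(complex \<Rightarrow> complex) \<Rightarrow> complex \<Rightarrow> complex" where
  "circ F = (\<lambda>w. if w \<in> circle then F w else 0)"

lemma in_A_continuous_on_circle: "in_A F \<Longrightarrow> continuous_on circle F"
  unfolding in_A_def by (elim conjE continuous_on_subset) auto

lemma circ_in_disk_algebra:
  assumes "in_A F"
  shows "circ F \<in> disk_algebra"
proof -
  have "continuous_on circle (circ F)"
    by (rule continuous_on_eq[OF in_A_continuous_on_circle[OF assms]]) (simp add: circ_def)
  then show ?thesis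
    using assms unfolding disk_algebra_def C_circle_def in_A_def by (auto simp: circ_def intro!: exI[of _ F])
qed

lemma disk_algebraE:
  assumes "a \<in> disk_algebra"
  obtains F where "in_A F" "a = circ F"
proof -
  obtain F where F: "in_A F" "\<forall>w\<in>circle. a w = F w" and C: "\<forall>z. z \<notin> circle \<longrightarrow> a z = 0"
    using assms unfolding disk_algebra_def C_circle_def in_A_def by blast
  then have "a = circ F" by (auto simp: circ_def fun_eq_iff)
  with F that show ?thesis by blast
qed

lemma disk_algebra_add: "a \<in> disk_algebra \<Longrightarrow> b \<in> disk_algebra \<Longrightarrow> a + b \<in> disk_algebra"
proof (elim disk_algebraE)
  fix F G assume F: "in_A F" "in_A G" "a = circ F" "b = circ G"
  then have "a + b = circ (\<lambda>z. F z + G z)" by (auto simp: circ_def fun_eq_iff)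
  moreover have "in_A (\<lambda>z. F z + G z)" using F by (auto simp: in_A_def intro!: continuous_intros holomorphic_intros)
  ultimately show ?thesis using circ_in_disk_algebra by simp
qed

lemma disk_algebra_mult: "a \<in> disk_algebra \<Longrightarrow> b \<in> disk_algebra \<Longrightarrow> a * b \<in> disk_algebra"
proof (elim disk_algebraE)
  fix F G assume F: "in_A F" "in_A G" "a = circ F" "b = circ G"
  then have "a * b = circ (\<lambda>z. F z * G z)" by (auto simp: circ_def fun_eq_iff)
  moreover have "in_A (\<lambda>z. F z * G z)" using F by (auto simp: in_A_def intro!: continuous_intros holomorphic_intros)
  ultimately show ?thesis using circ_in_disk_algebra by simp
qed

lemma disk_algebra_scale: "a \<in> disk_algebra \<Longrightarrow> (\<lambda>z. c * a z) \<in> disk_algebra"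
proof (elim disk_algebraE)
  fix F assume F: "in_A F" "a = circ F"
  then have "(\<lambda>z. c * a z) = circ (\<lambda>z. c * F z)" by (auto simp: circ_def fun_eq_iff)
  moreover have "in_A (\<lambda>z. c * F z)" using F by (auto simp: in_A_def intro!: continuous_intros holomorphic_intros)
  ultimately show ?thesis using circ_in_disk_algebra by simp
qed

lemma disk_algebra_const: "circ (\<lambda>_. c) \<in> disk_algebra"
  by (rule circ_in_disk_algebra) (auto simp: in_A_def)

lemma disk_algebra_zero: "0 \<in> disk_algebra"
  using disk_algebra_const[of 0] by (simp add: circ_def zero_fun_def)

lemma indicator_circle_eq: "indicator circle = circ (\<lambda>_. 1)"
  by (auto simp: circ_def indicator_def fun_eq_iff)

lemma disk_algebra_sum: "(\<And>i. i \<in> I \<Longrightarrow> a i \<in> disk_algebra) \<Longrightarrow> (\<Sum>i\<in>I. a i) \<in> disk_algebra"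
  by (induction I rule: infinite_finite_induct) (auto simp: disk_algebra_zero disk_algebra_add)

lemma disk_algebra_C_circle: "a \<in> disk_algebra \<Longrightarrow> a \<in> C_circle"
  by (simp add: disk_algebra_def)

lemma norm_in_A_le:
  assumes "in_A F" "\<And>w. w \<in> circle \<Longrightarrow> norm (F w) \<le> B" "norm z \<le> 1"
  shows "norm (F z) \<le> B"
  using norm_poisson_formula_le[OF assms(1) _ assms(2)] assms(2)[of z] assms(3)
  by (cases "norm z < 1") auto

text \<open>The maximum principle turns the uniform Cauchy condition on the circle into one on the
  closed disk, so the extensions converge uniformly to a function that is again continuous there and
  holomorphic inside.\<close>

lemma disk_algebra_closed:
  assumes off: "\<And>z. z \<notin> circle \<Longrightarrow> a z = 0"
    and approx: "\<And>e. e > 0 \<Longrightarrow> \<exists>b\<in>disk_algebra. \<forall>w\<in>circle. norm (a w - b w) < e"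
  shows "a \<in> disk_algebra"
proof -
  have "\<exists>F. in_A F \<and> (\<forall>w\<in>circle. norm (a w - F w) < 1 / (real n + 1))" for n
  proof -
    obtain b where b: "b \<in> disk_algebra" "\<forall>w\<in>circle. norm (a w - b w) < 1 / (real n + 1)"
      using approx[of "1 / (real n + 1)"] by auto
    from b(1) show ?thesis
    proof (rule disk_algebraE)
      fix F assume "in_A F" "b = circ F"
      then show ?thesis using b(2) by (intro exI[of _ F]) (auto simp: circ_def)
    qed
  qed
  then obtain F where F: "\<And>n. in_A (F n)" "\<And>n w. w \<in> circle \<Longrightarrow> norm (a w - F n w) < 1 / (real n + 1)"
    by metis
  have "uniformly_Cauchy_on (cball 0 1) F"
    unfolding uniformly_Cauchy_on_def
  proof (intro allI impI)
    fix e :: real assume e: "0 < e"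
    obtain N where N: "2 / e < real N" using reals_Archimedean2 by blast
    have small: "1 / (real n + 1) < e / 2" if "N \<le> n" for n
    proof -
      have "2 / e < real n + 1" using N that by linarith
      then show ?thesis using e by (simp add: field_simps)
    qed
    show "\<exists>M. \<forall>x\<in>cball 0 1. \<forall>m\<ge>M. \<forall>n\<ge>M. dist (F m x) (F n x) < e"
    proof (intro exI ballI allI impI)
      fix z m n assume z: "z \<in> cball (0::complex) 1" and m: "N \<le> m" and n: "N \<le> n"
      have "in_A (\<lambda>z. F m z - F n z)"
        using F(1) unfolding in_A_def by (auto intro!: continuous_intros holomorphic_intros)
      then have "norm (F m z - F n z) \<le> 1 / (real m + 1) + 1 / (real n + 1)"
      proof (rule norm_in_A_le)
        fix w assume w: "w \<in> circle"
        have "norm (F m w - F n w) = norm ((a w - F n w) - (a w - F m w))" by simp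
        also have "\<dots> \<le> norm (a w - F n w) + norm (a w - F m w)" by (rule norm_triangle_ineq4)
        finally show "norm (F m w - F n w) \<le> 1 / (real m + 1) + 1 / (real n + 1)"
          using F(2)[OF w, of m] F(2)[OF w, of n] by linarith
      qed (use z in auto)
      then show "dist (F m z) (F n z) < e"
        using small[OF m] small[OF n] by (simp add: dist_norm)
    qed
  qed
  then obtain G where G: "uniform_limit (cball 0 1) F G sequentially"
    using Cauchy_uniformly_convergent uniformly_convergent_on_def by blast
  have "continuous_on (cball 0 1) G"
    by (rule uniform_limit_theorem[OF _ G]) (use F in \<open>auto simp: in_A_def\<close>)
  moreover have "G holomorphic_on ball 0 1"
  proof (rule holomorphic_uniform_sequence[of _ F])
    show "F n holomorphic_on ball 0 1" for n using F(1) by (simp add: in_A_def)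
    fix x :: complex assume "x \<in> ball 0 1"
    then obtain d where d: "0 < d" "cball x d \<subseteq> ball 0 1"
      by (meson open_ball open_contains_cball)
    moreover have "uniform_limit (cball x d) F G sequentially"
      by (rule uniform_limit_on_subset[OF G]) (use d in auto)
    ultimately show "\<exists>d>0. cball x d \<subseteq> ball 0 1 \<and> uniform_limit (cball x d) F G sequentially"
      by blast
  qed auto
  ultimately have GA: "in_A G" by (simp add: in_A_def)
  have "a w = G w" if w: "w \<in> circle" for w
  proof -
    have "(\<lambda>n. F n w) \<longlonglongrightarrow> G w" by (rule tendsto_uniform_limitI[OF G]) (use w in auto)
    moreover have "(\<lambda>n. F n w) \<longlonglongrightarrow> a w"
    proof (rule LIM_zero_cancel, rule Lim_null_comparison)
      show "eventually (\<lambda>n. norm (F n w - a w) \<le> 1 / (real n + 1)) sequentially"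
        using F(2)[OF w] by (intro always_eventually allI) (metis norm_minus_commute order_less_imp_le)
      show "(\<lambda>n. 1 / (real n + 1)) \<longlonglongrightarrow> 0" by real_asymp
    qed
    ultimately show ?thesis using LIMSEQ_unique by blast
  qed
  then have "a = circ G" using off by (auto simp: circ_def fun_eq_iff)
  then show ?thesis using circ_in_disk_algebra[OF GA] by simp
qed

section \<open>Approximation in modulus from an integrable logarithm\<close>

lemma cmean_mono_AE:
  fixes f g :: "complex \<Rightarrow> real"
  assumes "integrable circle_measure f" "integrable circle_measure g" "AE w in circle_measure. f w \<le> g w"
  shows "cmean f \<le> cmean g"
  using assms by (auto simp: cmean_def intro!: divide_right_mono integral_mono_AE)

text \<open>The tuples are \<open>H = exp (- p)\<close> and, up to a constant factor,
  \<open>K = exp p * g\<close>, where the real part of \<open>p n\<close> approximates the truncated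
  logarithm \<open>u n\<close> and \<open>g n\<close> has modulus at most
  \<open>f * exp (- u n)\<close>. The difficulty is to find such \<open>g n\<close> in the disk
  algebra that tend to 1 off the zeros of \<open>f\<close>: \<open>g n\<close> is the exponential of
  minus the sum of the dilated transforms of the layers from index \<open>n\<close> on.\<close>

lemma log_integrable_imp_R_class:
  assumes f: "continuous_on circle f" "\<And>w. w \<in> circle \<Longrightarrow> 0 \<le> f w" and log: "log_integrable f"
  shows "f \<in> R_class"
proof -
  define E where "E = {w \<in> circle. f w = 0}"
  have fpos: "0 < f w" if "w \<in> circle - E" for w
    using that f(2)[of w] by (force simp: E_def)
  \<comment> \<open>Taking the maximum before the logarithm gives the value \<open>- n\<close> at
    zeros of \<open>f\<close>, where \<open>ln 0 = 0\<close> would be wrong.\<close>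
  define u where "u = (\<lambda>(n::nat) w. ln (max (f w) (exp (- real n))))"
  have mpos: "0 < max (f w) (exp (- real n))" for n w by (simp add: less_max_iff_disj)
  have uc: "continuous_on circle (u n)" for n
    unfolding u_def using f(1) mpos by (intro continuous_intros) (auto simp: less_imp_neq[symmetric])
  have uge: "- real n \<le> u n w" for n w
    unfolding u_def using mpos[of w n] by (simp add: ln_ge_iff)
  have uE: "u n w = - real n" if "w \<in> E" for n w
    using that by (simp add: u_def E_def max_absorb2)
  have uf: "u n w = ln (f w)" if "exp (- real n) \<le> f w" for n w
    using that by (simp add: u_def max_absorb1)
  have ufge: "ln (f w) \<le> u n w" if "0 < f w" for n w
    using that mpos[of w n] by (simp add: u_def)
  have umono: "u N w \<le> u n w" if "n \<le> N" for n N w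
    unfolding u_def using that mpos[of w n] mpos[of w N] by (subst ln_le_cancel_iff) (auto simp: max.coboundedI2)
  define v where "v = (\<lambda>n w. u n w - u (Suc n) w)"
  have vc: "continuous_on circle (v n)" for n
    unfolding v_def by (intro continuous_intros uc)
  have vi: "integrable circle_measure (v n)" for n by (rule integrable_circle_cont[OF vc])
  have v0: "0 \<le> v n w" for n w unfolding v_def using umono[of n "Suc n" w] by simp
  have vz: "v n w = 0" if "exp (- real n) \<le> f w" for n w
  proof -
    have "exp (- real (Suc n)) \<le> exp (- real n)" by simp
    then have "exp (- real (Suc n)) \<le> f w" using that by linarith
    then show ?thesis using that uf[of n w] uf[of "Suc n" w] by (simp add: v_def)
  qed
  define m where "m = (\<lambda>n. cmean (v n))"
  have m0: "0 \<le> m n" for n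
    using cmean_mono[OF integrable_circle_cont[of "\<lambda>_. 0::real"] vi v0] by (simp add: m_def cmean_const)
  have li: "integrable circle_measure (\<lambda>w. ln (f w))" and lp: "AE w in circle_measure. 0 < f w"
    using log by (auto simp: log_integrable_def)
  have ui: "integrable circle_measure (u n)" for n by (rule integrable_circle_cont[OF uc])
  have msum: "(\<Sum>n<N. m n) = cmean (u 0) - cmean (u N)" for N
  proof (induction N)
    case (Suc N)
    have "m N = cmean (u N) - cmean (u (Suc N))"
      unfolding m_def v_def by (rule cmean_diff[OF ui ui])
    then show ?case using Suc by simp
  qed simp
  \<comment> \<open>Integrability of \<open>ln f\<close> enters here: the telescoping sums of the
    means stay below the difference of the means of \<open>u 0\<close> and
    \<open>ln f\<close>.\<close>
  have summ: "summable m"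
  proof (rule summableI_nonneg_bounded[OF m0])
    fix N
    have "cmean (\<lambda>w. ln (f w)) \<le> cmean (u N)"
      by (rule cmean_mono_AE[OF li ui]) (use lp ufge in \<open>auto elim!: eventually_mono\<close>)
    then show "(\<Sum>n<N. m n) \<le> cmean (u 0) - cmean (\<lambda>w. ln (f w))" using msum[of N] by simp
  qed
  have "\<exists>r. 0 < r \<and> r < 1 \<and> (\<forall>w\<in>circle. \<bar>Re (herglotz (v n) (of_real r * w)) - v n w\<bar> < (1/2)^n)" for n
    using herglotz_dilate_approx[OF vc, of "(1/2)^n" n] by (metis zero_less_divide_1_iff zero_less_numeral zero_less_power)
  then obtain r where r: "\<And>n. 0 < r n" "\<And>n. r n < 1"
    "\<And>n w. w \<in> circle \<Longrightarrow> \<bar>Re (herglotz (v n) (of_real (r n) * w)) - v n w\<bar> < (1/2)^n"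
    by metis
  \<comment> \<open>The radius \<open>r n\<close> allows an error \<open>(1/2)^n\<close>. Adding it
    back makes the real part dominate the layer \<open>v n\<close> on the circle, and the
    corrections remain summable.\<close>
  define q where "q = (\<lambda>n z. herglotz (v n) (of_real (r n) * z) + of_real ((1/2)^n))"
  have qA: "in_A (q n)" for n
    using in_A_herglotz_dilate[OF vi r(1,2)[of n], of n]
    unfolding in_A_def q_def by (auto intro!: continuous_intros holomorphic_intros)
  have qge: "v n w \<le> Re (q n w)" if "w \<in> circle" for n w
    using r(3)[OF that, of n] unfolding q_def plus_complex.sel Re_complex_of_real by linarith
  define S where "S = (\<lambda>N z. \<Sum>n<N. q n z)"
  define Q where "Q = (\<lambda>z. \<Sum>n. q n z)"
  \<comment> \<open>On a compact set off the zeros, \<open>f\<close> is at least some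
    \<open>\<delta>\<close>, hence at least \<open>\<delta> / 2\<close> within some distance
    \<open>d\<close> of that set. Layers of index beyond \<open>- ln (\<delta> / 2)\<close> vanish
    within that distance, so the bound off the support applies with a fixed
    \<open>d\<close>.\<close>
  have ulQ: "uniform_limit L S Q sequentially" if L: "compact L" "L \<subseteq> circle - E" for L
  proof (cases "L = {}")
    case False
    have "continuous_on L f" using f(1) L(2) by (meson Diff_subset continuous_on_subset order_trans)
    then obtain z0 where z0: "z0 \<in> L" "\<And>z. z \<in> L \<Longrightarrow> f z0 \<le> f z"
      using continuous_attains_inf[OF L(1) False] by blast
    define \<delta> where "\<delta> = f z0"
    have \<delta>: "0 < \<delta>" using fpos z0(1) L(2) by (auto simp: \<delta>_def)
    have "uniformly_continuous_on circle f"
      by (rule compact_uniformly_continuous[OF f(1)]) auto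
    then obtain d where d: "0 < d" "\<And>w w'. w \<in> circle \<Longrightarrow> w' \<in> circle \<Longrightarrow> dist w' w < d \<Longrightarrow> dist (f w') (f w) < \<delta> / 2"
      unfolding uniformly_continuous_on_def using \<delta> by (metis half_gt_zero)
    obtain N0 where N0: "- ln (\<delta> / 2) < real N0" using reals_Archimedean2 by blast
    have supp: "v n w = 0" if "N0 \<le> n" "z \<in> L" "w \<in> circle" "norm (w - z) < d" for n w z
    proof (rule vz)
      have "z \<in> circle" using that L by auto
      then have "\<bar>f w - f z\<bar> < \<delta> / 2" using d(2)[of z w] that by (simp add: dist_norm)
      then have "f z - f w < \<delta> / 2" by (simp only: abs_less_iff) linarith
      then have "\<delta> / 2 \<le> f w" using z0(2)[OF that(2)] unfolding \<delta>_def by linarith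
      moreover have "exp (- real n) \<le> exp (ln (\<delta> / 2))" using N0 that(1) by (subst exp_le_cancel_iff) linarith
      ultimately show "exp (- real n) \<le> f w" using \<delta> by simp
    qed
    have bnd: "norm (q n z) \<le> 4 / d * m n + (1/2)^n" if "N0 \<le> n" "z \<in> L" for n z
    proof -
      have "norm (herglotz (v n) (of_real (r n) * z)) \<le> 4 / d * cmean (\<lambda>w. \<bar>v n w\<bar>)"
        using supp[OF that] that L(2) r(1,2)[of n] d(1)
        by (intro herglotz_bound_off_support[OF vi]) auto
      also have "cmean (\<lambda>w. \<bar>v n w\<bar>) = m n" using v0 by (simp add: m_def)
      finally show ?thesis unfolding q_def
        using norm_triangle_ineq[of "herglotz (v n) (of_real (r n) * z)" "of_real ((1/2)^n)"]
        by (simp add: norm_power norm_divide)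
    qed
    have "uniform_limit L (\<lambda>N z. \<Sum>n<N. q n z) (\<lambda>z. \<Sum>n. q n z) sequentially"
    proof (rule Weierstrass_m_test_ev)
      show "eventually (\<lambda>n. \<forall>z\<in>L. norm (q n z) \<le> 4 / d * m n + (1/2)^n) sequentially"
        using bnd by (auto simp: eventually_sequentially)
      show "summable (\<lambda>n. 4 / d * m n + (1/2)^n)"
        by (intro summable_add summable_mult summ summable_geometric) auto
    qed
    then show ?thesis by (simp add: S_def Q_def[abs_def])
  qed (simp add: uniform_limit_iff)
  have ulexp: "uniform_limit L (\<lambda>N z. exp (S N z - Q z)) (\<lambda>_. 1) sequentially"
    if L: "compact L" "L \<subseteq> circle - E" for L
  proof (rule uniform_limitI)
    fix e :: real assume "0 < e"
    moreover have "isCont exp (0::complex)" by (rule isCont_exp)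
    ultimately obtain d where d: "0 < d" "\<And>x::complex. dist x 0 < d \<Longrightarrow> dist (exp x) (exp 0) < e"
      unfolding continuous_at_eps_delta by metis
    have "eventually (\<lambda>N. \<forall>z\<in>L. dist (S N z) (Q z) < d) sequentially"
      by (rule uniform_limitD[OF ulQ[OF L] d(1)])
    then show "eventually (\<lambda>N. \<forall>z\<in>L. dist (exp (S N z - Q z)) 1 < e) sequentially"
      by eventually_elim (use d(2) in \<open>auto simp: dist_norm\<close>)
  qed
  have Sge: "u n w - u N w \<le> Re (S N w - S n w)" if "n \<le> N" "w \<in> circle" for n N w
    using that(1)
  proof (induction N rule: dec_induct)
    case (step N)
    then show ?case using qge[OF that(2), of N] by (simp add: S_def v_def)
  qed simp
  have Slim: "(\<lambda>N. S N w) \<longlonglongrightarrow> Q w" if "w \<in> circle - E" for w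
    using tendsto_uniform_limitI[OF ulQ[of "{w}"]] that by auto
  \<comment> \<open>For large \<open>N\<close> the truncation \<open>u N w\<close> equals
    \<open>ln (f w)\<close>, so the bound for partial sums passes to the limit.\<close>
  have Qge: "u n w - ln (f w) \<le> Re (Q w - S n w)" if w: "w \<in> circle - E" for n w
  proof (rule tendsto_lowerbound)
    show "(\<lambda>N. Re (S N w - S n w)) \<longlonglongrightarrow> Re (Q w - S n w)"
      by (intro tendsto_intros Slim w)
    obtain N0 where N0: "- ln (f w) < real N0" using reals_Archimedean2 by blast
    show "eventually (\<lambda>N. u n w - ln (f w) \<le> Re (S N w - S n w)) sequentially"
      using eventually_ge_at_top[of "max n N0"]
    proof eventually_elim
      case (elim N)
      then have "exp (- real N) \<le> exp (ln (f w))" using N0 by (subst exp_le_cancel_iff) auto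
      then have "u N w = ln (f w)" using fpos[OF w] by (intro uf) simp
      then show ?case using Sge[of n N w] elim w by auto
    qed
  qed simp
  \<comment> \<open>The series \<open>Q\<close> is controlled only off \<open>E\<close>. The value 0
    on \<open>E\<close> is the continuous one, because \<open>g n\<close> has modulus at most
    \<open>f * exp (- u n)\<close>.\<close>
  define g where "g = (\<lambda>n w. if w \<in> circle - E then exp (S n w - Q w) else 0)"
  have gle: "norm (g n w) * exp (u n w) \<le> f w" if w: "w \<in> circle" for n w
  proof (cases "w \<in> E")
    case True then show ?thesis using f(2)[OF w] by (simp add: g_def)
  next
    case False
    then have w': "w \<in> circle - E" using w by simp
    have "norm (g n w) * exp (u n w) = exp (Re (S n w - Q w) + u n w)"
      using w' by (simp add: g_def exp_add)
    also have "\<dots> \<le> exp (ln (f w))" using Qge[OF w', of n] by (subst exp_le_cancel_iff) simp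
    finally show ?thesis using fpos[OF w'] by simp
  qed
  have SA: "in_A (S n)" for n
    unfolding S_def in_A_def using qA by (auto simp: in_A_def intro!: continuous_intros holomorphic_intros)
  have gA: "g n \<in> disk_algebra" for n
  proof (rule disk_algebra_closed)
    fix e :: real assume e: "0 < e"
    define G where "G = (\<lambda>N z. exp (S n z - S N z))"
    have GA: "in_A (G N)" for N
      unfolding G_def using SA unfolding in_A_def by (auto intro!: continuous_intros holomorphic_intros)
    obtain N1' where N1': "real n - ln (e / 2) < real N1'" using reals_Archimedean2 by blast
    define N1 where "N1 = max n N1'"
    have N1: "n \<le> N1" "exp (real n - real N1) < e / 2"
    proof -
      have "real n - real N1 < ln (e / 2)" using N1' by (auto simp: N1_def)
      then have "exp (real n - real N1) < exp (ln (e / 2))" by simp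
      then show "exp (real n - real N1) < e / 2" using e by simp
    qed (simp add: N1_def)
    \<comment> \<open>On \<open>E\<close> the exponential equals
      \<open>exp (n - N1) < e / 2\<close>, so \<open>L\<close> is a compact set off
      \<open>E\<close>, where the partial sums converge uniformly. Outside \<open>L\<close> both
      \<open>g n\<close> and its approximant \<open>G N\<close> have modulus at most
      \<open>e / 2\<close>.\<close>
    define L where "L = {w \<in> circle. e / 2 \<le> exp (u N1 w + real n)}"
    have Lc: "compact L"
    proof -
      have "closed (circle \<inter> (\<lambda>w. exp (u N1 w + real n)) -` {e / 2..})"
        by (intro continuous_closed_preimage continuous_intros uc) auto
      moreover have "circle \<inter> (\<lambda>w. exp (u N1 w + real n)) -` {e / 2..} = L"
        by (auto simp: L_def)
      moreover have "circle \<inter> L = L" by (auto simp: L_def)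
      ultimately show ?thesis using compact_Int_closed[of circle L] by auto
    qed
    have LE: "L \<subseteq> circle - E"
    proof
      fix w assume w: "w \<in> L"
      have "w \<notin> E"
      proof
        assume "w \<in> E"
        then have "exp (u N1 w + real n) < e / 2" using uE[of w N1] N1(2) by (simp add: add.commute)
        then show False using w by (simp add: L_def)
      qed
      then show "w \<in> circle - E" using w by (simp add: L_def)
    qed
    have GS: "norm (G N w) \<le> exp (u N w + real n)" if "n \<le> N" "w \<in> circle" for N w
    proof -
      have "norm (G N w) = exp (Re (S n w - S N w))" by (simp add: G_def)
      also have "\<dots> \<le> exp (u N w + real n)"
        using Sge[OF that] uge[of n w] by (subst exp_le_cancel_iff) simp
      finally show ?thesis .
    qed
    have "eventually (\<lambda>N. \<forall>z\<in>L. dist (exp (S N z - Q z)) 1 < e) sequentially"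
      by (rule uniform_limitD[OF ulexp[OF Lc LE] e])
    then obtain N where N: "N1 \<le> N" "\<And>z. z \<in> L \<Longrightarrow> dist (exp (S N z - Q z)) 1 < e"
      unfolding eventually_sequentially by (meson max.cobounded1 max.cobounded2)
    have nN: "n \<le> N" using N N1 by linarith
    show "\<exists>b\<in>disk_algebra. \<forall>w\<in>circle. norm (g n w - b w) < e"
    proof (intro bexI ballI)
      show "circ (G N) \<in> disk_algebra" by (rule circ_in_disk_algebra[OF GA])
      fix w assume w: "w \<in> circle"
      have b: "circ (G N) w = G N w" using w by (simp add: circ_def)
      show "norm (g n w - circ (G N) w) < e"
      proof (cases "w \<in> L")
        case True
        then have wE: "w \<in> circle - E" using LE by auto
        have "norm (G N w) \<le> 1"
          using Sge[OF nN w] umono[OF nN, of w] by (simp add: G_def)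
        have "g n w = G N w * exp (S N w - Q w)"
          using wE by (simp add: g_def G_def flip: exp_add)
        then have "norm (g n w - G N w) = norm (G N w) * norm (exp (S N w - Q w) - 1)"
          by (simp add: algebra_simps flip: norm_mult)
        also have "\<dots> \<le> 1 * norm (exp (S N w - Q w) - 1)"
          using \<open>norm (G N w) \<le> 1\<close> by (intro mult_right_mono) auto
        also have "\<dots> < e" using N(2)[OF True] by (simp add: dist_norm)
        finally show ?thesis by (simp add: b)
      next
        case False
        then have sm: "exp (u N1 w + real n) < e / 2" using w by (simp add: L_def)
        have "exp (u N w + real n) \<le> exp (u N1 w + real n)" using umono[OF N(1), of w] by simp
        then have 1: "norm (G N w) < e / 2" using GS[OF nN w] sm by linarith
        have 2: "norm (g n w) \<le> e / 2"
        proof (cases "w \<in> E")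
          case False
          then have wE: "w \<in> circle - E" using w by simp
          have "norm (g n w) = exp (Re (S n w - Q w))" using wE by (simp add: g_def)
          also have "\<dots> \<le> exp (u N1 w + real n)"
            using Qge[OF wE, of n] uge[of n w] ufge[OF fpos[OF wE], of N1]
            by (subst exp_le_cancel_iff) simp
          finally show ?thesis using sm by linarith
        qed (use e in \<open>simp add: g_def\<close>)
        have "norm (g n w - G N w) \<le> norm (g n w) + norm (G N w)" by (rule norm_triangle_ineq4)
        then show ?thesis using 1 2 by (simp add: b)
      qed
    qed
  qed (auto simp: g_def)
  have "\<exists>F. in_A F \<and> (\<forall>w\<in>circle. u n w \<le> Re (F w) \<and> Re (F w) \<le> u n w + 1 / (real n + 1))" for n
    using Re_approx_in_A[OF uc, of "1 / (real n + 1)" n] by (metis add_pos_nonneg of_nat_0_le_iff zero_less_divide_1_iff zero_less_one add.commute)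
  then obtain p where p: "\<And>n. in_A (p n)" "\<And>n w. w \<in> circle \<Longrightarrow> u n w \<le> Re (p n w)"
    "\<And>n w. w \<in> circle \<Longrightarrow> Re (p n w) \<le> u n w + 1 / (real n + 1)"
    by metis
  \<comment> \<open>\<open>Re (p n)\<close> may exceed \<open>u n\<close> by
    \<open>1 / (n + 1)\<close>; the constant subtracted in \<open>K\<close> cancels this excess and
    keeps the modulus of \<open>K\<close> below \<open>f\<close>. The tuples have length 1, so the
    index \<open>k\<close> is a dummy.\<close>
  define H where "H = (\<lambda>n (k::nat). circ (\<lambda>z. exp (- p n z)))"
  define K where "K = (\<lambda>n (k::nat). circ (\<lambda>z. exp (p n z - of_real (1 / (real n + 1)))) * g n)"
  have HA: "H n k \<in> disk_algebra" for n k
    unfolding H_def using p(1)[of n]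
    by (intro circ_in_disk_algebra) (auto simp: in_A_def intro!: continuous_intros holomorphic_intros)
  have KA: "K n k \<in> disk_algebra" for n k
    unfolding K_def using p(1)[of n]
    by (intro disk_algebra_mult gA circ_in_disk_algebra) (auto simp: in_A_def intro!: continuous_intros holomorphic_intros)
  have L1: "L2_set (\<lambda>k. cmod (c k w)) {..<1} = cmod (c 0 w)" for c :: "nat \<Rightarrow> complex \<Rightarrow> complex" and w
    by (simp add: L2_set_def lessThan_Suc)
  have "f \<in> R_class_on E"
    unfolding R_class_on_def
  proof (rule CollectI, intro conjI f(1), goal_cases)
    case 2
    show ?case
    proof (rule exI[of _ "\<lambda>_. 1::nat"], rule exI[of _ H], rule exI[of _ K], intro conjI allI ballI impI)
      fix n w assume w: "w \<in> circle"
      have "cmod (K n 0 w) = exp (Re (p n w) - 1 / (real n + 1)) * cmod (g n w)"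
        using w by (simp add: K_def circ_def norm_mult)
      also have "\<dots> \<le> exp (u n w) * cmod (g n w)"
        using p(3)[OF w, of n] by (intro mult_right_mono) (auto simp del: exp_diff)
      also have "\<dots> \<le> f w" using gle[OF w, of n] by (simp add: mult.commute)
      finally show "L2_set (\<lambda>k. cmod (K n k w)) {..<1} \<le> f w" by (simp only: L1)
      have h: "cmod (H n 0 w) = exp (- Re (p n w))" using w by (simp add: H_def circ_def)
      have "f w \<le> exp (u n w)" using mpos[of w n] by (simp add: u_def)
      also have "\<dots> \<le> exp (Re (p n w))" using p(2)[OF w] by simp
      finally have "f w \<le> 1 / cmod (H n 0 w)" by (simp add: h exp_minus divide_simps)
      moreover have "cmod (H n 0 w) \<noteq> 0" by (simp add: h)
      ultimately show "ereal (f w) \<le> 1 / ereal (L2_set (\<lambda>k. cmod (H n k w)) {..<1})"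
        by (simp only: L1) (simp add: one_ereal_def)
    next
      fix L assume L: "compact L \<and> L \<subseteq> circle - E"
      have "uniform_limit L (\<lambda>n w. of_real (exp (- (1 / (real n + 1)))) * exp (S n w - Q w)) (\<lambda>w. of_real 1 * 1) sequentially"
      proof (rule uniform_lim_mult)
        have "(\<lambda>n. complex_of_real (exp (- (1 / (real n + 1))))) \<longlonglongrightarrow> of_real 1"
          by (intro tendsto_of_real) real_asymp
        then show "uniform_limit L (\<lambda>n w. complex_of_real (exp (- (1 / (real n + 1))))) (\<lambda>w. of_real 1) sequentially"
          by (auto simp: uniform_limit_iff tendsto_iff elim: eventually_mono)
        show "uniform_limit L (\<lambda>n w. exp (S n w - Q w)) (\<lambda>w. 1) sequentially"
          using L by (intro ulexp) auto
      qed (simp_all add: image_constant_conv)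
      moreover have "(\<Sum>k<1. H n k w * K n k w) = of_real (exp (- (1 / (real n + 1)))) * exp (S n w - Q w)"
        if "w \<in> L" for n w
      proof -
        have w: "w \<in> circle" "w \<notin> E" using L that by auto
        have "exp (- p n w) * exp (p n w - of_real (1 / (real n + 1))) = of_real (exp (- (1 / (real n + 1))))"
          unfolding exp_add[symmetric] exp_of_real[symmetric] by simp
        then show ?thesis
          using w by (simp add: H_def K_def circ_def g_def mult.assoc[symmetric] del: exp_diff)
      qed
      ultimately show "uniform_limit L (\<lambda>n w. \<Sum>k<1. H n k w * K n k w) (\<lambda>_. 1) sequentially"
        by (subst uniform_limit_cong'[where g = "\<lambda>n w. of_real (exp (- (1 / (real n + 1)))) * exp (S n w - Q w)" and i = "\<lambda>_. of_real 1 * 1"]) auto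
    qed (use HA KA in auto)
  qed (simp add: E_def)
  moreover have "closed E"
  proof -
    have "closed (circle \<inter> f -` {0})"
      by (intro continuous_closed_preimage f) auto
    moreover have "circle \<inter> f -` {0} = E" by (auto simp: E_def)
    ultimately show ?thesis by simp
  qed
  moreover have "E \<subseteq> circle" by (auto simp: E_def)
  ultimately show ?thesis by (auto simp: R_class_def)
qed

section \<open>Operator norms of matrices\<close>

abbreviation l2 :: "nat \<Rightarrow> (nat \<Rightarrow> complex) \<Rightarrow> real" where
  "l2 n v \<equiv> L2_set (\<lambda>j. cmod (v j)) {..<n}"

abbreviation mat_vec :: "nat \<Rightarrow> (nat \<Rightarrow> nat \<Rightarrow> complex) \<Rightarrow> (nat \<Rightarrow> complex) \<Rightarrow> nat \<Rightarrow> complex" where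
  "mat_vec n a v \<equiv> (\<lambda>i. \<Sum>j<n. a i j * v j)"

lemma l2_nonneg: "0 \<le> l2 n v"
  by (rule L2_set_nonneg)

lemma l2_scale: "l2 n (\<lambda>j. c * v j) = cmod c * l2 n v"
  by (simp add: norm_mult L2_set_right_distrib)

lemma l2_triangle: "l2 n (\<lambda>j. u j + v j) \<le> l2 n u + l2 n v"
proof -
  have "l2 n (\<lambda>j. u j + v j) \<le> L2_set (\<lambda>j. cmod (u j) + cmod (v j)) {..<n}"
    by (rule L2_set_mono) (auto simp: norm_triangle_ineq)
  also have "\<dots> \<le> l2 n u + l2 n v" by (rule L2_set_triangle_ineq)
  finally show ?thesis .
qed

lemma l2_entry: "j < n \<Longrightarrow> cmod (v j) \<le> l2 n v"
  by (rule member_le_L2_set) auto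

lemma l2_0: "(\<And>j. j < n \<Longrightarrow> v j = 0) \<Longrightarrow> l2 n v = 0"
  by (subst L2_set_eq_0_iff) auto

lemma l2_dot: "cmod (\<Sum>j<n. u j * v j) \<le> l2 n u * l2 n v"
proof -
  have "cmod (\<Sum>j<n. u j * v j) \<le> (\<Sum>j<n. \<bar>cmod (u j)\<bar> * \<bar>cmod (v j)\<bar>)"
    by (rule order_trans[OF norm_sum]) (simp add: norm_mult)
  also have "\<dots> \<le> l2 n u * l2 n v" by (rule L2_set_mult_ineq)
  finally show ?thesis .
qed

lemma mat_vec_le_sum: "l2 m (mat_vec n a v) \<le> (\<Sum>i<m. \<Sum>j<n. cmod (a i j)) * l2 n v"
proof -
  have "l2 m (mat_vec n a v) \<le> (\<Sum>i<m. cmod (\<Sum>j<n. a i j * v j))"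
    by (rule L2_set_le_sum) auto
  also have "\<dots> \<le> (\<Sum>i<m. \<Sum>j<n. cmod (a i j) * l2 n v)"
    by (intro sum_mono order_trans[OF norm_sum]) (auto simp: norm_mult intro!: mult_left_mono l2_entry)
  also have "\<dots> = (\<Sum>i<m. \<Sum>j<n. cmod (a i j)) * l2 n v"
    by (simp add: sum_distrib_right)
  finally show ?thesis .
qed

lemma mat_norm_bdd:
  "bdd_above ((\<lambda>v. l2 m (mat_vec n a v)) ` {v. l2 n v \<le> 1})"
proof (rule bdd_aboveI2)
  fix v assume "v \<in> {v. l2 n v \<le> 1}"
  then have "(\<Sum>i<m. \<Sum>j<n. cmod (a i j)) * l2 n v \<le> (\<Sum>i<m. \<Sum>j<n. cmod (a i j)) * 1"
    by (intro mult_left_mono) (auto intro!: sum_nonneg)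
  then show "l2 m (mat_vec n a v) \<le> (\<Sum>i<m. \<Sum>j<n. cmod (a i j)) * 1"
    using mat_vec_le_sum[where m=m and n=n and a=a and v=v] by linarith
qed

lemma mat_norm_upper: "l2 n v \<le> 1 \<Longrightarrow> l2 m (mat_vec n a v) \<le> mat_norm m n a"
  unfolding mat_norm_def by (rule cSUP_upper[OF _ mat_norm_bdd]) simp

lemma mat_norm_least:
  assumes "\<And>v. l2 n v \<le> 1 \<Longrightarrow> l2 m (mat_vec n a v) \<le> c"
  shows "mat_norm m n a \<le> c"
  unfolding mat_norm_def
proof (rule cSUP_least)
  have "(\<lambda>_. 0) \<in> {v. l2 n v \<le> 1}" by (simp add: L2_set_def)
  then show "{v. l2 n v \<le> 1} \<noteq> {}" by (rule exI[THEN ex_in_conv[THEN iffD1]])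
next
  fix v assume "v \<in> {v. l2 n v \<le> 1}"
  then show "l2 m (mat_vec n a v) \<le> c" by (intro assms) simp
qed

lemma mat_norm_nonneg: "0 \<le> mat_norm m n a"
  using order_trans[OF l2_nonneg mat_norm_upper[where v="\<lambda>_. 0" and n=n and m=m and a=a]] by (simp add: L2_set_def)

lemma mat_vec_le: "l2 m (mat_vec n a v) \<le> mat_norm m n a * l2 n v"
proof (cases "l2 n v = 0")
  case True
  then have "v j = 0" if "j < n" for j using l2_entry[OF that, of v] by simp
  then show ?thesis using True by (simp add: L2_set_def)
next
  case False
  define s where "s = l2 n v"
  have s: "0 < s" using False l2_nonneg[where n=n and v=v] unfolding s_def by linarith
  have "l2 n (\<lambda>j. of_real (1 / s) * v j) = 1"
    unfolding l2_scale s_def[symmetric] using s by (simp add: norm_divide)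
  then have "l2 m (mat_vec n a (\<lambda>j. of_real (1 / s) * v j)) \<le> mat_norm m n a"
    by (intro mat_norm_upper) simp
  also have "mat_vec n a (\<lambda>j. of_real (1 / s) * v j) = (\<lambda>i. of_real (1 / s) * mat_vec n a v i)"
    by (simp add: sum_distrib_left mult.left_commute fun_eq_iff)
  finally have "1 / s * l2 m (mat_vec n a v) \<le> mat_norm m n a"
    unfolding l2_scale using s by (simp add: norm_divide)
  then show ?thesis using s by (simp add: s_def[symmetric] field_simps)
qed

lemma mat_norm_le_sum: "mat_norm m n a \<le> (\<Sum>i<m. \<Sum>j<n. cmod (a i j))"
proof (rule mat_norm_least)
  fix v assume "l2 n v \<le> 1"
  then have "(\<Sum>i<m. \<Sum>j<n. cmod (a i j)) * l2 n v \<le> (\<Sum>i<m. \<Sum>j<n. cmod (a i j)) * 1"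
    by (intro mult_left_mono) (auto intro!: sum_nonneg)
  then show "l2 m (mat_vec n a v) \<le> (\<Sum>i<m. \<Sum>j<n. cmod (a i j))"
    using mat_vec_le_sum[where m=m and n=n and a=a and v=v] by linarith
qed

lemma mat_norm_entry:
  assumes "i < m" "j < n"
  shows "cmod (a i j) \<le> mat_norm m n a"
proof -
  define v where "v = (\<lambda>k. if k = j then 1 else 0 :: complex)"
  have "(\<Sum>k<n. (cmod (v k))\<^sup>2) = (\<Sum>k<n. if k = j then 1 else 0)"
    by (rule sum.cong) (auto simp: v_def)
  also have "\<dots> = 1" using assms by simp
  finally have "l2 n v = 1" by (simp add: L2_set_def)
  then have "l2 m (mat_vec n a v) \<le> mat_norm m n a" by (intro mat_norm_upper) simp
  moreover have "mat_vec n a v i = a i j" using assms by (simp add: v_def if_distrib cong: if_cong)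
  ultimately show ?thesis using l2_entry[OF assms(1), of "mat_vec n a v"] by simp
qed

lemma C_circle_bounded:
  assumes "g \<in> C_circle"
  obtains B where "\<And>w. w \<in> circle \<Longrightarrow> cmod (g w) \<le> B"
proof -
  have "compact (g ` circle)"
    using assms by (intro compact_continuous_image) (auto simp: C_circle_def)
  then obtain B where "\<forall>x\<in>g ` circle. norm x \<le> B"
    using compact_imp_bounded bounded_iff by blast
  then show ?thesis by (intro that[of B]) blast
qed

lemma C_mnorm_bdd:
  assumes "\<forall>i<n. \<forall>j<n. g i j \<in> C_circle"
  shows "bdd_above ((\<lambda>w. mat_norm n n (\<lambda>i j. g i j w)) ` circle)"
proof -
  have "\<forall>i j. \<exists>B. i < n \<longrightarrow> j < n \<longrightarrow> (\<forall>w\<in>circle. cmod (g i j w) \<le> B)"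
  proof (intro allI)
    fix i j
    show "\<exists>B. i < n \<longrightarrow> j < n \<longrightarrow> (\<forall>w\<in>circle. cmod (g i j w) \<le> B)"
    proof (cases "i < n \<and> j < n")
      case True
      then have "g i j \<in> C_circle" using assms by blast
      then show ?thesis by (rule C_circle_bounded) blast
    qed blast
  qed
  then obtain B where "\<forall>i j. i < n \<longrightarrow> j < n \<longrightarrow> (\<forall>w\<in>circle. cmod (g i j w) \<le> B i j)"
    unfolding choice_iff by blast
  then have B: "\<And>i j w. i < n \<Longrightarrow> j < n \<Longrightarrow> w \<in> circle \<Longrightarrow> cmod (g i j w) \<le> B i j"
    by blast
  show ?thesis
  proof (rule bdd_aboveI2)
    fix w assume "w \<in> circle"
    then show "mat_norm n n (\<lambda>i j. g i j w) \<le> (\<Sum>i<n. \<Sum>j<n. B i j)"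
      by (intro order_trans[OF mat_norm_le_sum] sum_mono B) auto
  qed
qed

lemma C_mnorm_upper:
  assumes "\<forall>i<n. \<forall>j<n. g i j \<in> C_circle" "w \<in> circle"
  shows "mat_norm n n (\<lambda>i j. g i j w) \<le> C_mnorm n g"
  unfolding C_mnorm_def by (rule cSUP_upper[OF assms(2) C_mnorm_bdd[OF assms(1)]])

text \<open>Together with \<open>C_mnorm_apply\<close> this reduces estimates of a supremum of
  operator norms to vectors at a single point of the circle.\<close>

lemma C_mnorm_least:
  assumes "\<And>w v. w \<in> circle \<Longrightarrow> l2 n v \<le> 1 \<Longrightarrow> l2 n (mat_vec n (\<lambda>i j. g i j w) v) \<le> c"
  shows "C_mnorm n g \<le> c"
  unfolding C_mnorm_def
proof (rule cSUP_least)
  have "1 \<in> circle" by simp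
  then show "circle \<noteq> {}" by (rule exI[THEN ex_in_conv[THEN iffD1]])
next
  fix w :: complex assume "w \<in> circle"
  then show "mat_norm n n (\<lambda>i j. g i j w) \<le> c" by (rule mat_norm_least[OF assms])
qed

lemma C_mnorm_nonneg:
  assumes "\<forall>i<n. \<forall>j<n. g i j \<in> C_circle"
  shows "0 \<le> C_mnorm n g"
  using order_trans[OF mat_norm_nonneg C_mnorm_upper[OF assms, of 1]] by simp

lemma C_mnorm_apply:
  assumes "\<forall>i<n. \<forall>j<n. g i j \<in> C_circle" "w \<in> circle"
  shows "l2 n (mat_vec n (\<lambda>i j. g i j w) v) \<le> C_mnorm n g * l2 n v"
  using mat_vec_le C_mnorm_upper[OF assms] l2_nonneg by (meson mult_right_mono order_trans)

lemma C_mnorm_entry: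
  assumes "\<forall>i<n. \<forall>j<n. g i j \<in> C_circle" "w \<in> circle" "i < n" "j < n"
  shows "cmod (g i j w) \<le> C_mnorm n g"
  using mat_norm_entry[OF assms(3,4), of "\<lambda>i j. g i j w"] C_mnorm_upper[OF assms(1,2)] by linarith

lemma C_mnorm_1_least:
  assumes "\<And>w. w \<in> circle \<Longrightarrow> cmod (g w) \<le> c"
  shows "C_mnorm 1 (\<lambda>_ _. g) \<le> c"
proof (rule C_mnorm_least)
  fix w v assume w: "w \<in> circle" and v: "l2 1 v \<le> 1"
  have "l2 1 (mat_vec 1 (\<lambda>_ _. g w) v) = cmod (g w) * cmod (v 0)"
    by (simp add: L2_set_def norm_mult)
  also have "\<dots> \<le> cmod (g w) * 1"
    using v by (intro mult_left_mono) (auto simp: L2_set_def)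
  finally show "l2 1 (mat_vec 1 (\<lambda>_ _. g w) v) \<le> c" using assms[OF w] by simp
qed

lemma C_mnorm_1_upper: "g \<in> C_circle \<Longrightarrow> w \<in> circle \<Longrightarrow> cmod (g w) \<le> C_mnorm 1 (\<lambda>_ _. g)"
  using C_mnorm_entry[of 1 "\<lambda>_ _. g" w 0 0] by simp

lemma C_circle_add: "g \<in> C_circle \<Longrightarrow> h \<in> C_circle \<Longrightarrow> g + h \<in> C_circle"
  by (auto simp: C_circle_def plus_fun_def intro!: continuous_intros)

lemma C_circle_mult: "g \<in> C_circle \<Longrightarrow> h \<in> C_circle \<Longrightarrow> g * h \<in> C_circle"
  by (auto simp: C_circle_def times_fun_def intro!: continuous_intros)

lemma C_circle_scale: "g \<in> C_circle \<Longrightarrow> (\<lambda>z. c * g z) \<in> C_circle"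
  by (auto simp: C_circle_def intro!: continuous_intros)

lemma C_circle_zero: "0 \<in> C_circle"
  by (auto simp: C_circle_def zero_fun_def)

lemma sum_fun_apply: "(\<Sum>i\<in>I. g i) w = (\<Sum>i\<in>I. g i w)"
  for g :: "'i \<Rightarrow> 'a \<Rightarrow> 'b::comm_monoid_add"
  by (induction I rule: infinite_finite_induct) auto

lemma sum_lessThan_add: "(\<Sum>i<m + n. g i) = (\<Sum>i<m. g i) + (\<Sum>i<n. g (m + i))"
  for m n :: nat and g :: "nat \<Rightarrow> 'b::comm_monoid_add"
  by (induction n) (auto simp: add.assoc)

lemma l2_power2: "(l2 n v)\<^sup>2 = (\<Sum>i<n. (cmod (v i))\<^sup>2)"
  by (simp add: L2_set_def sum_nonneg)

lemma C_mnorm_scale_le: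
  assumes "\<forall>i<n. \<forall>j<n. g i j \<in> C_circle"
  shows "C_mnorm n (\<lambda>i j z. c * g i j z) \<le> cmod c * C_mnorm n g"
proof (rule C_mnorm_least)
  fix w v assume w: "w \<in> circle" and v: "l2 n v \<le> 1"
  have "mat_vec n (\<lambda>i j. c * g i j w) v i = c * mat_vec n (\<lambda>i j. g i j w) v i" for i
    by (simp add: sum_distrib_left mult.assoc)
  then have "l2 n (mat_vec n (\<lambda>i j. c * g i j w) v) = cmod c * l2 n (mat_vec n (\<lambda>i j. g i j w) v)"
    by (simp only: l2_scale)
  also have "l2 n (mat_vec n (\<lambda>i j. g i j w) v) \<le> C_mnorm n g * 1"
    by (rule order_trans[OF C_mnorm_apply[OF assms w]]) (intro mult_left_mono v C_mnorm_nonneg assms)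
  finally show "l2 n (mat_vec n (\<lambda>i j. c * g i j w) v) \<le> cmod c * C_mnorm n g"
    by (simp add: mult_left_mono)
qed

lemma C_mnorm_mult_le:
  assumes "\<forall>i<n. \<forall>j<n. p i j \<in> C_circle" "\<forall>i<n. \<forall>j<n. x i j \<in> C_circle"
  shows "C_mnorm n (\<lambda>i j. \<Sum>k<n. p i k * x k j) \<le> C_mnorm n p * C_mnorm n x"
proof (rule C_mnorm_least)
  fix w v assume w: "w \<in> circle" and v: "l2 n v \<le> 1"
  have "mat_vec n (\<lambda>i j. (\<Sum>k<n. p i k * x k j) w) v i
      = mat_vec n (\<lambda>i j. p i j w) (mat_vec n (\<lambda>i j. x i j w) v) i" for i
  proof -
    have "mat_vec n (\<lambda>i j. (\<Sum>k<n. p i k * x k j) w) v i = (\<Sum>j<n. \<Sum>k<n. p i k w * (x k j w * v j))"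
      by (simp add: sum_fun_apply sum_distrib_right mult.assoc)
    also have "\<dots> = (\<Sum>k<n. \<Sum>j<n. p i k w * (x k j w * v j))" by (rule sum.swap)
    finally show ?thesis by (simp add: sum_distrib_left)
  qed
  then have "l2 n (mat_vec n (\<lambda>i j. (\<Sum>k<n. p i k * x k j) w) v)
      \<le> C_mnorm n p * l2 n (mat_vec n (\<lambda>i j. x i j w) v)"
    by (simp only: C_mnorm_apply[OF assms(1) w])
  also have "l2 n (mat_vec n (\<lambda>i j. x i j w) v) \<le> C_mnorm n x * 1"
    by (rule order_trans[OF C_mnorm_apply[OF assms(2) w]]) (intro mult_left_mono v C_mnorm_nonneg assms)
  finally show "l2 n (mat_vec n (\<lambda>i j. (\<Sum>k<n. p i k * x k j) w) v) \<le> C_mnorm n p * C_mnorm n x"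
    using C_mnorm_nonneg[OF assms(1)] by (simp add: mult_left_mono)
qed

lemma C_mnorm_scalar_mult_le:
  assumes x: "\<forall>i<n. \<forall>j<n. x i j \<in> C_circle"
  shows "C_mnorm m (\<lambda>i j. \<Sum>k<n. \<Sum>l<n. (\<lambda>z. (\<alpha> i k * \<beta> l j) * x k l z))
      \<le> mat_norm m n \<alpha> * C_mnorm n x * mat_norm n m \<beta>"
proof (rule C_mnorm_least)
  fix w v assume w: "w \<in> circle" and v: "l2 m v \<le> 1"
  have "(\<Sum>j<m. (\<Sum>k<n. \<Sum>l<n. (\<alpha> i k * \<beta> l j) * x k l w) * v j)
      = (\<Sum>k<n. \<alpha> i k * (\<Sum>l<n. x k l w * (\<Sum>j<m. \<beta> l j * v j)))" for i
  proof -
    have "(\<Sum>j<m. (\<Sum>k<n. \<Sum>l<n. (\<alpha> i k * \<beta> l j) * x k l w) * v j)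
        = (\<Sum>j<m. \<Sum>k<n. \<Sum>l<n. \<alpha> i k * (x k l w * (\<beta> l j * v j)))"
      by (simp add: sum_distrib_right sum_distrib_left mult_ac)
    also have "\<dots> = (\<Sum>k<n. \<Sum>j<m. \<Sum>l<n. \<alpha> i k * (x k l w * (\<beta> l j * v j)))"
      by (rule sum.swap)
    also have "\<dots> = (\<Sum>k<n. \<Sum>l<n. \<Sum>j<m. \<alpha> i k * (x k l w * (\<beta> l j * v j)))"
      by (intro sum.cong refl sum.swap)
    finally show ?thesis by (simp add: sum_distrib_left)
  qed
  then have "mat_vec m (\<lambda>i j. (\<Sum>k<n. \<Sum>l<n. (\<lambda>z. (\<alpha> i k * \<beta> l j) * x k l z)) w) v i
      = mat_vec n \<alpha> (mat_vec n (\<lambda>k l. x k l w) (mat_vec m \<beta> v)) i" for i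
    by (simp add: sum_fun_apply)
  then have "l2 m (mat_vec m (\<lambda>i j. (\<Sum>k<n. \<Sum>l<n. (\<lambda>z. (\<alpha> i k * \<beta> l j) * x k l z)) w) v)
      \<le> mat_norm m n \<alpha> * l2 n (mat_vec n (\<lambda>k l. x k l w) (mat_vec m \<beta> v))"
    by (simp only: mat_vec_le)
  also have "\<dots> \<le> mat_norm m n \<alpha> * (C_mnorm n x * l2 n (mat_vec m \<beta> v))"
    by (intro mult_left_mono C_mnorm_apply[OF x w] mat_norm_nonneg)
  also have "\<dots> \<le> mat_norm m n \<alpha> * (C_mnorm n x * mat_norm n m \<beta>)"
    by (intro mult_left_mono mat_norm_upper v mat_norm_nonneg C_mnorm_nonneg[OF x])
  finally show "l2 m (mat_vec m (\<lambda>i j. (\<Sum>k<n. \<Sum>l<n. (\<lambda>z. (\<alpha> i k * \<beta> l j) * x k l z)) w) v)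
      \<le> mat_norm m n \<alpha> * C_mnorm n x * mat_norm n m \<beta>" by (simp only: mult.assoc)
qed

text \<open>Squares of Euclidean norms add over the two blocks of coordinates, which bounds the
  block matrix by the larger norm. Vectors padded with zeros give the reverse inequality.\<close>

lemma C_mnorm_direct_sum:
  assumes x: "\<forall>i<m. \<forall>j<m. x i j \<in> C_circle" and y: "\<forall>i<n. \<forall>j<n. y i j \<in> C_circle"
  shows "C_mnorm (m + n) (\<lambda>i j. if i < m \<and> j < m then x i j
              else if m \<le> i \<and> m \<le> j then y (i - m) (j - m) else 0)
            = max (C_mnorm m x) (C_mnorm n y)" (is "C_mnorm _ ?z = max ?a ?b")
proof (rule antisym)
  let ?D = "\<lambda>v w. mat_vec (m + n) (\<lambda>i j. ?z i j w) v"
  have D1: "?D v w i = mat_vec m (\<lambda>i j. x i j w) v i" if "i < m" for v w i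
    using that by (simp add: sum_lessThan_add)
  have D2: "?D v w (m + i) = mat_vec n (\<lambda>i j. y i j w) (\<lambda>j. v (m + j)) i" for v w i
    by (simp add: sum_lessThan_add)
  have D: "(l2 (m + n) (?D v w))\<^sup>2 = (l2 m (mat_vec m (\<lambda>i j. x i j w) v))\<^sup>2
      + (l2 n (mat_vec n (\<lambda>i j. y i j w) (\<lambda>j. v (m + j))))\<^sup>2" for v w
  proof -
    have "(l2 (m + n) (?D v w))\<^sup>2 = (\<Sum>i<m. (cmod (?D v w i))\<^sup>2) + (\<Sum>i<n. (cmod (?D v w (m + i)))\<^sup>2)"
      unfolding l2_power2 by (rule sum_lessThan_add)
    also have "(\<Sum>i<m. (cmod (?D v w i))\<^sup>2) = (l2 m (mat_vec m (\<lambda>i j. x i j w) v))\<^sup>2"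
      unfolding l2_power2
    proof (rule sum.cong)
      fix i assume "i \<in> {..<m}"
      then have "i < m" by simp
      from D1[OF this] show "(cmod (?D v w i))\<^sup>2 = (cmod (mat_vec m (\<lambda>i j. x i j w) v i))\<^sup>2"
        by (rule arg_cong)
    qed simp
    also have "(\<Sum>i<n. (cmod (?D v w (m + i)))\<^sup>2) = (l2 n (mat_vec n (\<lambda>i j. y i j w) (\<lambda>j. v (m + j))))\<^sup>2"
      unfolding l2_power2 D2 by (rule refl)
    finally show ?thesis .
  qed
  have V: "(l2 (m + n) v)\<^sup>2 = (l2 m v)\<^sup>2 + (l2 n (\<lambda>j. v (m + j)))\<^sup>2" for v
    unfolding l2_power2 by (rule sum_lessThan_add)
  have z: "\<forall>i<m + n. \<forall>j<m + n. ?z i j \<in> C_circle"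
    using x y by (auto simp: C_circle_zero)
  have a0: "0 \<le> ?a" "0 \<le> ?b" using C_mnorm_nonneg x y by auto
  show "C_mnorm (m + n) ?z \<le> max ?a ?b"
  proof (rule C_mnorm_least)
    fix w v assume w: "w \<in> circle" and v: "l2 (m + n) v \<le> 1"
    have "l2 m (mat_vec m (\<lambda>i j. x i j w) v) \<le> max ?a ?b * l2 m v"
      using C_mnorm_apply[OF x w, of v] by (rule order_trans) (intro mult_right_mono l2_nonneg max.cobounded1)
    moreover have "l2 n (mat_vec n (\<lambda>i j. y i j w) (\<lambda>j. v (m + j))) \<le> max ?a ?b * l2 n (\<lambda>j. v (m + j))"
      using C_mnorm_apply[OF y w, of "\<lambda>j. v (m + j)"] by (rule order_trans) (intro mult_right_mono l2_nonneg max.cobounded2)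
    ultimately have "(l2 (m + n) (?D v w))\<^sup>2 \<le> (max ?a ?b * l2 m v)\<^sup>2 + (max ?a ?b * l2 n (\<lambda>j. v (m + j)))\<^sup>2"
      unfolding D by (intro add_mono power_mono l2_nonneg)
    also have "\<dots> = (max ?a ?b)\<^sup>2 * (l2 (m + n) v)\<^sup>2" by (simp only: V) (simp add: power_mult_distrib algebra_simps)
    also have "\<dots> \<le> (max ?a ?b)\<^sup>2 * 1"
      by (intro mult_left_mono power_le_one l2_nonneg v zero_le_power2)
    finally have "(l2 (m + n) (?D v w))\<^sup>2 \<le> (max ?a ?b)\<^sup>2" by (simp only: mult_1_right)
    then show "l2 (m + n) (?D v w) \<le> max ?a ?b"
      by (rule power2_le_imp_le) (rule max.coboundedI1[OF a0(1)])
  qed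
  have "?a \<le> C_mnorm (m + n) ?z"
  proof (rule C_mnorm_least)
    fix w v assume w: "w \<in> circle" and v: "l2 m v \<le> 1"
    define v' where "v' = (\<lambda>j. if j < m then v j else 0)"
    have v'1: "l2 m v' = l2 m v" by (rule L2_set_cong) (auto simp: v'_def)
    have "l2 n (\<lambda>j. v' (m + j)) = 0" by (rule l2_0) (simp add: v'_def)
    then have "(l2 (m + n) v')\<^sup>2 = (l2 m v)\<^sup>2" unfolding V v'1 by simp
    then have "l2 (m + n) v' = l2 m v" by (rule power2_eq_imp_eq[OF _ l2_nonneg l2_nonneg])
    then have v'2: "l2 (m + n) v' \<le> 1" using v by (simp only:)
    have "l2 m (mat_vec m (\<lambda>i j. x i j w) v) = l2 m (mat_vec m (\<lambda>i j. x i j w) v')"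
      by (intro L2_set_cong refl arg_cong[where f=cmod] sum.cong) (auto simp: v'_def)
    also have "\<dots> \<le> l2 (m + n) (?D v' w)"
    proof (rule power2_le_imp_le)
      show "(l2 m (mat_vec m (\<lambda>i j. x i j w) v'))\<^sup>2 \<le> (l2 (m + n) (?D v' w))\<^sup>2" unfolding D by simp
    qed (rule l2_nonneg)
    also have "\<dots> \<le> C_mnorm (m + n) ?z * l2 (m + n) v'" by (rule C_mnorm_apply[OF z w])
    also have "\<dots> \<le> C_mnorm (m + n) ?z * 1" by (intro mult_left_mono v'2 C_mnorm_nonneg z)
    finally show "l2 m (mat_vec m (\<lambda>i j. x i j w) v) \<le> C_mnorm (m + n) ?z" by simp
  qed
  moreover have "?b \<le> C_mnorm (m + n) ?z"
  proof (rule C_mnorm_least)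
    fix w v assume w: "w \<in> circle" and v: "l2 n v \<le> 1"
    define v' where "v' = (\<lambda>j. if j < m then 0 else v (j - m))"
    have v'1: "v' (m + j) = v j" for j by (simp add: v'_def)
    have "l2 m v' = 0" by (rule l2_0) (simp add: v'_def)
    then have "(l2 (m + n) v')\<^sup>2 = (l2 n v)\<^sup>2" unfolding V v'1 by simp
    then have "l2 (m + n) v' = l2 n v" by (rule power2_eq_imp_eq[OF _ l2_nonneg l2_nonneg])
    then have v'2: "l2 (m + n) v' \<le> 1" using v by (simp only:)
    have "l2 n (mat_vec n (\<lambda>i j. y i j w) v) \<le> l2 (m + n) (?D v' w)"
    proof (rule power2_le_imp_le)
      show "(l2 n (mat_vec n (\<lambda>i j. y i j w) v))\<^sup>2 \<le> (l2 (m + n) (?D v' w))\<^sup>2" unfolding D v'1 by simp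
    qed (rule l2_nonneg)
    also have "\<dots> \<le> C_mnorm (m + n) ?z * l2 (m + n) v'" by (rule C_mnorm_apply[OF z w])
    also have "\<dots> \<le> C_mnorm (m + n) ?z * 1" by (intro mult_left_mono v'2 C_mnorm_nonneg z)
    finally show "l2 n (mat_vec n (\<lambda>i j. y i j w) v) \<le> C_mnorm (m + n) ?z" by simp
  qed
  ultimately show "max ?a ?b \<le> C_mnorm (m + n) ?z" by simp
qed

section \<open>Closed submodules of C(T) as operator modules\<close>

lemma closed_submodule_simps:
  "scl (closed_submodule f) = (\<lambda>c g z. c * g z)"
  "mnorm (closed_submodule f) = C_mnorm"
  "act (closed_submodule f) = (\<lambda>a g. a * g)"
  by (simp_all add: closed_submodule_def)

lemma mem_closed_submodule:
  "g \<in> car (closed_submodule f) \<longleftrightarrow>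
     g \<in> C_circle \<and> (\<forall>e>0. \<exists>a\<in>disk_algebra. \<forall>w\<in>circle. cmod (g w - a w * f w) < e)"
  by (simp add: closed_submodule_def)

lemma closed_submodule_add:
  assumes "g \<in> car (closed_submodule f)" "h \<in> car (closed_submodule f)"
  shows "g + h \<in> car (closed_submodule f)"
  unfolding mem_closed_submodule
proof (intro conjI allI impI)
  fix e :: real assume "0 < e"
  then obtain a b where a: "a \<in> disk_algebra" "\<forall>w\<in>circle. cmod (g w - a w * f w) < e / 2"
    and b: "b \<in> disk_algebra" "\<forall>w\<in>circle. cmod (h w - b w * f w) < e / 2"
    using assms unfolding mem_closed_submodule by (meson half_gt_zero)
  show "\<exists>a\<in>disk_algebra. \<forall>w\<in>circle. cmod ((g + h) w - a w * f w) < e"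
  proof (intro bexI ballI)
    fix w :: complex assume w: "w \<in> circle"
    have "cmod ((g + h) w - (a + b) w * f w) = cmod ((g w - a w * f w) + (h w - b w * f w))"
      by (simp add: algebra_simps)
    also have "\<dots> \<le> cmod (g w - a w * f w) + cmod (h w - b w * f w)" by (rule norm_triangle_ineq)
    also have "\<dots> < e" using a(2) b(2) w by (metis add_strict_mono field_sum_of_halves)
    finally show "cmod ((g + h) w - (a + b) w * f w) < e" .
  qed (intro disk_algebra_add a b)
qed (use assms in \<open>auto simp: mem_closed_submodule intro: C_circle_add\<close>)

lemma closed_submodule_act:
  assumes "a \<in> disk_algebra" "g \<in> car (closed_submodule f)"
  shows "a * g \<in> car (closed_submodule f)"
  unfolding mem_closed_submodule
proof (intro conjI allI impI)
  show "a * g \<in> C_circle"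
    using assms by (auto simp: mem_closed_submodule intro: C_circle_mult disk_algebra_C_circle)
  fix e :: real assume e: "0 < e"
  obtain B where B: "\<And>w. w \<in> circle \<Longrightarrow> cmod (a w) \<le> B"
    using C_circle_bounded[OF disk_algebra_C_circle[OF assms(1)]] by blast
  have B0: "0 \<le> B" using order_trans[OF norm_ge_zero B[of 1]] by simp
  obtain b where b: "b \<in> disk_algebra" "\<forall>w\<in>circle. cmod (g w - b w * f w) < e / (B + 1)"
    using assms(2) e B0 unfolding mem_closed_submodule by (metis add_nonneg_pos divide_pos_pos zero_less_one)
  show "\<exists>b\<in>disk_algebra. \<forall>w\<in>circle. cmod ((a * g) w - b w * f w) < e"
  proof (intro bexI ballI)
    fix w :: complex assume w: "w \<in> circle"
    have "cmod ((a * g) w - (a * b) w * f w) = cmod (a w) * cmod (g w - b w * f w)"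
      by (simp add: algebra_simps flip: norm_mult)
    also have "\<dots> \<le> B * (e / (B + 1))" using b(2) w B[OF w] B0
      by (intro mult_mono) (auto intro: less_imp_le)
    also have "\<dots> < e" using B0 e by (simp add: field_simps)
    finally show "cmod ((a * g) w - (a * b) w * f w) < e" .
  qed (intro disk_algebra_mult assms b)
qed

lemma closed_submodule_scale:
  assumes "g \<in> car (closed_submodule f)"
  shows "(\<lambda>z. c * g z) \<in> car (closed_submodule f)"
proof -
  have "g \<in> C_circle" using assms by (simp add: mem_closed_submodule)
  then have "(\<lambda>z. c * g z) = circ (\<lambda>_. c) * g"
    by (auto simp: fun_eq_iff circ_def C_circle_def)
  then show ?thesis using closed_submodule_act[OF disk_algebra_const assms] by simp
qed

lemma closed_submodule_zero: "0 \<in> car (closed_submodule f)"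
  unfolding mem_closed_submodule
  by (auto intro!: C_circle_zero bexI[OF _ disk_algebra_zero])

lemma closed_submodule_generated:
  assumes f: "continuous_on circle f" and a: "a \<in> disk_algebra"
  shows "(\<lambda>w. a w * of_real (f w)) \<in> car (closed_submodule f)"
  unfolding mem_closed_submodule
proof (intro conjI allI impI bexI[OF _ a])
  show "(\<lambda>w. a w * of_real (f w)) \<in> C_circle"
    using f disk_algebra_C_circle[OF a] by (auto simp: C_circle_def intro!: continuous_intros)
qed auto

lemma closed_submodule_complete:
  assumes s: "\<And>k::nat. s k \<in> car (closed_submodule f)"
    and cauchy: "\<And>e. e > 0 \<Longrightarrow> \<exists>N. \<forall>k\<ge>N. \<forall>l\<ge>N. \<forall>w\<in>circle. cmod (s k w - s l w) < e"
  obtains g where "g \<in> car (closed_submodule f)" "uniform_limit circle s g sequentially"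
proof -
  have "uniformly_Cauchy_on circle s"
    unfolding uniformly_Cauchy_on_def dist_norm using cauchy by blast
  then obtain h where h: "uniform_limit circle s h sequentially"
    using Cauchy_uniformly_convergent uniformly_convergent_on_def by blast
  \<comment> \<open>The uniform limit is determined on the circle only; \<open>circ\<close> restores
    the value 0 elsewhere.\<close>
  define g where "g = circ h"
  have g: "uniform_limit circle s g sequentially"
    using h by (auto simp: uniform_limit_iff g_def circ_def)
  have "continuous_on circle g"
    by (rule uniform_limit_theorem[OF _ g]) (use s in \<open>auto simp: mem_closed_submodule C_circle_def\<close>)
  then have gC: "g \<in> C_circle" by (simp add: C_circle_def g_def circ_def)
  have "\<exists>a\<in>disk_algebra. \<forall>w\<in>circle. cmod (g w - a w * f w) < e" if e: "0 < e" for e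
  proof -
    from uniform_limitD[OF g, of "e / 2"] e obtain k where k: "\<forall>w\<in>circle. dist (s k w) (g w) < e / 2"
      by (auto simp: eventually_sequentially)
    obtain a where a: "a \<in> disk_algebra" "\<forall>w\<in>circle. cmod (s k w - a w * f w) < e / 2"
      using s[of k] e unfolding mem_closed_submodule by (meson half_gt_zero)
    show ?thesis
    proof (intro bexI[OF _ a(1)] ballI)
      fix w :: complex assume w: "w \<in> circle"
      have "cmod (g w - a w * f w) = cmod ((s k w - a w * f w) - (s k w - g w))" by simp
      also have "\<dots> \<le> cmod (s k w - a w * f w) + cmod (s k w - g w)" by (rule norm_triangle_ineq4)
      also have "\<dots> < e" using a(2) k w by (metis add_strict_mono field_sum_of_halves dist_norm)
      finally show "cmod (g w - a w * f w) < e" .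
    qed
  qed
  with gC have "g \<in> car (closed_submodule f)" by (simp add: mem_closed_submodule)
  with g that show ?thesis by blast
qed

lemma closed_submodule_C_circle: "g \<in> car (closed_submodule f) \<Longrightarrow> g \<in> C_circle"
  by (simp add: mem_closed_submodule)

lemma C_circle_diff: "g \<in> C_circle \<Longrightarrow> h \<in> C_circle \<Longrightarrow> g - h \<in> C_circle"
  by (auto simp: C_circle_def intro!: continuous_intros simp: fun_diff_def)

lemma vnorm_closed_submodule: "vnorm (closed_submodule f) = (\<lambda>g. C_mnorm 1 (\<lambda>_ _. g))"
  by (simp add: vnorm_def closed_submodule_simps fun_eq_iff)

text \<open>Ruan's axioms hold pointwise, since matrices over the submodule are matrix-valued
  functions on the circle; completeness is that of a closed subspace in the uniform norm.\<close>

lemma left_operator_module_closed_submodule: "left_operator_module (closed_submodule f)"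
proof -
  have C: "\<forall>i<m. \<forall>j<n. x i j \<in> C_circle" if "x \<in> mats (closed_submodule f) m n" for x m n
    using that by (auto simp: mats_def intro: closed_submodule_C_circle)
  show ?thesis
  proof (unfold_locales, unfold closed_submodule_simps vnorm_closed_submodule)
    fix x n assume x: "x \<in> mats (closed_submodule f) n n"
    show "0 \<le> C_mnorm n x" by (rule C_mnorm_nonneg[OF C[OF x]])
    show "C_mnorm n x = 0 \<longleftrightarrow> (\<forall>i<n. \<forall>j<n. x i j = 0)"
    proof
      assume 0: "C_mnorm n x = 0"
      show "\<forall>i<n. \<forall>j<n. x i j = 0"
      proof (intro allI impI ext)
        fix i j w assume ij: "i < n" "j < n"
        show "x i j w = 0 w"
        proof (cases "w \<in> circle")
          case True
          then show ?thesis using C_mnorm_entry[OF C[OF x] True ij] 0 by simp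
        next
          case False
          then show ?thesis using C[OF x] ij by (auto simp: C_circle_def)
        qed
      qed
    next
      assume "\<forall>i<n. \<forall>j<n. x i j = 0"
      then have "C_mnorm n x \<le> 0"
        by (intro C_mnorm_least) (simp add: L2_set_def)
      then show "C_mnorm n x = 0" using C_mnorm_nonneg[OF C[OF x]] by simp
    qed
    show "C_mnorm n (\<lambda>i j z. c * x i j z) = cmod c * C_mnorm n x" for c
    proof (rule antisym[OF C_mnorm_scale_le[OF C[OF x]]])
      show "cmod c * C_mnorm n x \<le> C_mnorm n (\<lambda>i j z. c * x i j z)"
      proof (cases "c = 0")
        case False
        have "C_mnorm n (\<lambda>i j z. inverse c * (c * x i j z)) \<le> cmod (inverse c) * C_mnorm n (\<lambda>i j z. c * x i j z)"
          by (rule C_mnorm_scale_le) (use C[OF x] in \<open>auto intro: C_circle_scale\<close>)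
        moreover have "(\<lambda>i j z. inverse c * (c * x i j z)) = x" using False by (simp add: fun_eq_iff)
        ultimately have "C_mnorm n x \<le> cmod (inverse c) * C_mnorm n (\<lambda>i j z. c * x i j z)" by simp
        then show ?thesis using False by (simp add: norm_divide field_simps)
      qed (use C_mnorm_nonneg[of n "\<lambda>i j z. 0"] C_circle_zero in \<open>simp add: zero_fun_def\<close>)
    qed
    fix y assume y: "y \<in> mats (closed_submodule f) n n"
    show "C_mnorm n (\<lambda>i j. x i j + y i j) \<le> C_mnorm n x + C_mnorm n y"
    proof (rule C_mnorm_least)
      fix w v assume w: "w \<in> circle" and v: "l2 n v \<le> 1"
      have "mat_vec n (\<lambda>i j. (x i j + y i j) w) v i
          = mat_vec n (\<lambda>i j. x i j w) v i + mat_vec n (\<lambda>i j. y i j w) v i" for i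
        by (simp add: algebra_simps sum.distrib)
      then have "l2 n (mat_vec n (\<lambda>i j. (x i j + y i j) w) v)
          \<le> l2 n (mat_vec n (\<lambda>i j. x i j w) v) + l2 n (mat_vec n (\<lambda>i j. y i j w) v)"
        by (simp only: l2_triangle)
      also have "\<dots> \<le> C_mnorm n x * 1 + C_mnorm n y * 1"
        by (intro add_mono order_trans[OF C_mnorm_apply[OF C w]] x y mult_left_mono v C_mnorm_nonneg[OF C])
      finally show "l2 n (mat_vec n (\<lambda>i j. (x i j + y i j) w) v) \<le> C_mnorm n x + C_mnorm n y" by simp
    qed
  next
    fix x m y n assume "x \<in> mats (closed_submodule f) m m" "y \<in> mats (closed_submodule f) n n"
    then show "C_mnorm (m + n) (\<lambda>i j. if i < m \<and> j < m then x i j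
              else if m \<le> i \<and> m \<le> j then y (i - m) (j - m) else 0) = max (C_mnorm m x) (C_mnorm n y)"
      by (intro C_mnorm_direct_sum C)
  next
    fix x n m \<alpha> \<beta> assume "x \<in> mats (closed_submodule f) n n"
    then show "C_mnorm m (\<lambda>i j. \<Sum>k<n. \<Sum>l<n. (\<lambda>z. \<alpha> i k * \<beta> l j * x k l z))
            \<le> mat_norm m n \<alpha> * C_mnorm n x * mat_norm n m \<beta>"
      by (intro C_mnorm_scalar_mult_le C)
  next
    fix s :: "nat \<Rightarrow> complex \<Rightarrow> complex"
    assume s: "\<And>k. s k \<in> car (closed_submodule f)"
      and cauchy: "\<And>e. e > 0 \<Longrightarrow> \<exists>N. \<forall>k\<ge>N. \<forall>l\<ge>N. C_mnorm 1 (\<lambda>_ _. s k - s l) < e"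
    note sC = closed_submodule_C_circle[OF s]
    obtain g where g: "g \<in> car (closed_submodule f)" "uniform_limit circle s g sequentially"
    proof (rule closed_submodule_complete[OF s])
      fix e :: real assume "0 < e"
      from cauchy[OF this] show "\<exists>N. \<forall>k\<ge>N. \<forall>l\<ge>N. \<forall>w\<in>circle. cmod (s k w - s l w) < e"
        using C_mnorm_1_upper[OF C_circle_diff[OF sC sC]] by (metis fun_diff_def order_le_less_trans)
    qed blast
    have "(\<lambda>k. C_mnorm 1 (\<lambda>_ _. s k - g)) \<longlonglongrightarrow> 0"
    proof (rule tendstoI)
      fix e :: real assume e: "0 < e"
      from uniform_limitD[OF g(2), of "e / 2"] e
      have "eventually (\<lambda>k. \<forall>w\<in>circle. dist (s k w) (g w) < e / 2) sequentially" by simp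
      then show "eventually (\<lambda>k. dist (C_mnorm 1 (\<lambda>_ _. s k - g)) 0 < e) sequentially"
      proof eventually_elim
        case (elim k)
        then have "C_mnorm 1 (\<lambda>_ _. s k - g) \<le> e / 2"
          by (intro C_mnorm_1_least) (auto simp: dist_norm less_imp_le)
        moreover have "0 \<le> C_mnorm 1 (\<lambda>_ _. s k - g)"
          using C_circle_diff[OF sC closed_submodule_C_circle[OF g(1)]] by (intro C_mnorm_nonneg) auto
        ultimately show ?case using e by simp
      qed
    qed
    with g(1) show "\<exists>u\<in>car (closed_submodule f). (\<lambda>k. C_mnorm 1 (\<lambda>_ _. s k - u)) \<longlonglongrightarrow> 0" by blast
  next
    fix u assume "u \<in> car (closed_submodule f)"
    then show "indicator circle * u = u"
      using closed_submodule_C_circle by (force simp: fun_eq_iff C_circle_def indicator_def)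
  next
    fix n p x
    assume "\<forall>i<n. \<forall>k<n. p i k \<in> disk_algebra" "x \<in> mats (closed_submodule f) n n"
    then show "C_mnorm n (\<lambda>i j. \<Sum>k<n. p i k * x k j) \<le> C_mnorm n p * C_mnorm n x"
      by (intro C_mnorm_mult_le[OF _ C]) (auto intro: disk_algebra_C_circle)
  qed (auto simp: closed_submodule_zero closed_submodule_add closed_submodule_act closed_submodule_scale
      fun_eq_iff algebra_simps)
qed

section \<open>Riggings from approximations in modulus\<close>

lemma closed_submoduleE:
  assumes "g \<in> car (closed_submodule f)" "0 < e"
  obtains a where "a \<in> disk_algebra" "\<And>w. w \<in> circle \<Longrightarrow> cmod (g w - a w * f w) < e"
  using assms unfolding mem_closed_submodule by blast

lemma row_module_simps:
  "car (row_module n) = {v. (\<forall>k<n. v k \<in> disk_algebra) \<and> (\<forall>k\<ge>n. v k = 0)}"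
  "act (row_module n) = (\<lambda>a v k. a * v k)"
  by (simp_all add: row_module_def)

text \<open>In the block matrix behind the norm of the row module only rows with index divisible by
  \<open>n\<close> can be nonzero. This is coordinate \<open>i * n\<close> of that matrix, at the
  point \<open>w\<close>, applied to \<open>V\<close>.\<close>

definition row_apply :: "nat \<Rightarrow> nat \<Rightarrow> (nat \<Rightarrow> nat \<Rightarrow> nat \<Rightarrow> complex \<Rightarrow> complex) \<Rightarrow> complex \<Rightarrow> (nat \<Rightarrow> complex) \<Rightarrow> nat \<Rightarrow> complex" where
  "row_apply n m x w V i = (\<Sum>j<m. \<Sum>k<n. x i j k w * V (j * n + k))"

lemma sum_blocks: "(\<Sum>s<m * n. g s) = (\<Sum>j<m. \<Sum>k<n. g (j * n + k))"
  for m n :: nat and g :: "nat \<Rightarrow> 'b::comm_monoid_add"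
proof (induction m)
  case (Suc m)
  have "(\<Sum>s<Suc m * n. g s) = (\<Sum>s<m * n + n. g s)" by (simp add: add.commute)
  then show ?case using Suc by (simp add: sum_lessThan_add)
qed simp

text \<open>All coordinates other than the multiples of \<open>n\<close> vanish, so \<open>m\<close>
  coordinates carry the whole Euclidean norm. Estimates can then be made without the
  \<open>div\<close> and \<open>mod\<close> of the block indices.\<close>

lemma l2_row_blocks:
  assumes n: "1 \<le> n"
  shows "l2 (m * n) (mat_vec (m * n) (\<lambda>r s. (if r mod n = 0 then x (r div n) (s div n) (s mod n) else 0) w) V)
      = l2 m (row_apply n m x w V)"
proof -
  let ?M = "mat_vec (m * n) (\<lambda>r s. (if r mod n = 0 then x (r div n) (s div n) (s mod n) else 0) w) V"
  have M: "?M (i * n + k) = (if k = 0 then row_apply n m x w V i else 0)" if "k < n" for i k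
  proof (cases "k = 0")
    case True
    have "?M (i * n) = (\<Sum>j<m. \<Sum>k<n. x i ((j * n + k) div n) ((j * n + k) mod n) w * V (j * n + k))"
      unfolding sum_blocks using n by simp
    also have "\<dots> = row_apply n m x w V i"
      unfolding row_apply_def using n by (intro sum.cong refl) simp
    finally show ?thesis using True by simp
  next
    case False
    then have "(i * n + k) mod n \<noteq> 0" using that by simp
    then show ?thesis using False by simp
  qed
  have "(l2 (m * n) ?M)\<^sup>2 = (\<Sum>i<m. \<Sum>k<n. (cmod (?M (i * n + k)))\<^sup>2)"
    unfolding l2_power2 by (rule sum_blocks)
  also have "\<dots> = (\<Sum>i<m. \<Sum>k<n. (if k = 0 then (cmod (row_apply n m x w V i))\<^sup>2 else 0))"
  proof (intro sum.cong refl)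
    fix i k assume "k \<in> {..<n}"
    then have "k < n" by simp
    show "(cmod (?M (i * n + k)))\<^sup>2 = (if k = 0 then (cmod (row_apply n m x w V i))\<^sup>2 else 0)"
      unfolding M[OF \<open>k < n\<close>] by simp
  qed
  also have "\<dots> = (l2 m (row_apply n m x w V))\<^sup>2"
    using n by (simp add: l2_power2)
  finally show ?thesis by (rule power2_eq_imp_eq[OF _ l2_nonneg l2_nonneg])
qed

lemma row_mnorm_eq:
  "mnorm (row_module n) m x = C_mnorm (m * n) (\<lambda>r s. if r mod n = 0 then x (r div n) (s div n) (s mod n) else 0)"
  by (simp add: row_module_def)

lemma row_mnorm_least:
  assumes n: "1 \<le> n"
    and le: "\<And>w V. w \<in> circle \<Longrightarrow> l2 (m * n) V \<le> 1 \<Longrightarrow> l2 m (row_apply n m x w V) \<le> c"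
  shows "mnorm (row_module n) m x \<le> c"
  unfolding row_mnorm_eq
proof (rule C_mnorm_least)
  fix w V assume "w \<in> circle" "l2 (m * n) V \<le> 1"
  then have "l2 m (row_apply n m x w V) \<le> c" by (rule le)
  then show "l2 (m * n) (mat_vec (m * n) (\<lambda>r s. (if r mod n = 0 then x (r div n) (s div n) (s mod n) else 0) w) V) \<le> c"
    unfolding l2_row_blocks[OF n] .
qed

lemma row_mnorm_entries:
  assumes n: "1 \<le> n" and x: "x \<in> mats (row_module n) m m"
  shows "\<forall>r<m * n. \<forall>s<m * n. (if r mod n = 0 then x (r div n) (s div n) (s mod n) else 0) \<in> C_circle"
proof (intro allI impI)
  fix r s assume "r < m * n" "s < m * n"
  then have "r div n < m" "s div n < m" using less_mult_imp_div_less by blast+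
  moreover have "s mod n < n" using n by simp
  ultimately have "x (r div n) (s div n) (s mod n) \<in> disk_algebra"
    using x by (auto simp: mats_def row_module_simps)
  then show "(if r mod n = 0 then x (r div n) (s div n) (s mod n) else 0) \<in> C_circle"
    using C_circle_zero by (simp add: disk_algebra_C_circle)
qed

lemma row_mnorm_apply:
  assumes n: "1 \<le> n" and x: "x \<in> mats (row_module n) m m" and w: "w \<in> circle"
  shows "l2 m (row_apply n m x w V) \<le> mnorm (row_module n) m x * l2 (m * n) V"
  using C_mnorm_apply[OF row_mnorm_entries[OF n x] w, of V]
  unfolding l2_row_blocks[OF n] row_mnorm_eq[symmetric] .

lemma row_mnorm_nonneg:
  assumes n: "1 \<le> n" and x: "x \<in> mats (row_module n) m m"
  shows "0 \<le> mnorm (row_module n) m x"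
  unfolding row_mnorm_eq by (rule C_mnorm_nonneg[OF row_mnorm_entries[OF n x]])

lemma row_vnorm_apply:
  assumes n: "1 \<le> n" and v: "v \<in> car (row_module n)" and w: "w \<in> circle"
  shows "cmod (\<Sum>k<n. v k w * c k) \<le> vnorm (row_module n) v * l2 n c"
proof -
  have "(\<lambda>_ _. v) \<in> mats (row_module n) 1 1" using v by (simp add: mats_def)
  from row_mnorm_apply[OF n this w, of c] show ?thesis
    by (simp add: vnorm_def row_apply_def L2_set_def)
qed

lemma row_vnorm_least:
  assumes n: "1 \<le> n" and le: "\<And>w. w \<in> circle \<Longrightarrow> l2 n (\<lambda>k. v k w) \<le> B"
  shows "vnorm (row_module n) v \<le> B"
  unfolding vnorm_def
proof (rule row_mnorm_least[OF n])
  fix w V assume w: "w \<in> circle" and V: "l2 (1 * n) V \<le> 1"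
  have "l2 1 (row_apply n 1 (\<lambda>_ _. v) w V) = cmod (\<Sum>k<n. v k w * V k)"
    by (simp add: row_apply_def L2_set_def)
  also have "\<dots> \<le> l2 n (\<lambda>k. v k w) * l2 n V" by (rule l2_dot)
  also have "\<dots> \<le> l2 n (\<lambda>k. v k w) * 1" using V by (intro mult_left_mono l2_nonneg) simp
  finally show "l2 1 (row_apply n 1 (\<lambda>_ _. v) w V) \<le> B" using le[OF w] by linarith
qed

text \<open>Testing the row against its own conjugate at \<open>w\<close> gives the square of its
  Euclidean norm. With \<open>row_vnorm_least\<close> this identifies the norm of a tuple as the
  supremum of its pointwise Euclidean norms.\<close>

lemma row_vnorm_upper:
  assumes n: "1 \<le> n" and v: "v \<in> car (row_module n)" and w: "w \<in> circle"
  shows "l2 n (\<lambda>k. v k w) \<le> vnorm (row_module n) v"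
proof (cases "l2 n (\<lambda>k. v k w) = 0")
  case True
  have "0 \<le> vnorm (row_module n) v"
    unfolding vnorm_def by (rule row_mnorm_nonneg[OF n]) (use v in \<open>simp add: mats_def\<close>)
  then show ?thesis using True by simp
next
  case False
  let ?s = "l2 n (\<lambda>k. v k w)"
  have "(\<Sum>k<n. v k w * cnj (v k w)) = of_real (\<Sum>k<n. (cmod (v k w))\<^sup>2)"
    by (simp only: of_real_sum complex_norm_square)
  also have "\<dots> = of_real (?s\<^sup>2)" by (simp only: l2_power2)
  finally have "cmod (\<Sum>k<n. v k w * cnj (v k w)) = ?s\<^sup>2" by (simp add: norm_power)
  moreover have "cmod (\<Sum>k<n. v k w * cnj (v k w)) \<le> vnorm (row_module n) v * l2 n (\<lambda>k. cnj (v k w))"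
    by (rule row_vnorm_apply[OF n v w])
  ultimately have "?s * ?s \<le> vnorm (row_module n) v * ?s" by (simp add: power2_eq_square)
  moreover have "0 < ?s" using False l2_nonneg[where n=n and v="\<lambda>k. v k w"] by linarith
  ultimately show ?thesis by (rule mult_right_le_imp_le)
qed

lemma l2_blocks_le:
  assumes c: "l2 n c \<le> \<gamma>"
  shows "l2 m (\<lambda>j. \<Sum>k<n. c k * V (j * n + k)) \<le> \<gamma> * l2 (m * n) V"
proof (rule power2_le_imp_le)
  have g: "0 \<le> \<gamma>" by (rule order_trans[OF l2_nonneg c])
  have "(l2 m (\<lambda>j. \<Sum>k<n. c k * V (j * n + k)))\<^sup>2 \<le> (\<Sum>j<m. (\<gamma> * l2 n (\<lambda>k. V (j * n + k)))\<^sup>2)"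
    unfolding l2_power2
  proof (intro sum_mono power_mono)
    fix j
    have "cmod (\<Sum>k<n. c k * V (j * n + k)) \<le> l2 n c * l2 n (\<lambda>k. V (j * n + k))" by (rule l2_dot)
    also have "\<dots> \<le> \<gamma> * l2 n (\<lambda>k. V (j * n + k))" by (intro mult_right_mono c l2_nonneg)
    finally show "cmod (\<Sum>k<n. c k * V (j * n + k)) \<le> \<gamma> * l2 n (\<lambda>k. V (j * n + k))" .
  qed simp
  also have "\<dots> = \<gamma>\<^sup>2 * (l2 (m * n) V)\<^sup>2"
    unfolding power_mult_distrib l2_power2 by (simp only: sum_distrib_left[symmetric] sum_blocks)
  finally show "(l2 m (\<lambda>j. \<Sum>k<n. c k * V (j * n + k)))\<^sup>2 \<le> (\<gamma> * l2 (m * n) V)\<^sup>2"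
    by (simp only: power_mult_distrib)
  show "0 \<le> \<gamma> * l2 (m * n) V" using g l2_nonneg by (rule mult_nonneg_nonneg)
qed

text \<open>The multiplier \<open>c\<close> can be moved onto the vector \<open>V\<close>, where
  Cauchy-Schwarz in each block costs the factor \<open>\<gamma>\<close>; what is left is the matrix
  \<open>x\<close> itself. A pointwise bound thus holds at all matrix levels, which serves both
  contractivity and convergence in completely bounded norm.\<close>

lemma row_mnorm_multiplier:
  assumes n: "1 \<le> n" and x: "\<forall>i<m. \<forall>j<m. x i j \<in> C_circle"
    and y: "\<And>i j k w. i < m \<Longrightarrow> j < m \<Longrightarrow> k < n \<Longrightarrow> w \<in> circle \<Longrightarrow> y i j k w = x i j w * c k w"
    and c: "\<And>w. w \<in> circle \<Longrightarrow> l2 n (\<lambda>k. c k w) \<le> \<gamma>"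
    and x1: "C_mnorm m x \<le> 1"
  shows "mnorm (row_module n) m y \<le> \<gamma>"
proof (rule row_mnorm_least[OF n])
  fix w V assume w: "w \<in> circle" and V: "l2 (m * n) V \<le> 1"
  have g: "0 \<le> \<gamma>" by (rule order_trans[OF l2_nonneg c[OF w]])
  define Y where "Y = (\<lambda>j. \<Sum>k<n. c k w * V (j * n + k))"
  have "l2 m (row_apply n m y w V) = l2 m (mat_vec m (\<lambda>i j. x i j w) Y)"
  proof (intro L2_set_cong refl arg_cong[where f = cmod])
    fix i assume i: "i \<in> {..<m}"
    show "row_apply n m y w V i = mat_vec m (\<lambda>i j. x i j w) Y i"
      unfolding row_apply_def Y_def sum_distrib_left
      using i y w by (intro sum.cong refl) (simp add: mult.assoc)
  qed
  also have "\<dots> \<le> C_mnorm m x * l2 m Y" by (rule C_mnorm_apply[OF x w])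
  also have "\<dots> \<le> 1 * l2 m Y" by (intro mult_right_mono x1 l2_nonneg)
  also have "l2 m Y \<le> \<gamma> * l2 (m * n) V" unfolding Y_def by (rule l2_blocks_le[OF c[OF w]])
  also have "\<dots> \<le> \<gamma> * 1" by (intro mult_left_mono V g)
  finally show "l2 m (row_apply n m y w V) \<le> \<gamma>" by simp
qed

lemma cb_norm_le:
  assumes "\<And>n x. x \<in> mats X n n \<Longrightarrow> mnorm X n x \<le> 1 \<Longrightarrow> mnorm Y n (\<lambda>i j. T (x i j)) \<le> c"
  shows "cb_norm X Y T \<le> ennreal c"
  unfolding cb_norm_def by (intro SUP_least ennreal_leI) (use assms in auto)

lemma tendsto_ennreal_0I:
  fixes g :: "'i \<Rightarrow> ennreal"
  assumes "\<And>e. e > 0 \<Longrightarrow> eventually (\<lambda>i. g i \<le> ennreal e) F"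
  shows "(g \<longlongrightarrow> 0) F"
proof (rule order_tendstoI)
  fix a :: ennreal assume "0 < a"
  then obtain b where b: "0 < b" "b < a" using dense by blast
  have "b < top" by (rule order_less_le_trans[OF b(2) top_greatest])
  then obtain r where r: "b = ennreal r" "0 < r" using b(1) by (cases b) (auto simp: ennreal_less_zero_iff)
  from assms[OF r(2)] show "eventually (\<lambda>i. g i < a) F"
    by eventually_elim (use b r in auto)
qed simp

lemma net_filter_nat: "net_filter (UNIV :: nat set) (\<le>) = sequentially"
proof -
  have "directed_set (UNIV :: nat set) (\<le>)"
    unfolding directed_set_def by (auto intro: le_trans max.cobounded1 max.cobounded2)
  from eventually_net_filter[OF this] show ?thesis
    by (auto simp: filter_eq_iff eventually_sequentially)
qed

text \<open>The composition of the two maps is multiplication by \<open>S^2\<close>, where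
  \<open>S\<close> is the pairing of \<open>H\<close> with \<open>K\<close>: one factor comes from
  pairing with \<open>H\<close>, the other from the correction of \<open>K\<close>. Since
  \<open>S\<close> tends to 1 only locally uniformly off \<open>E\<close>, both limits rely on
  weights that vanish on \<open>E\<close>.\<close>

lemma R_class_imp_rigged:
  assumes f: "continuous_on circle f" "\<And>w. w \<in> circle \<Longrightarrow> 0 \<le> f w" and R: "f \<in> R_class"
  shows "rigged (closed_submodule f)"
proof -
  let ?X = "closed_submodule f"
  obtain E where E: "f \<in> R_class_on E" using R by (auto simp: R_class_def)
  have fE: "\<And>w. w \<in> circle \<Longrightarrow> f w = 0 \<longleftrightarrow> w \<in> E" using E unfolding R_class_on_def by blast
  obtain d H K where HK:
    "\<forall>n::nat. 1 \<le> d n \<and> (\<forall>k<d n. H n k \<in> disk_algebra \<and> K n k \<in> disk_algebra)"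
    "\<forall>n. \<forall>w\<in>circle. l2 (d n) (\<lambda>k. K n k w) \<le> f w \<and>
            ereal (f w) \<le> 1 / ereal (l2 (d n) (\<lambda>k. H n k w))"
    "\<forall>C. compact C \<and> C \<subseteq> circle - E \<longrightarrow>
            uniform_limit C (\<lambda>n w. \<Sum>k<d n. H n k w * K n k w) (\<lambda>_. 1) sequentially"
    using E[unfolded R_class_on_def mem_Collect_eq, THEN conjunct2, THEN conjunct2]
    by (elim exE conjE) (rule that)
  have d: "1 \<le> d n" for n using HK(1) by blast
  have HA: "H n k \<in> disk_algebra" if "k < d n" for n k using HK(1) that by blast
  have KA: "K n k \<in> disk_algebra" if "k < d n" for n k using HK(1) that by blast
  have Kf: "l2 (d n) (\<lambda>k. K n k w) \<le> f w" if "w \<in> circle" for n w using HK(2) that by blast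
  \<comment> \<open>The product form avoids the quotient: where \<open>H\<close> vanishes, the bound
    in \<open>ereal\<close> is \<open>\<infinity>\<close> and the product is 0.\<close>
  have Hf: "l2 (d n) (\<lambda>k. H n k w) * f w \<le> 1" if w: "w \<in> circle" for n w
  proof (cases "l2 (d n) (\<lambda>k. H n k w) = 0")
    case False
    define s where "s = l2 (d n) (\<lambda>k. H n k w)"
    have s: "0 < s" using False l2_nonneg[where n="d n" and v="\<lambda>k. H n k w"] unfolding s_def by linarith
    have "ereal (f w) \<le> 1 / ereal s" using HK(2) w unfolding s_def by blast
    also have "1 / ereal s = ereal (1 / s)" using s by (simp add: one_ereal_def)
    finally have "f w \<le> 1 / s" by simp
    then show ?thesis unfolding s_def[symmetric] using s by (simp add: field_simps)
  qed simp
  define S where "S = (\<lambda>n. \<Sum>k<d n. H n k * K n k)"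
  have Sw: "S n w = (\<Sum>k<d n. H n k w * K n k w)" for n w by (simp add: S_def sum_fun_apply)
  have SA: "S n \<in> disk_algebra" for n
    unfolding S_def by (intro disk_algebra_sum disk_algebra_mult HA KA) auto
  have SH: "cmod (S n w) \<le> l2 (d n) (\<lambda>k. H n k w) * f w" if w: "w \<in> circle" for n w
    unfolding Sw by (rule order_trans[OF l2_dot]) (intro mult_left_mono Kf w l2_nonneg)
  have S1: "cmod (S n w) \<le> 1" if w: "w \<in> circle" for n w
    using SH[OF w] Hf[OF w] by (rule order_trans)
  define Kt where "Kt = (\<lambda>n k. S n * K n k)"
  have KtA: "Kt n k \<in> disk_algebra" if "k < d n" for n k
    unfolding Kt_def by (intro disk_algebra_mult SA KA that)
  have Ktl: "l2 (d n) (\<lambda>k. Kt n k w) = cmod (S n w) * l2 (d n) (\<lambda>k. K n k w)" for n w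
    by (simp add: Kt_def l2_scale)
  have Ktf: "l2 (d n) (\<lambda>k. Kt n k w) \<le> f w" if w: "w \<in> circle" for n w
  proof -
    have "l2 (d n) (\<lambda>k. Kt n k w) \<le> 1 * l2 (d n) (\<lambda>k. K n k w)"
      unfolding Ktl by (intro mult_right_mono S1 w l2_nonneg)
    then show ?thesis using Kf[OF w, of n] by linarith
  qed
  have "\<exists>B. \<forall>w\<in>circle. l2 (d n) (\<lambda>k. H n k w) \<le> B" for n
  proof -
    have "continuous_on circle (\<lambda>w. l2 (d n) (\<lambda>k. H n k w))"
      unfolding L2_set_def using HA[of _ n]
      by (intro continuous_intros) (auto simp: disk_algebra_def C_circle_def)
    then have "compact ((\<lambda>w. l2 (d n) (\<lambda>k. H n k w)) ` circle)"
      by (intro compact_continuous_image) auto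
    then obtain B where "\<forall>x\<in>(\<lambda>w. l2 (d n) (\<lambda>k. H n k w)) ` circle. norm x \<le> B"
      using compact_imp_bounded bounded_iff by blast
    then show ?thesis by (intro exI[of _ B]) auto
  qed
  then obtain B where B: "\<And>n w. w \<in> circle \<Longrightarrow> l2 (d n) (\<lambda>k. H n k w) \<le> B n" by metis
  have B0: "0 \<le> B n" for n using order_trans[OF l2_nonneg B[of 1]] by simp
  \<comment> \<open>The estimate behind the correction of \<open>K\<close>: the modulus of
    \<open>S\<close> is at most \<open>B n * f\<close>, so the length of \<open>Kt / f\<close> is at
    most \<open>B n * f\<close> as well and vanishes at the zeros of \<open>f\<close>.\<close>
  have Ktff: "l2 (d n) (\<lambda>k. Kt n k w) \<le> B n * f w * f w" if w: "w \<in> circle" for n w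
  proof -
    have "cmod (S n w) \<le> B n * f w"
      by (rule order_trans[OF SH[OF w]]) (intro mult_right_mono B w f(2))
    then show ?thesis unfolding Ktl using Kf[OF w] B0 f(2)[OF w] by (intro mult_mono l2_nonneg) auto
  qed
  have x0: "x w = 0" if x: "x \<in> car ?X" and w: "w \<in> circle" "f w = 0" for x w
  proof (rule ccontr)
    assume "x w \<noteq> 0"
    then have "0 < cmod (x w)" by simp
    with x obtain a where "a \<in> disk_algebra" and a: "\<And>w'. w' \<in> circle \<Longrightarrow> cmod (x w' - a w' * f w') < cmod (x w)"
      by (rule closed_submoduleE) (rule that)
    from a[OF w(1)] show False using w(2) by simp
  qed
  \<comment> \<open>At zeros of \<open>f\<close> the value is 0; since division by 0 gives 0 in HOL,
    the formula \<open>x w * (Kt n k w / f w)\<close> holds on all of the circle.\<close>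
  define \<phi> where "\<phi> = (\<lambda>n x k w. if w \<in> circle \<and> f w \<noteq> 0 \<and> k < d n then x w * (Kt n k w / f w) else 0)"
  define \<psi> where "\<psi> = (\<lambda>n v w. (\<Sum>k<d n. v k * H n k) w * of_real (f w))"
  \<comment> \<open>Replacing \<open>x\<close> by \<open>a * f\<close> turns the quotient into
    \<open>a * Kt n k\<close>, and this costs less than \<open>e\<close> because the entries of
    \<open>Kt\<close> are bounded by \<open>f\<close>. The quotient is thus a uniform limit of
    elements of the disk algebra.\<close>
  have \<phi>A: "\<phi> n x k \<in> disk_algebra" if x: "x \<in> car ?X" and k: "k < d n" for n x k
  proof (rule disk_algebra_closed)
    fix e :: real assume "0 < e"
    with x obtain a where a: "a \<in> disk_algebra" "\<And>w. w \<in> circle \<Longrightarrow> cmod (x w - a w * f w) < e"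
      by (rule closed_submoduleE) (rule that)
    show "\<exists>b\<in>disk_algebra. \<forall>w\<in>circle. cmod (\<phi> n x k w - b w) < e"
    proof (intro bexI ballI)
      show "a * Kt n k \<in> disk_algebra" by (intro disk_algebra_mult a KtA k)
      fix w assume w: "w \<in> circle"
      have Kw: "cmod (Kt n k w) \<le> f w" using l2_entry[OF k, of "\<lambda>k. Kt n k w"] Ktf[OF w, of n] by linarith
      show "cmod (\<phi> n x k w - (a * Kt n k) w) < e"
      proof (cases "f w = 0")
        case True
        then show ?thesis using Kw \<open>0 < e\<close> by (simp add: \<phi>_def)
      next
        case False
        then have fp: "0 < f w" using f(2)[OF w] by simp
        have "\<phi> n x k w - (a * Kt n k) w = (x w - a w * f w) * (Kt n k w / f w)"
          using False w k by (simp add: \<phi>_def field_simps)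
        then have "cmod (\<phi> n x k w - (a * Kt n k) w) = cmod (x w - a w * f w) * (cmod (Kt n k w) / f w)"
          using fp by (simp add: norm_mult norm_divide)
        also have "\<dots> \<le> cmod (x w - a w * f w) * 1"
          using Kw fp by (intro mult_left_mono) auto
        also have "\<dots> < e" using a(2)[OF w] by simp
        finally show ?thesis .
      qed
    qed
  qed (simp add: \<phi>_def)
  have \<phi>car: "\<phi> n x \<in> car (row_module (d n))" if x: "x \<in> car ?X" for n x
    using \<phi>A[OF x] by (auto simp: row_module_simps \<phi>_def zero_fun_def)
  have \<psi>car: "\<psi> n v \<in> car ?X" if v: "v \<in> car (row_module (d n))" for n v
    unfolding \<psi>_def using v HA
    by (intro closed_submodule_generated f disk_algebra_sum disk_algebra_mult) (auto simp: row_module_simps)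
  have Xmats: "\<forall>i<m. \<forall>j<m. x i j \<in> C_circle" if "x \<in> mats ?X m m" for x m
    using that by (auto simp: mats_def intro: closed_submodule_C_circle)
  have \<phi>mult: "\<phi> n x k w = x w * (Kt n k w / f w)" if "k < d n" "w \<in> circle" for n x k w
    using that by (simp add: \<phi>_def)
  have ratio: "l2 (d n) (\<lambda>k. c * (Kt n k w / f w)) = cmod c * (l2 (d n) (\<lambda>k. Kt n k w) / f w)"
    if "w \<in> circle" for c n w
  proof -
    have "l2 (d n) (\<lambda>k. c * (Kt n k w / f w)) = l2 (d n) (\<lambda>k. (c / f w) * Kt n k w)" by simp
    also have "\<dots> = cmod (c / f w) * l2 (d n) (\<lambda>k. Kt n k w)" by (rule l2_scale)
    finally show ?thesis using f(2)[OF that] by (simp add: norm_divide)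
  qed
  have cc\<phi>: "cc_module_map ?X (row_module (d n)) (\<phi> n)" for n
  proof -
    have "module_map ?X (row_module (d n)) (\<phi> n)"
      unfolding module_map_def closed_submodule_simps row_module_simps(2)
      using \<phi>car by (auto simp: \<phi>_def fun_eq_iff algebra_simps add_divide_distrib)
    moreover have "cb_norm ?X (row_module (d n)) (\<phi> n) \<le> ennreal 1"
    proof (rule cb_norm_le, unfold closed_submodule_simps)
      fix m x assume x: "x \<in> mats ?X m m" "C_mnorm m x \<le> 1"
      show "mnorm (row_module (d n)) m (\<lambda>i j. \<phi> n (x i j)) \<le> 1"
      proof (rule row_mnorm_multiplier[OF d Xmats[OF x(1)] _ _ x(2)])
        fix w assume w: "w \<in> circle"
        show "l2 (d n) (\<lambda>k. Kt n k w / f w) \<le> 1"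
          using ratio[OF w, where n=n and c=1] Ktf[OF w, of n] f(2)[OF w] by (cases "f w = 0") (simp_all add: divide_le_eq_1)
      qed (rule \<phi>mult)
    qed
    ultimately show ?thesis by (simp add: cc_module_map_def)
  qed
  have cc\<psi>: "cc_module_map (row_module (d n)) ?X (\<psi> n)" for n
  proof -
    have "module_map (row_module (d n)) ?X (\<psi> n)"
      unfolding module_map_def closed_submodule_simps row_module_simps(2)
      using \<psi>car by (auto simp: \<psi>_def fun_eq_iff algebra_simps sum_fun_apply sum.distrib sum_distrib_left)
    moreover have "cb_norm (row_module (d n)) ?X (\<psi> n) \<le> ennreal 1"
    proof (rule cb_norm_le, unfold closed_submodule_simps)
      fix m x assume x: "x \<in> mats (row_module (d n)) m m" "mnorm (row_module (d n)) m x \<le> 1"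
      show "C_mnorm m (\<lambda>i j. \<psi> n (x i j)) \<le> 1"
      proof (rule C_mnorm_least)
        fix w v assume w: "w \<in> circle" and v: "l2 m v \<le> 1"
        \<comment> \<open>\<open>h\<close> is \<open>f\<close> times the tuple \<open>H\<close> at
          \<open>w\<close>, of length at most 1. Applying \<open>\<psi>\<close> entrywise and then
          the matrix to \<open>v\<close> is the same as applying the rows to the tensor product
          \<open>V\<close> of \<open>v\<close> and \<open>h\<close>, whose norm is the product of
          theirs.\<close>
        define h where "h = (\<lambda>k. of_real (f w) * H n k w)"
        define V where "V = (\<lambda>s. v (s div d n) * h (s mod d n))"
        have Vjk: "V (j * d n + k) = v j * h k" if "k < d n" for j k
          using that by (simp add: V_def)
        have h1: "l2 (d n) h \<le> 1"
          unfolding h_def l2_scale using Hf[OF w, of n] f(2)[OF w] by (simp add: mult.commute)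
        have "(l2 (m * d n) V)\<^sup>2 = (\<Sum>j<m. \<Sum>k<d n. (cmod (v j))\<^sup>2 * (cmod (h k))\<^sup>2)"
          unfolding l2_power2 sum_blocks
          by (intro sum.cong refl) (simp add: Vjk norm_mult power_mult_distrib)
        also have "\<dots> = (l2 m v)\<^sup>2 * (l2 (d n) h)\<^sup>2"
          unfolding l2_power2 by (simp add: sum_product)
        also have "\<dots> = (l2 m v * l2 (d n) h)\<^sup>2" by (simp add: power_mult_distrib)
        finally have "l2 (m * d n) V = l2 m v * l2 (d n) h"
          by (rule power2_eq_imp_eq[OF _ l2_nonneg mult_nonneg_nonneg[OF l2_nonneg l2_nonneg]])
        also have "\<dots> \<le> 1" using mult_mono[OF v h1 zero_le_one l2_nonneg] by simp
        finally have V1: "l2 (m * d n) V \<le> 1" .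
        have "l2 m (mat_vec m (\<lambda>i j. \<psi> n (x i j) w) v) = l2 m (row_apply (d n) m x w V)"
        proof (intro L2_set_cong refl arg_cong[where f = cmod])
          fix i
          show "mat_vec m (\<lambda>i j. \<psi> n (x i j) w) v i = row_apply (d n) m x w V i"
            unfolding row_apply_def \<psi>_def sum_fun_apply sum_distrib_right
            by (intro sum.cong refl) (simp add: Vjk h_def)
        qed
        also have "\<dots> \<le> mnorm (row_module (d n)) m x * l2 (m * d n) V"
          by (rule row_mnorm_apply[OF d x(1) w])
        also have "\<dots> \<le> 1" using mult_mono[OF x(2) V1 zero_le_one l2_nonneg] by simp
        finally show "l2 m (mat_vec m (\<lambda>i j. \<psi> n (x i j) w) v) \<le> 1" .
      qed
    qed
    ultimately show ?thesis by (simp add: cc_module_map_def)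
  qed
  have \<psi>\<phi>: "\<psi> n (\<phi> n x) w = x w * (S n w)\<^sup>2" if x: "x \<in> car ?X" and w: "w \<in> circle" for n x w
  proof (cases "f w = 0")
    case True
    then show ?thesis using x0[OF x w] by (simp add: \<psi>_def)
  next
    case False
    have "\<psi> n (\<phi> n x) w = (\<Sum>k<d n. x w * S n w * (H n k w * K n k w))"
      unfolding \<psi>_def sum_fun_apply sum_distrib_right
      using False by (intro sum.cong refl) (simp add: \<phi>mult[OF _ w] Kt_def)
    also have "\<dots> = x w * S n w * S n w" unfolding Sw by (rule sum_distrib_left[symmetric])
    finally show ?thesis by (simp add: power2_eq_square)
  qed
  \<comment> \<open>Near the zeros of \<open>f\<close> the continuous weight \<open>g\<close> is
    small and \<open>S^2 - 1\<close> has modulus at most 2; on the compact rest \<open>S\<close>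
    tends to 1 uniformly. The weight is the modulus of \<open>x\<close> for pointwise convergence
    and \<open>B j * f\<close> for the completely bounded norm.\<close>
  have conv: "eventually (\<lambda>n. \<forall>w\<in>circle. g w * cmod ((S n w)\<^sup>2 - 1) \<le> e) sequentially"
    if g: "continuous_on circle g" "\<And>w. w \<in> circle \<Longrightarrow> 0 \<le> g w" "\<And>w. w \<in> circle \<Longrightarrow> f w = 0 \<Longrightarrow> g w = 0"
      and e: "0 < e" for g :: "complex \<Rightarrow> real" and e
  proof -
    define L where "L = circle \<inter> g -` {e / 2..}"
    have "closed L" unfolding L_def by (intro continuous_closed_preimage g) auto
    moreover have "circle \<inter> L = L" by (auto simp: L_def)
    ultimately have Lc: "compact L" using compact_Int_closed[of circle L] by auto
    have LE: "L \<subseteq> circle - E"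
    proof
      fix w assume w: "w \<in> L"
      then have "w \<in> circle" "e / 2 \<le> g w" by (auto simp: L_def)
      then show "w \<in> circle - E" using g(3)[of w] fE[of w] e by auto
    qed
    have "compact (g ` circle)" using g(1) by (intro compact_continuous_image) auto
    then obtain M where "\<forall>x\<in>g ` circle. norm x \<le> M" using compact_imp_bounded bounded_iff by blast
    then have M: "g w \<le> M" if "w \<in> circle" for w using that by (auto simp: abs_le_iff)
    have M0: "0 \<le> M" using order_trans[OF g(2) M, of 1] by simp
    have "uniform_limit L (\<lambda>n w. \<Sum>k<d n. H n k w * K n k w) (\<lambda>_. 1) sequentially"
      using HK(3) Lc LE by blast
    then have "eventually (\<lambda>n. \<forall>w\<in>L. dist (\<Sum>k<d n. H n k w * K n k w) 1 < e / (2 * (M + 1))) sequentially"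
      by (rule uniform_limitD) (use e M0 in auto)
    then show ?thesis
    proof eventually_elim
      case (elim n)
      show ?case
      proof
        fix w assume w: "w \<in> circle"
        have "(S n w)\<^sup>2 - 1 = (S n w - 1) * (S n w + 1)" by (simp add: power2_eq_square algebra_simps)
        then have "cmod ((S n w)\<^sup>2 - 1) = cmod (S n w - 1) * cmod (S n w + 1)" by (simp only: norm_mult)
        also have "cmod (S n w + 1) \<le> 2" using norm_triangle_ineq[of "S n w" 1] S1[OF w, of n] by simp
        finally have s2: "cmod ((S n w)\<^sup>2 - 1) \<le> cmod (S n w - 1) * 2" by (simp add: mult_left_mono)
        show "g w * cmod ((S n w)\<^sup>2 - 1) \<le> e"
        proof (cases "w \<in> L")
          case True
          then have "cmod (S n w - 1) < e / (2 * (M + 1))" using elim by (simp add: Sw dist_norm)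
          then have "cmod (S n w - 1) * 2 \<le> e / (2 * (M + 1)) * 2" by (intro mult_right_mono) auto
          also have "e / (2 * (M + 1)) * 2 = e / (M + 1)" using M0 by (simp add: field_simps)
          finally have "cmod ((S n w)\<^sup>2 - 1) \<le> e / (M + 1)" by (rule order_trans[OF s2])
          then have "g w * cmod ((S n w)\<^sup>2 - 1) \<le> M * (e / (M + 1))"
            using M[OF w] g(2)[OF w] M0 by (intro mult_mono) auto
          also have "\<dots> \<le> e" using M0 e by (simp add: field_simps)
          finally show ?thesis .
        next
          case False
          then have "g w < e / 2" using w by (simp add: L_def)
          moreover have "cmod ((S n w)\<^sup>2 - 1) \<le> 2"
            using norm_triangle_ineq4[of "(S n w)\<^sup>2" 1] S1[OF w, of n] by (simp add: norm_power power_le_one order_trans)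
          ultimately have "g w * cmod ((S n w)\<^sup>2 - 1) \<le> e / 2 * 2"
            using g(2)[OF w] e by (intro mult_mono) auto
          then show ?thesis by simp
        qed
      qed
    qed
  qed
  have "rigging ?X (UNIV :: nat set) (\<le>) d \<phi> \<psi>"
    unfolding rigging_def net_filter_nat
  proof (intro conjI ballI d cc\<phi> cc\<psi>)
    show "directed_set (UNIV :: nat set) (\<le>)"
      unfolding directed_set_def by (auto intro: le_trans max.cobounded1 max.cobounded2)
  next
    fix x assume x: "x \<in> car ?X"
    have xC: "x \<in> C_circle" using x by (rule closed_submodule_C_circle)
    show "(\<lambda>i. vnorm ?X (\<psi> i (\<phi> i x) - x)) \<longlonglongrightarrow> 0"
      unfolding vnorm_closed_submodule
    proof (rule tendstoI)
      fix e :: real assume e: "0 < e"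
      have "eventually (\<lambda>n. \<forall>w\<in>circle. cmod (x w) * cmod ((S n w)\<^sup>2 - 1) \<le> e / 2) sequentially"
        using xC x0[OF x] e by (intro conv) (auto simp: C_circle_def intro!: continuous_intros)
      then show "eventually (\<lambda>n. dist (C_mnorm 1 (\<lambda>_ _. \<psi> n (\<phi> n x) - x)) 0 < e) sequentially"
      proof eventually_elim
        case (elim n)
        have "C_mnorm 1 (\<lambda>_ _. \<psi> n (\<phi> n x) - x) \<le> e / 2"
        proof (rule C_mnorm_1_least)
          fix w assume w: "w \<in> circle"
          have "(\<psi> n (\<phi> n x) - x) w = x w * ((S n w)\<^sup>2 - 1)"
            by (simp add: \<psi>\<phi>[OF x w] algebra_simps)
          then show "cmod ((\<psi> n (\<phi> n x) - x) w) \<le> e / 2" using elim w by (simp only: norm_mult)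
        qed
        moreover have "0 \<le> C_mnorm 1 (\<lambda>_ _. \<psi> n (\<phi> n x) - x)"
          using C_circle_diff[OF closed_submodule_C_circle[OF \<psi>car[OF \<phi>car[OF x]]] xC] by (intro C_mnorm_nonneg) auto
        ultimately show ?case using e by simp
      qed
    qed
  next
    fix j :: nat
    show "(\<lambda>i. cb_norm ?X (row_module (d j)) (\<lambda>x. \<phi> j (\<psi> i (\<phi> i x)) - \<phi> j x)) \<longlonglongrightarrow> 0"
    proof (rule tendsto_ennreal_0I)
      fix e :: real assume e: "0 < e"
      have "eventually (\<lambda>n. \<forall>w\<in>circle. (B j * f w) * cmod ((S n w)\<^sup>2 - 1) \<le> e) sequentially"
        using e B0 by (intro conv) (auto intro!: continuous_intros f mult_nonneg_nonneg)
      then show "eventually (\<lambda>i. cb_norm ?X (row_module (d j)) (\<lambda>x. \<phi> j (\<psi> i (\<phi> i x)) - \<phi> j x) \<le> ennreal e) sequentially"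
      proof eventually_elim
        case (elim n)
        show ?case
        proof (rule cb_norm_le, unfold closed_submodule_simps)
          fix m x assume x: "x \<in> mats ?X m m" "C_mnorm m x \<le> 1"
          show "mnorm (row_module (d j)) m (\<lambda>i i'. \<phi> j (\<psi> n (\<phi> n (x i i'))) - \<phi> j (x i i')) \<le> e"
          proof (rule row_mnorm_multiplier[OF d Xmats[OF x(1)] _ _ x(2)])
            fix i i' k w assume i: "i < m" "i' < m" "k < d j" and w: "w \<in> circle"
            have xii: "x i i' \<in> car ?X" using x(1) i by (simp add: mats_def)
            show "(\<phi> j (\<psi> n (\<phi> n (x i i'))) - \<phi> j (x i i')) k w = x i i' w * (((S n w)\<^sup>2 - 1) * (Kt j k w / f w))"
              by (simp add: \<phi>mult[OF i(3) w] \<psi>\<phi>[OF xii w] algebra_simps)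
          next
            fix w assume w: "w \<in> circle"
            have "l2 (d j) (\<lambda>k. Kt j k w) / f w \<le> B j * f w"
              using Ktff[OF w, of j] f(2)[OF w] B0[of j] by (cases "f w = 0") (auto simp: divide_le_eq)
            then have "cmod ((S n w)\<^sup>2 - 1) * (l2 (d j) (\<lambda>k. Kt j k w) / f w) \<le> cmod ((S n w)\<^sup>2 - 1) * (B j * f w)"
              by (intro mult_left_mono) auto
            also have "\<dots> \<le> e" using elim w by (subst mult.commute) blast
            finally show "l2 (d j) (\<lambda>k. ((S n w)\<^sup>2 - 1) * (Kt j k w / f w)) \<le> e"
              unfolding ratio[OF w] .
          qed
        qed
      qed
    qed
  qed
  then show ?thesis by (rule rigging_imp_rigged[OF left_operator_module_closed_submodule])
qed

section \<open>Rigged submodules of C(T)\<close>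

lemma disk_algebra_diff: "a \<in> disk_algebra \<Longrightarrow> b \<in> disk_algebra \<Longrightarrow> a - b \<in> disk_algebra"
  using disk_algebra_add[OF _ disk_algebra_scale[of b "-1"], of a]
  by (simp add: plus_fun_def fun_diff_def)

lemma disk_algebra_bound:
  assumes "a \<in> disk_algebra" "w \<in> circle"
  shows "cmod (a w) \<le> C_mnorm 1 (\<lambda>_ _. a)"
  using C_mnorm_1_upper[OF disk_algebra_C_circle] assms by blast

lemma cb_norm_le_1D:
  assumes "cb_norm X Y T \<le> 1" "x \<in> mats X n n" "mnorm X n x \<le> 1"
  shows "mnorm Y n (\<lambda>i j. T (x i j)) \<le> 1"
proof -
  have "ennreal (mnorm Y n (\<lambda>i j. T (x i j))) \<le> cb_norm X Y T"
    unfolding cb_norm_def using assms(2,3)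
    by (intro SUP_upper2[of n] SUP_upper2[of x]) auto
  also note assms(1)
  finally show ?thesis by simp
qed

section \<open>Vector norms and completely contractive maps in operator modules\<close>

context left_operator_module
begin

lemma vnorm_nonneg: "u \<in> car X \<Longrightarrow> 0 \<le> vnorm X u"
  unfolding vnorm_def by (rule mnorm_nonneg) (simp add: mats_def)

lemma vnorm_eq_0: "u \<in> car X \<Longrightarrow> vnorm X u = 0 \<longleftrightarrow> u = 0"
  unfolding vnorm_def by (subst mnorm_eq_0_iff) (simp_all add: mats_def)

lemma vnorm_add: "u \<in> car X \<Longrightarrow> v \<in> car X \<Longrightarrow> vnorm X (u + v) \<le> vnorm X u + vnorm X v"
  unfolding vnorm_def by (rule mnorm_triangle) (simp_all add: mats_def)

lemma vnorm_scl: "u \<in> car X \<Longrightarrow> vnorm X (scl X c u) = cmod c * vnorm X u"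
  unfolding vnorm_def by (rule mnorm_scl) (simp add: mats_def)

lemma vnorm_act_le:
  assumes "a \<in> disk_algebra" "u \<in> car X"
  shows "vnorm X (act X a u) \<le> C_mnorm 1 (\<lambda>_ _. a) * vnorm X u"
  using act_contractive[of 1 "\<lambda>_ _. a" "\<lambda>_ _. u"] assms by (simp add: vnorm_def mats_def)

lemma scl_0: "u \<in> car X \<Longrightarrow> scl X 0 u = 0"
  using scl_add_left[of u 0 0] by simp

lemma scl_minus_1: "u \<in> car X \<Longrightarrow> scl X (-1) u = - u"
  using scl_add_left[of u 1 "-1"] scl_one[of u] scl_0[of u] by (simp add: eq_neg_iff_add_eq_0 add.commute)

lemma minus_closed: "u \<in> car X \<Longrightarrow> - u \<in> car X"
  using scl_closed[of u "-1"] scl_minus_1[of u] by simp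

lemma diff_closed: "u \<in> car X \<Longrightarrow> v \<in> car X \<Longrightarrow> u - v \<in> car X"
  using add_closed[OF _ minus_closed, of u v] by simp

lemma vnorm_minus: "u \<in> car X \<Longrightarrow> vnorm X (- u) = vnorm X u"
  using vnorm_scl[of u "-1"] scl_minus_1[of u] by simp

lemma vnorm_commute: "u \<in> car X \<Longrightarrow> v \<in> car X \<Longrightarrow> vnorm X (u - v) = vnorm X (v - u)"
  using vnorm_minus[OF diff_closed, of u v] by simp

lemma vnorm_le_diff: "u \<in> car X \<Longrightarrow> v \<in> car X \<Longrightarrow> vnorm X u \<le> vnorm X (u - v) + vnorm X v"
  using vnorm_add[OF diff_closed, of u v v] by simp

lemma vnorm_diff_triangle:
  "u \<in> car X \<Longrightarrow> v \<in> car X \<Longrightarrow> y \<in> car X \<Longrightarrow> vnorm X (u - v) \<le> vnorm X (u - y) + vnorm X (y - v)"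
  using vnorm_add[OF diff_closed diff_closed, of u y y v] by simp

lemma act_const: "u \<in> car X \<Longrightarrow> act X (circ (\<lambda>_. c)) u = scl X c u"
proof -
  assume u: "u \<in> car X"
  have "circ (\<lambda>_. c) = (\<lambda>z. c * indicator circle z)" by (auto simp: circ_def indicator_def fun_eq_iff)
  then show ?thesis
    using act_scl[OF disk_algebra_const[of 1, folded indicator_circle_eq] u] act_unit[OF u] by simp
qed

lemma act_diff_left:
  "a \<in> disk_algebra \<Longrightarrow> b \<in> disk_algebra \<Longrightarrow> u \<in> car X \<Longrightarrow> act X (a - b) u = act X a u - act X b u"
  using act_add_left[OF disk_algebra_diff, of a b b u] by (simp add: algebra_simps)

lemma act_diff_right:
  "a \<in> disk_algebra \<Longrightarrow> u \<in> car X \<Longrightarrow> v \<in> car X \<Longrightarrow> act X a (u - v) = act X a u - act X a v"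
  using act_add_right[OF _ diff_closed, of a u v v] by (simp add: algebra_simps)

lemma act_zero_left: "u \<in> car X \<Longrightarrow> act X 0 u = 0"
  using act_add_left[OF disk_algebra_zero disk_algebra_zero, of u] by simp

lemma sum_closed: "(\<And>i. i \<in> S \<Longrightarrow> u i \<in> car X) \<Longrightarrow> (\<Sum>i\<in>S. u i) \<in> car X"
  by (induction S rule: infinite_finite_induct) (auto simp: zero_closed add_closed)

lemma vnorm_sum_le: "(\<And>i. i \<in> S \<Longrightarrow> u i \<in> car X) \<Longrightarrow> vnorm X (\<Sum>i\<in>S. u i) \<le> (\<Sum>i\<in>S. vnorm X (u i))"
proof (induction S rule: infinite_finite_induct)
  case (insert i S)
  then show ?case using vnorm_add[of "u i" "\<Sum>i\<in>S. u i"] sum_closed[of S u] by force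
qed (use vnorm_eq_0[OF zero_closed] in auto)

lemma act_sum_left:
  assumes "u \<in> car X" "\<And>i. i \<in> S \<Longrightarrow> a i \<in> disk_algebra"
  shows "act X (\<Sum>i\<in>S. a i) u = (\<Sum>i\<in>S. act X (a i) u)"
  using assms(2)
  by (induction S rule: infinite_finite_induct)
     (auto simp: act_zero_left[OF assms(1)] act_add_left assms(1) disk_algebra_sum)

text \<open>\<open>cb_norm\<close> tests matrices in unit balls, so \<open>u\<close> is rescaled
  first. Module maps are assumed additive and linear over the disk algebra; they commute with
  scalars because scalars act as constant functions.\<close>

lemma cc_to_row:
  assumes T: "cc_module_map X (row_module n) T" and n: "1 \<le> n" and u: "u \<in> car X" and w: "w \<in> circle"
  shows "l2 n (\<lambda>k. T u k w) \<le> vnorm X u"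
proof -
  have mm: "module_map X (row_module n) T" and cb: "cb_norm X (row_module n) T \<le> 1"
    using T by (auto simp: cc_module_map_def)
  have Tcar: "T v \<in> car (row_module n)" if "v \<in> car X" for v using mm that by (simp add: module_map_def)
  have Tadd: "T (v + v') = T v + T v'" if "v \<in> car X" "v' \<in> car X" for v v' using mm that by (simp add: module_map_def)
  show ?thesis
  proof (cases "vnorm X u = 0")
    case True
    then have "u = 0" using vnorm_eq_0[OF u] by simp
    moreover have "T 0 = 0" using Tadd[OF zero_closed zero_closed] by simp
    ultimately show ?thesis using vnorm_nonneg[OF u] by (simp add: L2_set_def)
  next
    case False
    define s where "s = vnorm X u"
    have s: "0 < s" using False vnorm_nonneg[OF u] by (simp add: s_def)
    define c where "c = complex_of_real (1 / s)"
    let ?u = "scl X c u"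
    have cu: "?u \<in> car X" by (rule scl_closed[OF u])
    have nu: "vnorm X ?u \<le> 1" using s vnorm_scl[OF u, of c] by (simp add: s_def[symmetric] c_def norm_divide)
    have "vnorm (row_module n) (T ?u) \<le> 1"
      using cb_norm_le_1D[OF cb, of "\<lambda>_ _. ?u" 1] cu nu by (simp add: vnorm_def mats_def)
    then have "l2 n (\<lambda>k. T ?u k w) \<le> 1" using row_vnorm_upper[OF n Tcar[OF cu] w] by linarith
    moreover have "T ?u = act (row_module n) (circ (\<lambda>_. c)) (T u)"
      using mm u act_const[OF u, of c] disk_algebra_const[of c] unfolding module_map_def by metis
    then have "T ?u k w = c * T u k w" for k using w by (simp add: row_module_simps circ_def)
    ultimately have "cmod c * l2 n (\<lambda>k. T u k w) \<le> 1" by (simp only: l2_scale)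
    then show ?thesis using s by (simp add: c_def norm_divide s_def[symmetric] field_simps)
  qed
qed

text \<open>Stated with a positive bound \<open>B\<close> in place of the norm of \<open>v\<close>,
  so that pointwise estimates can be inserted directly and the rescaling divides by a positive
  number even for \<open>v = 0\<close>.\<close>

lemma cc_from_row:
  assumes T: "cc_module_map (row_module n) X T" and n: "1 \<le> n" and v: "v \<in> car (row_module n)"
    and B: "0 < B" "\<And>w. w \<in> circle \<Longrightarrow> l2 n (\<lambda>k. v k w) \<le> B"
  shows "vnorm X (T v) \<le> B"
proof -
  have mm: "module_map (row_module n) X T" and cb: "cb_norm (row_module n) X T \<le> 1"
    using T by (auto simp: cc_module_map_def)
  define c where "c = complex_of_real (1 / B)"
  define v' where "v' = act (row_module n) (circ (\<lambda>_. c)) v"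
  have v': "v' \<in> car (row_module n)"
    using v by (auto simp: v'_def row_module_simps intro: disk_algebra_mult disk_algebra_const)
  have "vnorm (row_module n) v' \<le> 1"
  proof (rule row_vnorm_least[OF n])
    fix w assume w: "w \<in> circle"
    have "l2 n (\<lambda>k. v' k w) = cmod c * l2 n (\<lambda>k. v k w)"
      using w by (simp add: v'_def row_module_simps circ_def l2_scale)
    also have "\<dots> \<le> cmod c * B" by (intro mult_left_mono B w) simp
    finally show "l2 n (\<lambda>k. v' k w) \<le> 1" using B by (simp add: c_def norm_divide)
  qed
  then have "vnorm X (T v') \<le> 1"
    using cb_norm_le_1D[OF cb, of "\<lambda>_ _. v'" 1] v' by (simp add: vnorm_def mats_def)
  moreover have Tv: "T v \<in> car X" using mm v by (simp add: module_map_def)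
  moreover have "T v' = act X (circ (\<lambda>_. c)) (T v)"
    unfolding v'_def using mm v disk_algebra_const[of c] unfolding module_map_def by blast
  ultimately have "cmod c * vnorm X (T v) \<le> 1" by (simp add: act_const vnorm_scl)
  then show ?thesis using B by (simp add: c_def norm_divide field_simps)
qed

end

text \<open>\<open>\<kappa>\<close> is a quantity at \<open>w0\<close> such as the length of a
  tuple. The multiplier \<open>a\<close> has modulus between \<open>1 / (f + e)\<close> and
  \<open>exp e / (f + e)\<close>, so the hypothesis yields
  \<open>\<kappa> \<le> exp e * (f w0 + e)\<close>, and \<open>e\<close> tends to 0.\<close>

lemma peak:
  assumes f: "continuous_on circle f" "\<And>w. w \<in> circle \<Longrightarrow> 0 \<le> f w" and w0: "w0 \<in> circle"
    and le: "\<And>a c. a \<in> disk_algebra \<Longrightarrow> 0 < c \<Longrightarrow> (\<And>w. w \<in> circle \<Longrightarrow> cmod (a w) * f w \<le> c) \<Longrightarrow> cmod (a w0) * \<kappa> \<le> c"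
  shows "\<kappa> \<le> f w0"
proof (cases "\<kappa> \<le> 0")
  case True
  then show ?thesis using f(2)[OF w0] by linarith
next
  case False
  have "\<kappa> \<le> exp e * (f w0 + e)" if e: "0 < e" for e
  proof -
    have pos: "0 < f w + e" if "w \<in> circle" for w using f(2)[OF that] e by linarith
    have "continuous_on circle (\<lambda>w. - ln (f w + e))"
      using f(1) pos by (intro continuous_intros) (auto simp: less_imp_neq[symmetric])
    then obtain F where F: "in_A F" "\<And>w. w \<in> circle \<Longrightarrow> - ln (f w + e) \<le> Re (F w)"
      "\<And>w. w \<in> circle \<Longrightarrow> Re (F w) \<le> - ln (f w + e) + e"
      using Re_approx_in_A[OF _ e] by blast
    define a where "a = circ (\<lambda>z. exp (F z))"
    have aw: "cmod (a w) = exp (Re (F w))" if "w \<in> circle" for w using that by (simp add: a_def circ_def)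
    have "a \<in> disk_algebra"
      unfolding a_def using F(1)
      by (intro circ_in_disk_algebra) (auto simp: in_A_def intro!: continuous_intros holomorphic_intros)
    then have "cmod (a w0) * \<kappa> \<le> exp e"
    proof (rule le)
      fix w assume w: "w \<in> circle"
      have "cmod (a w) \<le> exp (- ln (f w + e) + e)" unfolding aw[OF w] using F(3)[OF w] by simp
      also have "\<dots> = exp e / (f w + e)" using pos[OF w] by (simp add: exp_diff)
      finally have "cmod (a w) * f w \<le> exp e / (f w + e) * f w" by (intro mult_right_mono f w)
      also have "\<dots> \<le> exp e" using pos[OF w] e by (simp add: field_simps)
      finally show "cmod (a w) * f w \<le> exp e" .
    qed simp
    moreover have "1 / (f w0 + e) \<le> cmod (a w0)"
    proof -
      have "1 / (f w0 + e) = exp (- ln (f w0 + e))" using pos[OF w0] by (simp add: exp_minus field_simps)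
      also have "\<dots> \<le> cmod (a w0)" unfolding aw[OF w0] using F(2)[OF w0] by simp
      finally show ?thesis .
    qed
    ultimately have "1 / (f w0 + e) * \<kappa> \<le> exp e"
      using False by (meson linorder_le_cases mult_right_mono order_trans)
    then show ?thesis using pos[OF w0] by (simp add: field_simps)
  qed
  then have "eventually (\<lambda>e. \<kappa> \<le> exp e * (f w0 + e)) (at_right 0)"
    using eventually_at_right_less[of 0] by (auto elim: eventually_mono)
  moreover have "((\<lambda>e. exp e * (f w0 + e)) \<longlongrightarrow> exp 0 * (f w0 + 0)) (at_right 0)"
    by (intro tendsto_intros)
  ultimately have "\<kappa> \<le> exp 0 * (f w0 + 0)"
    by (intro tendsto_lowerbound[of _ _ "at_right 0"]) auto
  then show ?thesis by simp
qed

lemma rigging_eventually: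
  assumes R: "rigging X I le n \<phi> \<psi>" and u: "u \<in> car X" and e: "0 < e"
  obtains i where "i \<in> I" "vnorm X (\<psi> i (\<phi> i u) - u) < e"
proof -
  have d: "directed_set I le" and
    "((\<lambda>i. vnorm X (\<psi> i (\<phi> i u) - u)) \<longlongrightarrow> 0) (net_filter I le)"
    using R u by (auto simp: rigging_def)
  from order_tendstoD(2)[OF this(2) e]
  obtain i where i: "i \<in> I" "\<forall>j\<in>I. le i j \<longrightarrow> vnorm X (\<psi> j (\<phi> j u) - u) < e"
    unfolding eventually_net_filter[OF d] by blast
  have "le i i" using d i(1) by (simp add: directed_set_def)
  then show ?thesis using that i by blast
qed

text \<open>With \<open>E\<close> the whole circle the only compact set to test is empty, and zero
  tuples satisfy both bounds since \<open>1 / 0 = \<infinity>\<close>.\<close>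

lemma zero_in_R_class:
  assumes "\<And>w. w \<in> circle \<Longrightarrow> f w = 0"
  shows "f \<in> R_class"
proof -
  have c: "continuous_on circle f" by (rule continuous_on_eq[of _ "\<lambda>_. 0"]) (use assms in auto)
  have "f \<in> R_class_on circle"
    unfolding R_class_on_def
  proof (rule CollectI, intro conjI c)
    show "\<forall>w\<in>circle. (f w = 0) = (w \<in> circle)" using assms by blast
    have "(0::complex \<Rightarrow> complex) \<in> disk_algebra" by (rule disk_algebra_zero)
    then show "\<exists>d H K. (\<forall>n. 1 \<le> d n \<and> (\<forall>k<d n. H n k \<in> disk_algebra \<and> K n k \<in> disk_algebra)) \<and>
       (\<forall>n. \<forall>w\<in>circle. l2 (d n) (\<lambda>k. K n k w) \<le> f w \<and> ereal (f w) \<le> 1 / ereal (l2 (d n) (\<lambda>k. H n k w))) \<and>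
       (\<forall>C. compact C \<and> C \<subseteq> circle - circle \<longrightarrow>
            uniform_limit C (\<lambda>n w. \<Sum>k<d n. H n k w * K n k w) (\<lambda>_. 1) sequentially)"
      by (intro exI[of _ "\<lambda>_::nat. 1::nat"] exI[of _ "\<lambda>_ _. 0"]) (auto simp: assms L2_set_def uniform_limit_iff divide_ereal_def simp flip: zero_ereal_def)
  qed
  then show ?thesis unfolding R_class_def by (intro UN_I[of circle]) auto
qed

lemma rigged_imp_log_integrable:
  assumes f: "continuous_on circle f" "\<And>w. w \<in> circle \<Longrightarrow> 0 \<le> f w"
    and R: "rigged (closed_submodule f)" and w1: "w1 \<in> circle" "f w1 \<noteq> 0"
  shows "log_integrable f"
proof -
  let ?X = "closed_submodule f"
  interpret X: left_operator_module ?X by (rule left_operator_module_closed_submodule)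
  obtain I :: "((complex \<Rightarrow> complex) factorization set \<times> (complex \<Rightarrow> complex) factorization) set"
    and le n \<phi> \<psi> where rig: "rigging ?X I le n \<phi> \<psi>"
    using R unfolding rigged_def by blast
  define x where "x = (\<lambda>w. circ (\<lambda>_. 1) w * of_real (f w))"
  have x: "x \<in> car ?X" unfolding x_def by (rule closed_submodule_generated[OF f(1) disk_algebra_const])
  have xw: "x w = of_real (f w)" if "w \<in> circle" for w using that by (simp add: x_def circ_def)
  have "x \<noteq> 0" using xw[OF w1(1)] w1(2) by auto
  then have "0 < vnorm ?X x" using X.vnorm_nonneg[OF x] X.vnorm_eq_0[OF x] by linarith
  \<comment> \<open>At an index where the factorisation moves \<open>x\<close> by less than its
    norm, \<open>\<phi> i x\<close> cannot vanish, because \<open>\<psi> i\<close> sends 0 to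
    0.\<close>
  then obtain i where i: "i \<in> I" "vnorm ?X (\<psi> i (\<phi> i x) - x) < vnorm ?X x"
    by (rule rigging_eventually[OF rig x])
  have n: "1 \<le> n i" and cc\<phi>: "cc_module_map ?X (row_module (n i)) (\<phi> i)" and cc\<psi>: "cc_module_map (row_module (n i)) ?X (\<psi> i)"
    using rig i(1) unfolding rigging_def by blast+
  have mm\<phi>: "module_map ?X (row_module (n i)) (\<phi> i)" using cc\<phi> by (simp add: cc_module_map_def)
  have car: "\<phi> i x \<in> car (row_module (n i))" using mm\<phi> x by (simp add: module_map_def)
  have "\<phi> i x \<noteq> 0"
  proof
    assume 0: "\<phi> i x = 0"
    have "(0 :: nat \<Rightarrow> complex \<Rightarrow> complex) \<in> car (row_module (n i))" using car 0 by simp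
    then have "\<psi> i (0 + 0) = \<psi> i 0 + \<psi> i 0"
      using cc\<psi> unfolding cc_module_map_def module_map_def by blast
    then have "\<psi> i 0 = 0" by simp
    then show False using i(2) X.vnorm_minus[OF x] 0 by simp
  qed
  then obtain k where k: "\<phi> i x k \<noteq> 0" by (auto simp: fun_eq_iff)
  have kn: "k < n i" using car k by (force simp: row_module_simps)
  then have kA: "\<phi> i x k \<in> disk_algebra" using car by (simp add: row_module_simps)
  obtain w2 where w2: "\<phi> i x k w2 \<noteq> 0" using k by (auto simp: fun_eq_iff)
  show ?thesis
  proof (rule log_integrable_of_disk_algebra_le[OF f kA w2])
    fix w0 assume w0: "w0 \<in> circle"
    have "l2 (n i) (\<lambda>k. \<phi> i x k w0) \<le> f w0"
    proof (rule peak[OF f w0])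
      fix a c assume a: "a \<in> disk_algebra" and c: "0 < c" "\<And>w. w \<in> circle \<Longrightarrow> cmod (a w) * f w \<le> c"
      have "\<phi> i (act ?X a x) = act (row_module (n i)) a (\<phi> i x)"
        using mm\<phi> a x by (simp add: module_map_def)
      then have "cmod (a w0) * l2 (n i) (\<lambda>k. \<phi> i x k w0) = l2 (n i) (\<lambda>k. \<phi> i (act ?X a x) k w0)"
        by (simp add: row_module_simps l2_scale)
      also have "\<dots> \<le> vnorm ?X (act ?X a x)"
        by (rule X.cc_to_row[OF cc\<phi> n X.act_closed[OF a x] w0])
      also have "\<dots> \<le> c"
        unfolding vnorm_closed_submodule closed_submodule_simps
      proof (rule C_mnorm_1_least)
        fix w assume w: "w \<in> circle"
        show "cmod ((a * x) w) \<le> c" using c(2)[OF w] f(2)[OF w] by (simp add: xw[OF w] norm_mult)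
      qed
      finally show "cmod (a w0) * l2 (n i) (\<lambda>k. \<phi> i x k w0) \<le> c" .
    qed
    then show "cmod (\<phi> i x k w0) \<le> f w0" using l2_entry[OF kn, of "\<lambda>k. \<phi> i x k w0"] by linarith
  qed
qed

lemma rigged_iff_R_class:
  assumes f: "continuous_on circle f" "\<And>w. w \<in> circle \<Longrightarrow> 0 \<le> f w"
  shows "rigged (closed_submodule f) \<longleftrightarrow> f \<in> R_class"
proof
  assume R: "rigged (closed_submodule f)"
  show "f \<in> R_class"
  proof (cases "\<exists>w\<in>circle. f w \<noteq> 0")
    case True
    then show ?thesis
      using rigged_imp_log_integrable[OF f R] log_integrable_imp_R_class[OF f] by blast
  qed (rule zero_in_R_class, blast)
qed (rule R_class_imp_rigged[OF f])

lemma log_integrable_iff_rigged: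
  assumes f: "continuous_on circle f" "\<And>w. w \<in> circle \<Longrightarrow> 0 \<le> f w" and w: "w \<in> circle" "f w \<noteq> 0"
  shows "log_integrable f \<longleftrightarrow> rigged (closed_submodule f)"
  using rigged_imp_log_integrable[OF f _ w] log_integrable_imp_R_class[OF f] R_class_imp_rigged[OF f]
  by blast

section \<open>Singly generated rigged modules\<close>

definition std_unit :: "nat \<Rightarrow> nat \<Rightarrow> complex \<Rightarrow> complex" where
  "std_unit k = (\<lambda>j. if j = k then circ (\<lambda>_. 1) else 0)"

lemma std_unit_car: "k < n \<Longrightarrow> std_unit k \<in> car (row_module n)"
  by (auto simp: row_module_simps std_unit_def disk_algebra_const disk_algebra_zero)

lemma row_expansion:
  assumes v: "v \<in> car (row_module n)"
  shows "v = (\<Sum>k<n. act (row_module n) (v k) (std_unit k))"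
proof (rule ext, rule ext)
  fix j z
  have C: "v k \<in> C_circle" if "k < n" for k using v that by (simp add: row_module_simps disk_algebra_C_circle)
  have "(\<Sum>k<n. act (row_module n) (v k) (std_unit k)) j z = (\<Sum>k<n. if k = j then v j z else 0)"
    unfolding sum_fun_apply row_module_simps
  proof (intro sum.cong refl)
    fix k assume "k \<in> {..<n}"
    then have "z \<notin> circle \<Longrightarrow> v k z = 0" using C[of k] by (simp add: C_circle_def)
    then show "(v k * std_unit k j) z = (if k = j then v j z else 0)"
      by (auto simp: std_unit_def circ_def)
  qed
  also have "\<dots> = v j z" using v by (auto simp: row_module_simps not_less)
  finally show "v j z = (\<Sum>k<n. act (row_module n) (v k) (std_unit k)) j z" by simp
qed

lemma row_module_add: "u \<in> car (row_module n) \<Longrightarrow> v \<in> car (row_module n) \<Longrightarrow> u + v \<in> car (row_module n)"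
  by (auto simp: row_module_simps disk_algebra_add)

lemma row_module_zero: "0 \<in> car (row_module n)"
  by (auto simp: row_module_simps disk_algebra_zero)

lemma row_module_act: "a \<in> disk_algebra \<Longrightarrow> v \<in> car (row_module n) \<Longrightarrow> act (row_module n) a v \<in> car (row_module n)"
  by (auto simp: row_module_simps disk_algebra_mult)

text \<open>The row module is free on the standard units. The induction over finite index sets
  carries membership along, because additivity is available on the carrier only.\<close>

lemma module_map_row_expansion:
  assumes T: "module_map (row_module n) X T" and v: "v \<in> car (row_module n)"
  shows "T v = (\<Sum>k<n. act X (v k) (T (std_unit k)))"
proof -
  have vA: "v k \<in> disk_algebra" if "k < n" for k using v that by (simp add: row_module_simps)
  have T0: "T 0 = 0"
  proof -
    have "T (0 + 0) = T 0 + T 0" using T row_module_zero[of n] unfolding module_map_def by blast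
    then show ?thesis by simp
  qed
  have "(\<Sum>k\<in>S. act (row_module n) (v k) (std_unit k)) \<in> car (row_module n) \<and>
      T (\<Sum>k\<in>S. act (row_module n) (v k) (std_unit k)) = (\<Sum>k\<in>S. act X (v k) (T (std_unit k)))"
    if "finite S" "S \<subseteq> {..<n}" for S
    using that
  proof (induction S)
    case empty
    then show ?case unfolding sum.empty using T0 row_module_zero by blast
  next
    case (insert k S)
    then have k: "k < n" by simp
    let ?s = "\<Sum>k\<in>S. act (row_module n) (v k) (std_unit k)"
    have 1: "act (row_module n) (v k) (std_unit k) \<in> car (row_module n)"
      by (rule row_module_act[OF vA[OF k] std_unit_car[OF k]])
    have 2: "?s \<in> car (row_module n)" "T ?s = (\<Sum>k\<in>S. act X (v k) (T (std_unit k)))"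
      using insert by auto
    have 3: "T (act (row_module n) (v k) (std_unit k) + ?s) = T (act (row_module n) (v k) (std_unit k)) + T ?s"
      using T 1 2(1) unfolding module_map_def by blast
    have 4: "T (act (row_module n) (v k) (std_unit k)) = act X (v k) (T (std_unit k))"
      using T vA[OF k] std_unit_car[OF k] unfolding module_map_def by blast
    show ?case
      unfolding sum.insert[OF insert(1,2)] 3 4 2(2) by (intro conjI row_module_add 1 2(1) refl)
  qed
  from this[of "{..<n}"] show ?thesis using row_expansion[OF v] by simp
qed

section \<open>The pointwise norm of a generator and the resulting isometry\<close>

context left_operator_module
begin

text \<open>As a supremum of continuous functions, \<open>f\<close> is at first only lower
  semicontinuous; it has to be shown that a single \<open>F i\<close> comes uniformly close to it.
  If \<open>\<psi> i\<close> sends the standard units nearly to \<open>b k\<close> acting on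
  \<open>x\<close>, contractivity of \<open>\<psi> i\<close> bounds the length of \<open>b\<close>
  times \<open>f\<close> by nearly 1, while the pairing \<open>h\<close> of
  \<open>\<phi> i x\<close> with \<open>b\<close> acts on \<open>x\<close> nearly as the identity.
  Hence \<open>f\<close> is close to \<open>|h| * f\<close>, which is at most \<open>F i\<close> up
  to a small error.\<close>

lemma generator_norm:
  assumes rig: "rigging X I le n \<phi> \<psi>" and x: "x \<in> car X"
    and gen: "\<And>y e. y \<in> car X \<Longrightarrow> e > 0 \<Longrightarrow> \<exists>a\<in>disk_algebra. vnorm X (y - act X a x) < e"
  obtains f where "continuous_on circle f" "\<And>w. w \<in> circle \<Longrightarrow> 0 \<le> f w"
    "\<And>a w. a \<in> disk_algebra \<Longrightarrow> w \<in> circle \<Longrightarrow> cmod (a w) * f w \<le> vnorm X (act X a x)"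
    "\<And>a c. a \<in> disk_algebra \<Longrightarrow> 0 < c \<Longrightarrow> (\<And>w. w \<in> circle \<Longrightarrow> cmod (a w) * f w \<le> c) \<Longrightarrow> vnorm X (act X a x) \<le> c"
    "rigged (closed_submodule f)"
proof -
  have I0: "I \<noteq> {}" using rig by (auto simp: rigging_def directed_set_def)
  have n: "1 \<le> n i" if "i \<in> I" for i using rig that by (simp add: rigging_def)
  have cc\<phi>: "cc_module_map X (row_module (n i)) (\<phi> i)" if "i \<in> I" for i using rig that by (simp add: rigging_def)
  have cc\<psi>: "cc_module_map (row_module (n i)) X (\<psi> i)" if "i \<in> I" for i using rig that by (simp add: rigging_def)
  have mm\<phi>: "module_map X (row_module (n i)) (\<phi> i)" if "i \<in> I" for i using cc\<phi>[OF that] by (simp add: cc_module_map_def)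
  have mm\<psi>: "module_map (row_module (n i)) X (\<psi> i)" if "i \<in> I" for i using cc\<psi>[OF that] by (simp add: cc_module_map_def)
  define F where "F = (\<lambda>i w. l2 (n i) (\<lambda>k. \<phi> i x k w))"
  have K: "\<phi> i x \<in> car (row_module (n i))" if "i \<in> I" for i using mm\<phi>[OF that] x by (simp add: module_map_def)
  have Kact: "\<phi> i (act X a x) k w = a w * \<phi> i x k w" if "i \<in> I" "a \<in> disk_algebra" for i a k w
  proof -
    have "\<phi> i (act X a x) = act (row_module (n i)) a (\<phi> i x)"
      using mm\<phi>[OF that(1)] that(2) x by (simp add: module_map_def)
    then show ?thesis by (simp add: row_module_simps)
  qed
  have Fact: "l2 (n i) (\<lambda>k. \<phi> i (act X a x) k w) = cmod (a w) * F i w" if "i \<in> I" "a \<in> disk_algebra" for i a w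
    unfolding F_def Kact[OF that] by (rule l2_scale)
  have Fle: "cmod (a w) * F i w \<le> vnorm X (act X a x)" if "i \<in> I" "a \<in> disk_algebra" "w \<in> circle" for i a w
    using cc_to_row[OF cc\<phi>[OF that(1)] n[OF that(1)] act_closed[OF that(2) x] that(3)]
    unfolding Fact[OF that(1,2)] .
  have F0: "0 \<le> F i w" for i w unfolding F_def by (rule l2_nonneg)
  define N where "N = vnorm X x"
  have N0: "0 \<le> N" unfolding N_def by (rule vnorm_nonneg[OF x])
  have FN: "F i w \<le> N" if "i \<in> I" "w \<in> circle" for i w
    unfolding F_def N_def by (rule cc_to_row[OF cc\<phi>[OF that(1)] n[OF that(1)] x that(2)])
  define f where "f = (\<lambda>w. SUP i\<in>I. F i w)"
  have bdd: "bdd_above ((\<lambda>i. F i w) ` I)" if "w \<in> circle" for w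
    by (rule bdd_aboveI2[of _ _ N]) (rule FN[OF _ that])
  have Ff: "F i w \<le> f w" if "i \<in> I" "w \<in> circle" for i w
    unfolding f_def by (rule cSUP_upper[OF that(1) bdd[OF that(2)]])
  have f0: "0 \<le> f w" if "w \<in> circle" for w
  proof -
    obtain i where "i \<in> I" using I0 by blast
    from order_trans[OF F0 Ff[OF this that]] show ?thesis .
  qed
  have fle: "cmod (a w) * f w \<le> vnorm X (act X a x)" if a: "a \<in> disk_algebra" and w: "w \<in> circle" for a w
  proof (cases "a w = 0")
    case True
    then show ?thesis using vnorm_nonneg[OF act_closed[OF a x]] by simp
  next
    case False
    have "f w \<le> vnorm X (act X a x) / cmod (a w)"
      unfolding f_def
    proof (rule cSUP_least[OF I0])
      fix i assume "i \<in> I"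
      from Fle[OF this a w] show "F i w \<le> vnorm X (act X a x) / cmod (a w)"
        using False by (simp add: field_simps)
    qed
    then show ?thesis using False by (simp add: field_simps)
  qed
  \<comment> \<open>The norm is recovered through \<open>\<psi> i\<close>: it is contractive, and it
    returns nearly the vector that \<open>\<phi> i\<close> has mapped to a tuple of pointwise length
    at most \<open>c\<close>.\<close>
  have fge: "vnorm X (act X a x) \<le> c"
    if a: "a \<in> disk_algebra" and c: "0 < c" "\<And>w. w \<in> circle \<Longrightarrow> cmod (a w) * f w \<le> c" for a c
  proof (rule field_le_epsilon)
    fix e :: real assume e: "0 < e"
    let ?y = "act X a x"
    have y: "?y \<in> car X" by (rule act_closed[OF a x])
    obtain i where i: "i \<in> I" "vnorm X (\<psi> i (\<phi> i ?y) - ?y) < e"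
      by (rule rigging_eventually[OF rig y e])
    have car: "\<phi> i ?y \<in> car (row_module (n i))" using mm\<phi>[OF i(1)] y by (simp add: module_map_def)
    have z: "\<psi> i (\<phi> i ?y) \<in> car X" using mm\<psi>[OF i(1)] car by (simp add: module_map_def)
    have "vnorm X (\<psi> i (\<phi> i ?y)) \<le> c"
    proof (rule cc_from_row[OF cc\<psi>[OF i(1)] n[OF i(1)] car c(1)])
      fix w assume w: "w \<in> circle"
      have "cmod (a w) * F i w \<le> cmod (a w) * f w" by (intro mult_left_mono Ff i w) simp
      then show "l2 (n i) (\<lambda>k. \<phi> i ?y k w) \<le> c" unfolding Fact[OF i(1) a] using c(2)[OF w] by linarith
    qed
    then show "vnorm X ?y \<le> c + e"
      using vnorm_le_diff[OF y z] vnorm_commute[OF y z] i(2) by linarith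
  qed
  have approx: "\<exists>i\<in>I. \<forall>w\<in>circle. f w \<le> F i w + e" if e: "0 < e" for e
  proof -
    obtain i where i: "i \<in> I" "vnorm X (\<psi> i (\<phi> i x) - x) < e / 2"
      by (rule rigging_eventually[OF rig x, of "e / 2"]) (use e in auto)
    define m where "m = n i"
    have m: "1 \<le> m" using n[OF i(1)] by (simp add: m_def)
    \<comment> \<open>Two errors of size \<open>real m * N * \<delta>\<close> arise below, one from
      \<open>h\<close> acting on \<open>x\<close> and one from the factor
      \<open>1 + real m * \<delta>\<close>; with this \<open>\<delta>\<close> they add up to at most
      \<open>e / 2\<close>. The 1 in the denominator covers \<open>N = 0\<close>.\<close>
    define \<delta> where "\<delta> = e / (4 * (real m * N + 1))"
    have mN: "0 < real m * N + 1" using N0 by (simp add: add_nonneg_pos)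
    have \<delta>: "0 < \<delta>" using e mN by (simp add: \<delta>_def)
    have \<delta>e: "2 * (real m * N * \<delta>) \<le> e / 2"
    proof -
      have "real m * N * \<delta> \<le> (real m * N + 1) * \<delta>" using \<delta> by (intro mult_right_mono) auto
      also have "\<dots> = e / 4"
      proof -
        have "t * (e / (4 * t)) = e / 4" if "t \<noteq> 0" for t using that by simp
        then show ?thesis unfolding \<delta>_def using mN by (metis less_irrefl)
      qed
      finally show ?thesis by simp
    qed
    have E: "\<psi> i (std_unit k) \<in> car X" if "k < m" for k
      using mm\<psi>[OF i(1)] std_unit_car[of k "n i"] that by (simp add: module_map_def m_def)
    have "\<exists>b. \<forall>k. k < m \<longrightarrow> b k \<in> disk_algebra \<and> vnorm X (\<psi> i (std_unit k) - act X (b k) x) < \<delta>"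
    proof (rule choice, rule allI)
      fix k
      show "\<exists>b. k < m \<longrightarrow> b \<in> disk_algebra \<and> vnorm X (\<psi> i (std_unit k) - act X b x) < \<delta>"
        using gen[OF E[of k] \<delta>] by (cases "k < m") auto
    qed
    then obtain b where b: "\<And>k. k < m \<Longrightarrow> b k \<in> disk_algebra"
      "\<And>k. k < m \<Longrightarrow> vnorm X (\<psi> i (std_unit k) - act X (b k) x) < \<delta>" by blast
    \<comment> \<open>\<open>\<psi> i v\<close> is determined by the images of the standard units,
      so it is nearly a single function acting on \<open>x\<close>; each of the \<open>m\<close>
      entries contributes an error of at most \<open>M * \<delta>\<close>.\<close>
    have comb: "vnorm X (\<psi> i v - act X (\<Sum>k<m. v k * b k) x) \<le> real m * M * \<delta>"
      if v: "v \<in> car (row_module m)" and M: "\<And>k w. k < m \<Longrightarrow> w \<in> circle \<Longrightarrow> cmod (v k w) \<le> M" for v M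
    proof -
      have vA: "v k \<in> disk_algebra" if "k < m" for k using v that by (simp add: row_module_simps)
      have M0: "0 \<le> M" using order_trans[OF norm_ge_zero M[of 0 1]] m by simp
      let ?D = "\<lambda>k. \<psi> i (std_unit k) - act X (b k) x"
      have D: "?D k \<in> car X" if "k < m" for k by (intro diff_closed E that act_closed b x)
      have "act X (\<Sum>k<m. v k * b k) x = (\<Sum>k<m. act X (v k * b k) x)"
        by (intro act_sum_left x disk_algebra_mult vA b) auto
      also have "\<dots> = (\<Sum>k<m. act X (v k) (act X (b k) x))"
        by (intro sum.cong refl act_mult vA b x) auto
      finally have "\<psi> i v - act X (\<Sum>k<m. v k * b k) x =
          (\<Sum>k<m. act X (v k) (\<psi> i (std_unit k))) - (\<Sum>k<m. act X (v k) (act X (b k) x))"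
        using module_map_row_expansion[OF mm\<psi>[OF i(1)], of v] v by (simp add: m_def)
      also have "\<dots> = (\<Sum>k<m. act X (v k) (?D k))"
        unfolding sum_subtractf[symmetric]
        by (intro sum.cong refl act_diff_right[symmetric] vA E act_closed b x) auto
      finally have "vnorm X (\<psi> i v - act X (\<Sum>k<m. v k * b k) x) = vnorm X (\<Sum>k<m. act X (v k) (?D k))" by simp
      also have "\<dots> \<le> (\<Sum>k<m. vnorm X (act X (v k) (?D k)))"
        by (intro vnorm_sum_le act_closed vA D) auto
      also have "\<dots> \<le> (\<Sum>k<m. M * \<delta>)"
      proof (rule sum_mono)
        fix k assume "k \<in> {..<m}"
        then have k: "k < m" by simp
        have "vnorm X (act X (v k) (?D k)) \<le> C_mnorm 1 (\<lambda>_ _. v k) * vnorm X (?D k)"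
          by (rule vnorm_act_le[OF vA[OF k] D[OF k]])
        also have "\<dots> \<le> M * \<delta>"
          using M[OF k] b(2)[OF k] M0 vnorm_nonneg[OF D[OF k]]
          by (intro mult_mono C_mnorm_1_least) auto
        finally show "vnorm X (act X (v k) (?D k)) \<le> M * \<delta>" .
      qed
      finally show ?thesis by simp
    qed
    have bA: "(\<Sum>k<m. v k * b k) \<in> disk_algebra" if "v \<in> car (row_module m)" for v
      using that by (intro disk_algebra_sum disk_algebra_mult b) (auto simp: row_module_simps)
    have lb: "l2 m (\<lambda>k. b k w) * f w \<le> 1 + real m * \<delta>" if w: "w \<in> circle" for w
    proof (cases "l2 m (\<lambda>k. b k w) = 0")
      case True
      then show ?thesis using \<delta> by simp
    next
      case False
      define s where "s = l2 m (\<lambda>k. b k w)"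
      have s: "0 < s" using False l2_nonneg[where n=m and v="\<lambda>k. b k w"] unfolding s_def by linarith
      \<comment> \<open>The normalised conjugate of \<open>b\<close> at the chosen point
        \<open>w\<close>. As a constant tuple it is sent by \<open>\<psi> i\<close> into the unit
        ball, and its pairing with \<open>b\<close> takes the value \<open>s\<close> at
        \<open>w\<close>.\<close>
      define c where "c = (\<lambda>k. of_real (1 / s) * cnj (b k w))"
      have c1: "l2 m c = 1"
      proof -
        have "l2 m c = cmod (of_real (1 / s)) * l2 m (\<lambda>k. cnj (b k w))" unfolding c_def by (rule l2_scale)
        then show ?thesis using s by (simp add: s_def[symmetric] norm_divide)
      qed
      define v where "v = (\<lambda>k. if k < m then circ (\<lambda>_. c k) else 0)"
      have v: "v \<in> car (row_module m)" by (auto simp: v_def row_module_simps disk_algebra_const)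
      have vw: "v k w' = c k" if "k < m" "w' \<in> circle" for k w' using that by (simp add: v_def circ_def)
      let ?a = "\<Sum>k<m. v k * b k"
      have aw: "?a w = of_real s"
      proof -
        have "?a w = (\<Sum>k<m. of_real (1 / s) * (b k w * cnj (b k w)))"
          unfolding sum_fun_apply by (intro sum.cong refl) (simp add: vw[OF _ w] c_def)
        also have "\<dots> = of_real (1 / s) * of_real (\<Sum>k<m. (cmod (b k w))\<^sup>2)"
          by (simp only: sum_distrib_left[symmetric] of_real_sum complex_norm_square)
        also have "(\<Sum>k<m. (cmod (b k w))\<^sup>2) = s\<^sup>2" unfolding s_def l2_power2 ..
        also have "complex_of_real (1 / s) * of_real (s\<^sup>2) = of_real s" using s by (simp add: power2_eq_square)
        finally show ?thesis .
      qed
      have "vnorm X (\<psi> i v - act X ?a x) \<le> real m * 1 * \<delta>"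
      proof (rule comb[OF v])
        fix k w' assume kw: "k < m" "w' \<in> circle"
        show "cmod (v k w') \<le> 1" using l2_entry[OF kw(1), of c] c1 by (simp add: vw[OF kw])
      qed
      moreover have "vnorm X (\<psi> i v) \<le> 1"
      proof (rule cc_from_row[OF cc\<psi>[OF i(1)] n[OF i(1)]])
        show "v \<in> car (row_module (n i))" using v by (simp add: m_def)
        fix w' assume w': "w' \<in> circle"
        have "l2 (n i) (\<lambda>k. v k w') = l2 m c"
          unfolding m_def[symmetric] by (intro L2_set_cong refl) (simp add: vw[OF _ w'])
        then show "l2 (n i) (\<lambda>k. v k w') \<le> 1" using c1 by simp
      qed simp
      moreover have carp: "\<psi> i v \<in> car X" "act X ?a x \<in> car X"
        using mm\<psi>[OF i(1)] v act_closed[OF bA[OF v] x] by (auto simp: module_map_def m_def)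
      ultimately have "vnorm X (act X ?a x) \<le> 1 + real m * \<delta>"
        using vnorm_le_diff[OF carp(2,1)] vnorm_commute[OF carp] by linarith
      then have "cmod (?a w) * f w \<le> 1 + real m * \<delta>" using fle[OF bA[OF v] w] by linarith
      then show ?thesis unfolding aw s_def[symmetric] using s by simp
    qed
    define h where "h = (\<Sum>k<m. \<phi> i x k * b k)"
    have Km: "\<phi> i x \<in> car (row_module m)" using K[OF i(1)] by (simp add: m_def)
    have hA: "h \<in> disk_algebra" unfolding h_def by (rule bA[OF Km])
    have one: "indicator circle \<in> disk_algebra" unfolding indicator_circle_eq by (rule disk_algebra_const)
    have carh: "act X h x \<in> car X" "\<psi> i (\<phi> i x) \<in> car X"
      using act_closed[OF hA x] mm\<psi>[OF i(1)] K[OF i(1)] by (auto simp: module_map_def)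
    have "vnorm X (\<psi> i (\<phi> i x) - act X h x) \<le> real m * N * \<delta>"
      unfolding h_def
    proof (rule comb[OF Km])
      fix k w assume kw: "k < m" "w \<in> circle"
      show "cmod (\<phi> i x k w) \<le> N"
        using l2_entry[OF kw(1), of "\<lambda>k. \<phi> i x k w"] FN[OF i(1) kw(2)] unfolding F_def m_def[symmetric] by linarith
    qed
    then have "vnorm X (x - act X h x) \<le> e / 2 + real m * N * \<delta>"
      using vnorm_diff_triangle[OF x carh] vnorm_commute[OF x carh(2)] i(2) by linarith
    moreover have "act X (indicator circle - h) x = x - act X h x"
      using act_diff_left[OF one hA x] act_unit[OF x] by simp
    ultimately have nh: "vnorm X (act X (indicator circle - h) x) \<le> e / 2 + real m * N * \<delta>" by simp
    have "f w \<le> F i w + e" if w: "w \<in> circle" for w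
    proof -
      have "cmod ((indicator circle - h) w) * f w \<le> e / 2 + real m * N * \<delta>"
        using fle[OF disk_algebra_diff[OF one hA] w] nh by linarith
      then have 1: "cmod (1 - h w) * f w \<le> e / 2 + real m * N * \<delta>" using w by (simp add: fun_diff_def)
      have "cmod (h w) \<le> l2 m (\<lambda>k. \<phi> i x k w) * l2 m (\<lambda>k. b k w)"
        unfolding h_def sum_fun_apply by (simp add: l2_dot)
      then have "cmod (h w) * f w \<le> F i w * l2 m (\<lambda>k. b k w) * f w"
        unfolding F_def m_def[symmetric] by (intro mult_right_mono f0 w)
      also have "\<dots> = F i w * (l2 m (\<lambda>k. b k w) * f w)" by (simp only: mult.assoc)
      also have "\<dots> \<le> F i w * (1 + real m * \<delta>)" by (intro mult_left_mono lb w F0)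
      also have "\<dots> = F i w + F i w * (real m * \<delta>)" by (simp add: algebra_simps)
      also have "\<dots> \<le> F i w + N * (real m * \<delta>)"
        using \<delta> by (intro add_left_mono mult_right_mono FN i w) auto
      finally have 2: "cmod (h w) * f w \<le> F i w + real m * N * \<delta>" by (simp only: mult_ac)
      have "1 \<le> cmod (h w) + cmod (1 - h w)" using norm_triangle_ineq[of "h w" "1 - h w"] by simp
      then have "1 * f w \<le> (cmod (h w) + cmod (1 - h w)) * f w" by (intro mult_right_mono f0 w)
      then have "f w \<le> cmod (h w) * f w + cmod (1 - h w) * f w" by (simp add: algebra_simps)
      then show ?thesis using 1 2 \<delta>e by linarith
    qed
    then show ?thesis using i(1) by blast
  qed
  have Fc: "continuous_on circle (F i)" if "i \<in> I" for i
  proof -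
    have "continuous_on circle (\<phi> i x k)" if k: "k < n i" for k
      using K[OF \<open>i \<in> I\<close>] k by (auto simp: row_module_simps disk_algebra_def C_circle_def)
    then show ?thesis unfolding F_def L2_set_def by (intro continuous_intros) auto
  qed
  have fc: "continuous_on circle f"
  proof -
    have "\<exists>j. \<forall>k. j k \<in> I \<and> (\<forall>w\<in>circle. f w \<le> F (j k) w + 1 / (real k + 1))"
    proof (rule choice, rule allI)
      fix k :: nat
      show "\<exists>i. i \<in> I \<and> (\<forall>w\<in>circle. f w \<le> F i w + 1 / (real k + 1))"
        using approx[of "1 / (real k + 1)"] by (simp add: Bex_def)
    qed
    then obtain j where j: "\<And>k. j k \<in> I" "\<And>k w. w \<in> circle \<Longrightarrow> f w \<le> F (j k) w + 1 / (real k + 1)" by blast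
    have "uniform_limit circle (\<lambda>k. F (j k)) f sequentially"
    proof (rule uniform_limitI)
      fix e :: real assume e: "0 < e"
      have "(\<lambda>k. 1 / (real k + 1)) \<longlonglongrightarrow> 0" by real_asymp
      from order_tendstoD(2)[OF this e]
      show "eventually (\<lambda>k. \<forall>w\<in>circle. dist (F (j k) w) (f w) < e) sequentially"
      proof eventually_elim
        case (elim k)
        show ?case
        proof
          fix w assume w: "w \<in> circle"
          show "dist (F (j k) w) (f w) < e"
            using j(2)[OF w, of k] Ff[OF j(1) w, of k] elim by (simp add: dist_real_def abs_if)
        qed
      qed
    qed
    then show ?thesis by (rule uniform_limit_theorem[rotated]) (auto intro!: always_eventually Fc j)
  qed
  \<comment> \<open>\<open>A_isometric\<close> speaks of norms of vectors and not of matrices, so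
    riggedness is not transported along the isometry. For nonzero \<open>f\<close> it follows from
    integrability of \<open>ln f\<close>, which a nonzero entry of some \<open>\<phi> i x\<close>,
    bounded by \<open>f\<close>, provides.\<close>
  have "rigged (closed_submodule f)"
  proof (cases "\<exists>w\<in>circle. f w \<noteq> 0")
    case False
    then have "f w = 0" if "w \<in> circle" for w using that by auto
    then show ?thesis by (intro R_class_imp_rigged[OF fc f0] zero_in_R_class)
  next
    case True
    then obtain w1 where w1: "w1 \<in> circle" "0 < f w1" using f0 by force
    obtain i where i: "i \<in> I" "f w1 \<le> F i w1 + f w1 / 2"
      using approx[of "f w1 / 2"] w1 by auto
    have "F i w1 \<noteq> 0" using i(2) w1(2) by auto
    have "\<exists>k<n i. \<phi> i x k w1 \<noteq> 0"
    proof (rule ccontr)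
      assume "\<not> ?thesis"
      then have "F i w1 = 0" unfolding F_def by (intro l2_0) blast
      then show False using \<open>F i w1 \<noteq> 0\<close> by simp
    qed
    then obtain k where k: "k < n i" "\<phi> i x k w1 \<noteq> 0" by blast
    have "log_integrable f"
    proof (rule log_integrable_of_disk_algebra_le[where k = "\<phi> i x k", OF fc f0 _ k(2)])
      show "\<phi> i x k \<in> disk_algebra" using K[OF i(1)] k(1) by (simp add: row_module_simps)
      fix w assume w: "w \<in> circle"
      show "cmod (\<phi> i x k w) \<le> f w"
        using l2_entry[OF k(1), of "\<lambda>k. \<phi> i x k w"] Ff[OF i(1) w] unfolding F_def by linarith
    qed
    then show ?thesis
      by (intro R_class_imp_rigged[OF fc f0] log_integrable_imp_R_class[OF fc f0])
  qed
  with that[OF fc f0 fle fge] show ?thesis by blast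
qed

text \<open>The map from \<open>a x\<close> to \<open>a f\<close> is extended by closing its graph:
  \<open>rel\<close> relates \<open>y\<close> and \<open>g\<close> when common multipliers
  approximate both. The two estimates between \<open>f\<close> and the norm give related elements
  equal norms, hence uniqueness of partners; completeness of each module gives partners for the
  elements of the other.\<close>

lemma isometric_closed_submodule:
  assumes x: "x \<in> car X"
    and gen: "\<And>y e. y \<in> car X \<Longrightarrow> e > 0 \<Longrightarrow> \<exists>a\<in>disk_algebra. vnorm X (y - act X a x) < e"
    and f: "continuous_on circle f" "\<And>w. w \<in> circle \<Longrightarrow> 0 \<le> f w"
    and fle: "\<And>a w. a \<in> disk_algebra \<Longrightarrow> w \<in> circle \<Longrightarrow> cmod (a w) * f w \<le> vnorm X (act X a x)"
    and fge: "\<And>a c. a \<in> disk_algebra \<Longrightarrow> 0 < c \<Longrightarrow> (\<And>w. w \<in> circle \<Longrightarrow> cmod (a w) * f w \<le> c) \<Longrightarrow> vnorm X (act X a x) \<le> c"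
  shows "A_isometric X (closed_submodule f)"
proof -
  let ?Y = "closed_submodule f"
  interpret Y: left_operator_module ?Y by (rule left_operator_module_closed_submodule)
  define rel where "rel = (\<lambda>y g. y \<in> car X \<and> g \<in> car ?Y \<and> (\<forall>e>0. \<exists>a\<in>disk_algebra.
      vnorm X (y - act X a x) < e \<and> (\<forall>w\<in>circle. cmod (g w - a w * f w) < e)))"
  have relE: "\<exists>a\<in>disk_algebra. vnorm X (y - act X a x) < e \<and> (\<forall>w\<in>circle. cmod (g w - a w * f w) < e)"
    if "rel y g" "0 < e" for y g e using that unfolding rel_def by blast
  have rel_car: "y \<in> car X" "g \<in> car ?Y" if "rel y g" for y g using that unfolding rel_def by blast+
  have rel_norm: "vnorm ?Y g = vnorm X y" if r: "rel y g" for y g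
  proof (rule antisym)
    have y: "y \<in> car X" and g: "g \<in> car ?Y" using rel_car[OF r] by auto
    note gC = closed_submodule_C_circle[OF g]
    show "vnorm ?Y g \<le> vnorm X y"
    proof (rule field_le_epsilon)
      fix e :: real assume e: "0 < e"
      obtain a where a: "a \<in> disk_algebra" "vnorm X (y - act X a x) < e / 2" "\<forall>w\<in>circle. cmod (g w - a w * f w) < e / 2"
        using relE[OF r, of "e / 2"] e by auto
      have ax: "act X a x \<in> car X" by (rule act_closed[OF a(1) x])
      show "vnorm ?Y g \<le> vnorm X y + e"
        unfolding vnorm_closed_submodule
      proof (rule C_mnorm_1_least)
        fix w assume w: "w \<in> circle"
        have "cmod (g w) \<le> cmod (g w - a w * f w) + cmod (a w * f w)"
          using norm_triangle_ineq[of "g w - a w * f w" "a w * f w"] by simp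
        also have "cmod (a w * f w) = cmod (a w) * f w" using f(2)[OF w] by (simp add: norm_mult)
        also have "\<dots> \<le> vnorm X (act X a x)" by (rule fle[OF a(1) w])
        also have "\<dots> \<le> vnorm X (act X a x - y) + vnorm X y" by (rule vnorm_le_diff[OF ax y])
        also have "vnorm X (act X a x - y) = vnorm X (y - act X a x)" by (rule vnorm_commute[OF ax y])
        finally show "cmod (g w) \<le> vnorm X y + e" using a(2) a(3)[rule_format, OF w] by linarith
      qed
    qed
    show "vnorm X y \<le> vnorm ?Y g"
    proof (rule field_le_epsilon)
      fix e :: real assume e: "0 < e"
      obtain a where a: "a \<in> disk_algebra" "vnorm X (y - act X a x) < e / 2" "\<forall>w\<in>circle. cmod (g w - a w * f w) < e / 2"
        using relE[OF r, of "e / 2"] e by auto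
      have ax: "act X a x \<in> car X" by (rule act_closed[OF a(1) x])
      have "vnorm X (act X a x) \<le> vnorm ?Y g + e / 2"
      proof (rule fge[OF a(1)])
        show "0 < vnorm ?Y g + e / 2" using Y.vnorm_nonneg[OF g] e by simp
        fix w assume w: "w \<in> circle"
        have "cmod (a w) * f w = cmod (a w * f w)" using f(2)[OF w] by (simp add: norm_mult)
        also have "\<dots> \<le> cmod (g w) + cmod (g w - a w * f w)"
          using norm_triangle_ineq4[of "g w" "g w - a w * f w"] by simp
        also have "cmod (g w) \<le> vnorm ?Y g"
          unfolding vnorm_closed_submodule by (rule C_mnorm_1_upper[OF gC w])
        finally show "cmod (a w) * f w \<le> vnorm ?Y g + e / 2" using a(3)[rule_format, OF w] by linarith
      qed
      then show "vnorm X y \<le> vnorm ?Y g + e"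
        using vnorm_le_diff[OF y ax] a(2) by linarith
    qed
  qed
  have rel_add: "rel (y + y') (g + g')" if r: "rel y g" "rel y' g'" for y g y' g'
    unfolding rel_def
  proof (intro conjI allI impI)
    note c = rel_car[OF r(1)] rel_car[OF r(2)]
    show "y + y' \<in> car X" by (intro add_closed c)
    show "g + g' \<in> car ?Y" by (intro Y.add_closed c)
    fix e :: real assume e: "0 < e"
    obtain a where a: "a \<in> disk_algebra" "vnorm X (y - act X a x) < e / 2" "\<forall>w\<in>circle. cmod (g w - a w * f w) < e / 2"
      using relE[OF r(1), of "e / 2"] e by auto
    obtain b where b: "b \<in> disk_algebra" "vnorm X (y' - act X b x) < e / 2" "\<forall>w\<in>circle. cmod (g' w - b w * f w) < e / 2"
      using relE[OF r(2), of "e / 2"] e by auto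
    have "y + y' - act X (a + b) x = (y - act X a x) + (y' - act X b x)"
      using act_add_left[OF a(1) b(1) x] by simp
    moreover have "vnorm X ((y - act X a x) + (y' - act X b x)) \<le> vnorm X (y - act X a x) + vnorm X (y' - act X b x)"
      by (intro vnorm_add diff_closed c act_closed a b x)
    ultimately have "vnorm X (y + y' - act X (a + b) x) \<le> vnorm X (y - act X a x) + vnorm X (y' - act X b x)"
      by (simp only:)
    moreover have "cmod ((g + g') w - (a + b) w * f w) < e" if w: "w \<in> circle" for w
    proof -
      have "(g + g') w - (a + b) w * f w = (g w - a w * f w) + (g' w - b w * f w)" by (simp add: algebra_simps)
      then have "cmod ((g + g') w - (a + b) w * f w) \<le> cmod (g w - a w * f w) + cmod (g' w - b w * f w)"
        by (simp only: norm_triangle_ineq)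
      then show ?thesis using a(3)[rule_format, OF w] b(3)[rule_format, OF w] by linarith
    qed
    ultimately show "\<exists>a\<in>disk_algebra. vnorm X (y + y' - act X a x) < e \<and> (\<forall>w\<in>circle. cmod ((g + g') w - a w * f w) < e)"
      using a(2) b(2) by (intro bexI[of _ "a + b"] conjI ballI disk_algebra_add a b) auto
  qed
  have rel_act: "rel (act X p y) (act ?Y p g)" if r: "rel y g" and p: "p \<in> disk_algebra" for y g p
    unfolding rel_def
  proof (intro conjI allI impI)
    note c = rel_car[OF r]
    show "act X p y \<in> car X" by (intro act_closed c p)
    show "act ?Y p g \<in> car ?Y" by (intro Y.act_closed c p)
    fix e :: real assume e: "0 < e"
    define B where "B = C_mnorm 1 (\<lambda>_ _. p)"
    have B: "cmod (p w) \<le> B" if "w \<in> circle" for w unfolding B_def by (rule disk_algebra_bound[OF p that])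
    have B0: "0 \<le> B" using order_trans[OF norm_ge_zero B[of 1]] by simp
    define d where "d = e / (B + 1)"
    have d: "0 < d" using e B0 by (simp add: d_def add_nonneg_pos)
    have Bd: "B * d < e" using e B0 by (simp add: d_def field_simps)
    obtain a where a: "a \<in> disk_algebra" "vnorm X (y - act X a x) < d" "\<forall>w\<in>circle. cmod (g w - a w * f w) < d"
      using relE[OF r d] by auto
    have ax: "act X a x \<in> car X" by (rule act_closed[OF a(1) x])
    have "act X p y - act X (p * a) x = act X p (y - act X a x)"
      using act_mult[OF p a(1) x] act_diff_right[OF p c(1) ax] by simp
    then have "vnorm X (act X p y - act X (p * a) x) \<le> B * vnorm X (y - act X a x)"
      unfolding B_def using vnorm_act_le[OF p diff_closed[OF c(1) ax]] by simp
    also have "\<dots> \<le> B * d" using a(2) B0 by (intro mult_left_mono) auto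
    finally have 1: "vnorm X (act X p y - act X (p * a) x) < e" using Bd by simp
    have 2: "cmod (act ?Y p g w - (p * a) w * f w) < e" if w: "w \<in> circle" for w
    proof -
      have "act ?Y p g w - (p * a) w * f w = p w * (g w - a w * f w)"
        by (simp add: closed_submodule_simps algebra_simps)
      then have "cmod (act ?Y p g w - (p * a) w * f w) = cmod (p w) * cmod (g w - a w * f w)" by (simp only: norm_mult)
      also have "\<dots> \<le> B * d" using a(3)[rule_format, OF w] B0 by (intro mult_mono B w) auto
      finally show ?thesis using Bd by simp
    qed
    show "\<exists>a\<in>disk_algebra. vnorm X (act X p y - act X a x) < e \<and> (\<forall>w\<in>circle. cmod (act ?Y p g w - a w * f w) < e)"
      using 1 2 by (intro bexI[of _ "p * a"] conjI ballI disk_algebra_mult p a) auto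
  qed
  \<comment> \<open>Subtraction is written through the constant function -1, for which
    \<open>rel\<close> is already known to be compatible. This relates \<open>g - g'\<close> to 0,
    so its norm is 0.\<close>
  have rel_unique: "g = g'" if r: "rel y g" "rel y g'" for y g g'
  proof -
    have m1: "circ (\<lambda>_. -1) \<in> disk_algebra" by (rule disk_algebra_const)
    note c = rel_car[OF r(1)] rel_car[OF r(2)]
    have "rel (y + act X (circ (\<lambda>_. -1)) y) (g + act ?Y (circ (\<lambda>_. -1)) g')"
      by (intro rel_add rel_act r m1)
    then have "rel 0 (g - g')"
      using act_const[OF c(1), of "-1"] scl_minus_1[OF c(1)] Y.act_const[OF c(4), of "-1"] Y.scl_minus_1[OF c(4)] by simp
    from rel_norm[OF this] have "vnorm ?Y (g - g') = 0" using vnorm_eq_0[OF zero_closed] by simp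
    then show ?thesis using Y.vnorm_eq_0[OF Y.diff_closed[OF c(2,4)]] by simp
  qed
  have small: "\<exists>k0. \<forall>k\<ge>k0. 1 / (real k + 1) < e" if "0 < e" for e
  proof -
    have "(\<lambda>k. 1 / (real k + 1)) \<longlonglongrightarrow> 0" by real_asymp
    from order_tendstoD(2)[OF this that] show ?thesis by (simp add: eventually_sequentially)
  qed
  have ex1: "\<exists>g. rel y g" if y: "y \<in> car X" for y
  proof -
    have "\<exists>a. \<forall>k::nat. a k \<in> disk_algebra \<and> vnorm X (y - act X (a k) x) < 1 / (real k + 1)"
    proof (rule choice, rule allI)
      fix k :: nat
      have "0 < 1 / (real k + 1)" by simp
      from gen[OF y this] show "\<exists>a. a \<in> disk_algebra \<and> vnorm X (y - act X a x) < 1 / (real k + 1)" by blast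
    qed
    then obtain a where a: "\<And>k. a k \<in> disk_algebra" "\<And>k. vnorm X (y - act X (a k) x) < 1 / (real k + 1)" by blast
    have ax: "act X (a k) x \<in> car X" for k by (rule act_closed[OF a(1) x])
    define s where "s = (\<lambda>k w. a k w * of_real (f w))"
    have diff: "cmod (s k w - s l w) < 1 / (real k + 1) + 1 / (real l + 1)" if w: "w \<in> circle" for k l w
    proof -
      have "s k w - s l w = (a k - a l) w * f w" by (simp add: s_def algebra_simps)
      then have "cmod (s k w - s l w) = cmod ((a k - a l) w) * f w"
        using f(2)[OF w] by (simp only: norm_mult norm_of_real abs_of_nonneg)
      also have "\<dots> \<le> vnorm X (act X (a k - a l) x)"
        by (intro fle disk_algebra_diff a w)
      also have "\<dots> = vnorm X (act X (a k) x - act X (a l) x)" by (simp add: act_diff_left a(1) x)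
      also have "\<dots> \<le> vnorm X (act X (a k) x - y) + vnorm X (y - act X (a l) x)"
        by (intro vnorm_diff_triangle ax y)
      also have "vnorm X (act X (a k) x - y) = vnorm X (y - act X (a k) x)" by (rule vnorm_commute[OF ax y])
      finally show ?thesis using a(2)[of k] a(2)[of l] by linarith
    qed
    obtain g where g: "g \<in> car ?Y" "uniform_limit circle s g sequentially"
    proof (rule closed_submodule_complete[where s=s and f=f])
      show "s k \<in> car ?Y" for k unfolding s_def by (rule closed_submodule_generated[OF f(1) a(1)])
      fix e :: real assume "0 < e"
      then obtain k0 where k0: "\<And>k. k \<ge> k0 \<Longrightarrow> 1 / (real k + 1) < e / 2" using small[of "e / 2"] by auto
      show "\<exists>N. \<forall>k\<ge>N. \<forall>l\<ge>N. \<forall>w\<in>circle. cmod (s k w - s l w) < e"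
      proof (intro exI allI impI ballI)
        fix k l w assume "k0 \<le> k" "k0 \<le> l" and w: "w \<in> circle"
        then show "cmod (s k w - s l w) < e" using k0[of k] k0[of l] diff[OF w, of k l] by linarith
      qed
    qed blast
    have "rel y g"
      unfolding rel_def
    proof (intro conjI y g allI impI)
      fix e :: real assume e: "0 < e"
      obtain k0 where k0: "\<And>k. k \<ge> k0 \<Longrightarrow> 1 / (real k + 1) < e" using small[OF e] by auto
      obtain k1 where k1: "\<And>k. k \<ge> k1 \<Longrightarrow> \<forall>w\<in>circle. dist (s k w) (g w) < e"
        using uniform_limitD[OF g(2) e] by (auto simp: eventually_sequentially)
      let ?k = "max k0 k1"
      show "\<exists>a\<in>disk_algebra. vnorm X (y - act X a x) < e \<and> (\<forall>w\<in>circle. cmod (g w - a w * f w) < e)"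
      proof (intro bexI conjI ballI)
        show "a ?k \<in> disk_algebra" by (rule a(1))
        show "vnorm X (y - act X (a ?k) x) < e" using a(2)[of ?k] k0[of ?k] by simp
        fix w assume w: "w \<in> circle"
        have "dist (s ?k w) (g w) < e" using k1[of ?k] w by simp
        then show "cmod (g w - a ?k w * f w) < e" by (simp add: s_def dist_norm norm_minus_commute)
      qed
    qed
    then show ?thesis by blast
  qed
  have ex2: "\<exists>y. rel y g" if g: "g \<in> car ?Y" for g
  proof -
    have "\<exists>a. \<forall>k::nat. a k \<in> disk_algebra \<and> (\<forall>w\<in>circle. cmod (g w - a k w * f w) < 1 / (real k + 1))"
    proof (rule choice, rule allI)
      fix k :: nat
      have "0 < 1 / (real k + 1)" by simp
      with g obtain a where "a \<in> disk_algebra" "\<And>w. w \<in> circle \<Longrightarrow> cmod (g w - a w * f w) < 1 / (real k + 1)"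
        by (rule closed_submoduleE) (rule that)
      then show "\<exists>a. a \<in> disk_algebra \<and> (\<forall>w\<in>circle. cmod (g w - a w * f w) < 1 / (real k + 1))" by blast
    qed
    then obtain a where a: "\<And>k. a k \<in> disk_algebra"
      "\<And>k w. w \<in> circle \<Longrightarrow> cmod (g w - a k w * f w) < 1 / (real k + 1)" by blast
    have ax: "act X (a k) x \<in> car X" for k by (rule act_closed[OF a(1) x])
    have diff: "vnorm X (act X (a k) x - act X (a l) x) \<le> 1 / (real k + 1) + 1 / (real l + 1)" for k l
    proof -
      have "vnorm X (act X (a k - a l) x) \<le> 1 / (real k + 1) + 1 / (real l + 1)"
      proof (rule fge)
        show "a k - a l \<in> disk_algebra" by (intro disk_algebra_diff a)
        show "0 < 1 / (real k + 1) + 1 / (real l + 1)" by (simp add: add_pos_pos)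
        fix w assume w: "w \<in> circle"
        have "cmod ((a k - a l) w) * f w = cmod ((a k - a l) w * f w)" using f(2)[OF w] by (simp add: norm_mult)
        also have "(a k - a l) w * f w = (g w - a l w * f w) - (g w - a k w * f w)" by (simp add: algebra_simps)
        also have "cmod \<dots> \<le> cmod (g w - a l w * f w) + cmod (g w - a k w * f w)" by (rule norm_triangle_ineq4)
        finally show "cmod ((a k - a l) w) * f w \<le> 1 / (real k + 1) + 1 / (real l + 1)"
          using a(2)[OF w, of k] a(2)[OF w, of l] by linarith
      qed
      then show ?thesis by (simp add: act_diff_left a(1) x)
    qed
    have "\<exists>y\<in>car X. (\<lambda>k. vnorm X (act X (a k) x - y)) \<longlonglongrightarrow> 0"
    proof (rule complete[OF ax])
      fix e :: real assume "0 < e"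
      then obtain k0 where k0: "\<And>k. k \<ge> k0 \<Longrightarrow> 1 / (real k + 1) < e / 2" using small[of "e / 2"] by auto
      show "\<exists>N. \<forall>k\<ge>N. \<forall>l\<ge>N. vnorm X (act X (a k) x - act X (a l) x) < e"
      proof (intro exI allI impI)
        fix k l assume "k0 \<le> k" "k0 \<le> l"
        then show "vnorm X (act X (a k) x - act X (a l) x) < e" using k0[of k] k0[of l] diff[of k l] by linarith
      qed
    qed
    then obtain y where y: "y \<in> car X" "(\<lambda>k. vnorm X (act X (a k) x - y)) \<longlonglongrightarrow> 0" by blast
    have "rel y g"
      unfolding rel_def
    proof (intro conjI y g allI impI)
      fix e :: real assume e: "0 < e"
      obtain k0 where k0: "\<And>k. k \<ge> k0 \<Longrightarrow> 1 / (real k + 1) < e" using small[OF e] by auto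
      obtain k1 where k1: "\<And>k. k \<ge> k1 \<Longrightarrow> vnorm X (act X (a k) x - y) < e"
        using order_tendstoD(2)[OF y(2) e] by (auto simp: eventually_sequentially)
      let ?k = "max k0 k1"
      show "\<exists>a\<in>disk_algebra. vnorm X (y - act X a x) < e \<and> (\<forall>w\<in>circle. cmod (g w - a w * f w) < e)"
      proof (intro bexI conjI ballI)
        show "a ?k \<in> disk_algebra" by (rule a(1))
        show "vnorm X (y - act X (a ?k) x) < e" using k1[of ?k] vnorm_commute[OF y(1) ax, of ?k] by simp
        fix w assume w: "w \<in> circle"
        show "cmod (g w - a ?k w * f w) < e" using a(2)[OF w, of ?k] k0[of ?k] by simp
      qed
    qed
    then show ?thesis by blast
  qed
  define T where "T = (\<lambda>y. SOME g. rel y g)"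
  have T: "rel y (T y)" if "y \<in> car X" for y
    unfolding T_def by (rule someI_ex[OF ex1[OF that]])
  show ?thesis
    unfolding A_isometric_def module_map_def
  proof (intro exI[of _ T] conjI ballI)
    show "T y \<in> car ?Y" if "y \<in> car X" for y by (rule rel_car[OF T[OF that]])
    show "T (y + y') = T y + T y'" if "y \<in> car X" "y' \<in> car X" for y y'
      by (rule rel_unique[OF T[OF add_closed[OF that]] rel_add[OF T T]]) (use that in auto)
    show "T (act X a y) = act ?Y a (T y)" if "a \<in> disk_algebra" "y \<in> car X" for a y
      by (rule rel_unique[OF T[OF act_closed[OF that]] rel_act[OF T]]) (use that in auto)
    show "vnorm ?Y (T y) = vnorm X y" if "y \<in> car X" for y by (rule rel_norm[OF T[OF that]])
    show "T ` car X = car ?Y"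
    proof (intro antisym subsetI)
      fix g assume "g \<in> T ` car X"
      then show "g \<in> car ?Y" using rel_car(2)[OF T] by blast
    next
      fix g assume "g \<in> car ?Y"
      then obtain y where y: "rel y g" using ex2 by blast
      then have "T y = g" by (rule rel_unique[OF T[OF rel_car(1)[OF y]]])
      then show "g \<in> T ` car X" using rel_car(1)[OF y] by blast
    qed
  qed
qed

end

lemma singly_generated_rigged_isometric:
  fixes X :: "'x::ab_group_add opmodule"
  assumes R: "rigged X" and S: "singly_generated X"
  shows "\<exists>f\<in>C_circle_nonneg. rigged (closed_submodule f) \<and> A_isometric X (closed_submodule f)"
proof -
  interpret left_operator_module X using R by (simp add: rigged_def)
  obtain I :: "('x factorization set \<times> 'x factorization) set" and le n \<phi> \<psi> where rig: "rigging X I le n \<phi> \<psi>"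
    using R unfolding rigged_def by blast
  obtain x where x: "x \<in> car X"
    and gen: "\<And>y e. y \<in> car X \<Longrightarrow> e > 0 \<Longrightarrow> \<exists>a\<in>disk_algebra. vnorm X (y - act X a x) < e"
    using S unfolding singly_generated_def by blast
  obtain f where f: "continuous_on circle f" "\<And>w. w \<in> circle \<Longrightarrow> 0 \<le> f w"
    "\<And>a w. a \<in> disk_algebra \<Longrightarrow> w \<in> circle \<Longrightarrow> cmod (a w) * f w \<le> vnorm X (act X a x)"
    "\<And>a c. a \<in> disk_algebra \<Longrightarrow> 0 < c \<Longrightarrow> (\<And>w. w \<in> circle \<Longrightarrow> cmod (a w) * f w \<le> c) \<Longrightarrow> vnorm X (act X a x) \<le> c"
    "rigged (closed_submodule f)"
    by (rule generator_norm[OF rig x gen]) blast+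
  have "A_isometric X (closed_submodule f)"
    by (rule isometric_closed_submodule[OF x gen f(1-4)]) blast+
  then show ?thesis using f by (intro bexI[of _ f]) (auto simp: C_circle_nonneg_def)
qed

section \<open>Fatou's theorem on radial limits\<close>

lemma cauchy_derivative_mean:
  assumes G: "in_A G" and z: "norm z < 1"
  shows "cmean (\<lambda>w. w / (w - z)\<^sup>2 * G w) = deriv G z"
proof -
  have Gc: "continuous_on (cball 0 1) G" and Gh: "G holomorphic_on ball 0 1"
    using G by (auto simp: in_A_def)
  have zb: "z \<in> ball 0 1" using z by simp
  have d: "(G has_field_derivative (1 / (2 * of_real pi * \<i>) * contour_integral (circlepath 0 1) (\<lambda>u. G u / (u - z)\<^sup>2))) (at z)"
    by (rule Cauchy_derivative_integral_circlepath(2)[OF Gc Gh zb])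
  have "continuous_on circle (\<lambda>u. G u / (u - z)\<^sup>2)"
    using z by (intro continuous_intros in_A_continuous_on_circle[OF G]) auto
  from contour_integral_unique[OF has_contour_integral_circle_cmean[OF this]]
  have "1 / (2 * of_real pi * \<i>) * contour_integral (circlepath 0 1) (\<lambda>u. G u / (u - z)\<^sup>2) = cmean (\<lambda>w. w * (G w / (w - z)\<^sup>2))"
    by simp
  with DERIV_imp_deriv[OF d] show ?thesis by simp
qed

text \<open>
  Subtracting the same kernel at the reflected point \<open>1 / cnj z\<close>, which integrates functions of
  the disk algebra to \<open>0\<close>, improves the decay of the kernel from \<open>1 / |w - z|\<^sup>2\<close> to the Poisson
  kernel divided by \<open>|w - z|\<close>.
\<close>

lemma norm_derivative_le_poisson:
  assumes G: "in_A G" and w0: "w0 \<in> circle" and r: "0 < r" "r < 1"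
    and q: "integrable circle_measure q" "\<And>w. w \<in> circle \<Longrightarrow> norm (G w) \<le> q w * norm (w - w0)" "\<And>w. w \<in> circle \<Longrightarrow> 0 \<le> q w"
  shows "norm (deriv G (of_real r * w0)) \<le> 4 * Re (herglotz q (of_real r * w0))"
proof -
  define z where "z = of_real r * w0"
  define z' where "z' = w0 / of_real r"
  have z: "norm z < 1" using w0 r by (simp add: z_def norm_mult)
  have z': "1 < norm z'" using w0 r by (simp add: z'_def norm_divide)
  have Gc: "continuous_on (cball 0 1) G" and Gh: "G holomorphic_on ball 0 1"
    using G by (auto simp: in_A_def)
  have Gcc: "continuous_on circle G" by (rule in_A_continuous_on_circle[OF G])
  have 1: "cmean (\<lambda>w. w / (w - z)\<^sup>2 * G w) = deriv G z" by (rule cauchy_derivative_mean[OF G z])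
  have 2: "cmean (\<lambda>w. w / (w - z')\<^sup>2 * G w) = 0"
  proof -
    have "cmean (\<lambda>w. w / (w - z')\<^sup>2 * G w) = (\<lambda>w. w / (w - z')\<^sup>2 * G w) 0"
      using z' by (intro mean_value_holomorphic) (auto intro!: continuous_intros holomorphic_intros Gc Gh)
    then show ?thesis by simp
  qed
  have i1: "integrable circle_measure (\<lambda>w. w / (w - z)\<^sup>2 * G w)"
    using z by (intro integrable_circle_cont continuous_intros Gcc) auto
  have i2: "integrable circle_measure (\<lambda>w. w / (w - z')\<^sup>2 * G w)"
    using z' by (intro integrable_circle_cont continuous_intros Gcc) auto
  have "deriv G z = cmean (\<lambda>w. w / (w - z)\<^sup>2 * G w - w / (w - z')\<^sup>2 * G w)"
    unfolding cmean_diff[OF i1 i2] 1 2 by simp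
  also have "norm \<dots> \<le> cmean (\<lambda>w. 4 * (poisson z w * q w))"
  proof (rule cmean_le_bound)
    show "integrable circle_measure (\<lambda>w. w / (w - z)\<^sup>2 * G w - w / (w - z')\<^sup>2 * G w)"
      using i1 i2 by auto
    show "integrable circle_measure (\<lambda>w. 4 * (poisson z w * q w))"
      by (intro integrable_mult_right integrable_circle_mult_cont_real q continuous_on_poisson z)
    fix w assume w: "w \<in> circle"
    have w1: "norm w = 1" using w by simp
    define D where "D = norm (w - z)"
    have D: "0 < D" using w z by (auto simp: D_def)
    \<comment> \<open>Reflection in the circle: \<open>|r w - w0| = |w - r w0|\<close> for
      unimodular \<open>w\<close> and \<open>w0\<close>, so the distances of \<open>w\<close> to
      \<open>z\<close> and to \<open>z'\<close> have the constant ratio \<open>r\<close>.\<close>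
    have refl: "norm (w - z') = D / r"
    proof -
      have "norm (of_real r * w - w0) = D"
      proof (rule power2_eq_imp_eq)
        have ww: "(Re w)\<^sup>2 + (Im w)\<^sup>2 = 1" "(Re w0)\<^sup>2 + (Im w0)\<^sup>2 = 1"
          using w w0 by (auto simp flip: cmod_power2)
        have "(norm (of_real r * w - w0))\<^sup>2 = r\<^sup>2 * ((Re w)\<^sup>2 + (Im w)\<^sup>2) - 2 * r * (Re w * Re w0 + Im w * Im w0) + ((Re w0)\<^sup>2 + (Im w0)\<^sup>2)"
          unfolding cmod_power2 by (simp add: power2_eq_square algebra_simps)
        also have "\<dots> = ((Re w)\<^sup>2 + (Im w)\<^sup>2) - 2 * r * (Re w * Re w0 + Im w * Im w0) + r\<^sup>2 * ((Re w0)\<^sup>2 + (Im w0)\<^sup>2)"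
          by (simp only: ww)
        also have "\<dots> = D\<^sup>2"
          unfolding D_def z_def cmod_power2 by (simp add: power2_eq_square algebra_simps)
        finally show "(norm (of_real r * w - w0))\<^sup>2 = D\<^sup>2" .
      qed (use D in auto)
      moreover have "w - z' = (of_real r * w - w0) / of_real r" using r by (simp add: z'_def field_simps)
      ultimately show ?thesis using r by (simp add: norm_divide)
    qed
    have ne: "w - z \<noteq> 0" "w - z' \<noteq> 0" using D refl r by (auto simp: D_def)
    have "w / (w - z)\<^sup>2 * G w - w / (w - z')\<^sup>2 * G w = w * G w * ((z - z') * ((w - z) + (w - z'))) / ((w - z)\<^sup>2 * (w - z')\<^sup>2)"
    proof -
      have "x / a\<^sup>2 * y - x / b\<^sup>2 * y = x * y * ((b - a) * (a + b)) / (a\<^sup>2 * b\<^sup>2)"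
        if "a \<noteq> 0" "b \<noteq> 0" for x y a b :: complex
        using that by (simp add: field_simps power2_eq_square)
      from this[OF ne, of w "G w"] show ?thesis by simp
    qed
    then have "norm (w / (w - z)\<^sup>2 * G w - w / (w - z')\<^sup>2 * G w)
        = norm (G w) * (norm (z - z') * norm ((w - z) + (w - z'))) / (D\<^sup>2 * (D / r)\<^sup>2)"
      by (simp only: norm_divide norm_mult norm_power refl D_def[symmetric] w1 mult_1_left)
    also have "\<dots> \<le> norm (G w) * ((1 - r\<^sup>2) / r * (D + D / r)) / (D\<^sup>2 * (D / r)\<^sup>2)"
    proof (intro divide_right_mono mult_left_mono mult_mono)
      have "z - z' = of_real (- ((1 - r\<^sup>2) / r)) * w0"
        using r by (simp add: z_def z'_def field_simps power2_eq_square)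
      then have "norm (z - z') = \<bar>- ((1 - r\<^sup>2) / r)\<bar>" using w0 by (simp only: norm_mult norm_of_real) simp
      then show "norm (z - z') \<le> (1 - r\<^sup>2) / r" using r by (simp add: power_le_one)
      show "norm ((w - z) + (w - z')) \<le> D + D / r"
        unfolding D_def using norm_triangle_ineq[of "w - z" "w - z'"] refl[unfolded D_def] by simp
    qed (use r D in \<open>auto simp: power_le_one\<close>)
    also have "\<dots> = norm (G w) * ((1 - r\<^sup>2) / D\<^sup>2) * ((1 + r) / D)"
      using r D by (simp add: field_simps power2_eq_square)
    also have "(1 - r\<^sup>2) / D\<^sup>2 = poisson z w"
      using w1 r w0 by (simp add: poisson_eq D_def z_def norm_mult)
    \<comment> \<open>The constant 4 collects a 2 from comparing \<open>norm (w - w0)\<close> with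
      \<open>D\<close> and a 2 from \<open>1 + r \<le> 2\<close>.\<close>
    also have "norm (G w) * poisson z w * ((1 + r) / D) \<le> (q w * (2 * D)) * poisson z w * (2 / D)"
    proof (intro mult_mono)
      have "norm (w - w0) \<le> 2 * D" unfolding D_def z_def using w1 w0 r by (intro norm_diff_radius) auto
      then have "q w * norm (w - w0) \<le> q w * (2 * D)" by (intro mult_left_mono q w)
      then show "norm (G w) \<le> q w * (2 * D)" using q(2)[OF w] by linarith
      show "(1 + r) / D \<le> 2 / D" using r D by (intro divide_right_mono) auto
    qed (use q(3)[OF w] D r poisson_nonneg[OF w1 z] in auto)
    also have "\<dots> = 4 * (poisson z w * q w)" using D by simp
    finally show "norm (w / (w - z)\<^sup>2 * G w - w / (w - z')\<^sup>2 * G w) \<le> 4 * (poisson z w * q w)" .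
  qed
  also have "\<dots> = 4 * Re (herglotz q z)"
    by (simp add: cmean_mult_left Re_herglotz[OF q(1) z])
  finally show ?thesis by (simp add: z_def)
qed

text \<open>After the first-order part at \<open>w0\<close> is removed, the quotient
  \<open>q\<close> is bounded on the circle and tends to 0 at \<open>w0\<close>. The derivative of
  the remainder is at most four times the Poisson integral of \<open>q\<close>, which tends to
  \<open>q w0 = 0\<close> along the radius.\<close>

lemma deriv_radial_limit:
  assumes G: "in_A G" and w0: "w0 \<in> circle"
    and lip: "\<And>w. w \<in> circle \<Longrightarrow> norm (G w - G w0) \<le> C * norm (w - w0)"
    and diff: "\<And>e. e > 0 \<Longrightarrow> \<exists>d>0. \<forall>w\<in>circle. norm (w - w0) < d \<longrightarrow> norm (G w - G w0 - b * (w - w0)) \<le> e * norm (w - w0)"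
  shows "((\<lambda>r. deriv G (of_real r * w0)) \<longlongrightarrow> b) (at_left 1)"
proof -
  define H where "H = (\<lambda>z. G z - G w0 - b * (z - w0))"
  have H: "in_A H" unfolding H_def using G by (auto simp: in_A_def intro!: continuous_intros holomorphic_intros)
  define q where "q = (\<lambda>w. norm (H w) / norm (w - w0))"
  have qw: "norm (H w) \<le> q w * norm (w - w0)" for w
    by (cases "w = w0") (simp_all add: q_def H_def)
  have q0: "0 \<le> q w" for w by (simp add: q_def)
  have qw0: "q w0 = 0" \<comment> \<open>because \<open>0 / 0 = 0\<close>\<close>
    by (simp add: q_def)
  have qi: "integrable circle_measure q"
  proof (rule CM.integrable_const_bound)
    show "AE w in circle_measure. norm (q w) \<le> \<bar>C\<bar> + norm b"
    proof (rule AE_I2)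
      fix w assume "w \<in> space circle_measure"
      then have w: "w \<in> circle" by (simp add: space_circle_measure)
      show "norm (q w) \<le> \<bar>C\<bar> + norm b"
      proof (cases "w = w0")
        case False
        have "norm (H w) \<le> norm (G w - G w0) + norm (b * (w - w0))" unfolding H_def by (rule norm_triangle_ineq4)
        also have "\<dots> \<le> \<bar>C\<bar> * norm (w - w0) + norm b * norm (w - w0)"
          using lip[OF w] mult_right_mono[OF abs_ge_self[of C] norm_ge_zero[of "w - w0"]] by (simp add: norm_mult)
        finally show ?thesis using False by (simp add: q_def divide_le_eq algebra_simps)
      qed (simp add: qw0)
    qed
    have "H \<in> borel_measurable circle_measure"
      by (rule borel_measurable_circle_measure_cont[OF in_A_continuous_on_circle[OF H]])
    moreover have "(\<lambda>w. w - w0) \<in> borel_measurable circle_measure"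
      by (rule borel_measurable_circle_measure_cont) (intro continuous_intros)
    ultimately show "q \<in> borel_measurable circle_measure" unfolding q_def by measurable
  qed
  have dH: "deriv G (of_real r * w0) - b = deriv H (of_real r * w0)" if "r \<in> {0<..<1}" for r
  proof -
    have "of_real r * w0 \<in> ball 0 1" using that w0 by (simp add: norm_mult)
    then have "(G has_field_derivative deriv G (of_real r * w0)) (at (of_real r * w0))"
      using G by (intro holomorphic_derivI[of _ "ball 0 1"]) (auto simp: in_A_def)
    then have "(H has_field_derivative deriv G (of_real r * w0) - b) (at (of_real r * w0))"
      unfolding H_def by (auto intro!: derivative_eq_intros)
    then show ?thesis by (simp add: DERIV_imp_deriv)
  qed
  have "((\<lambda>r. deriv G (of_real r * w0) - b) \<longlongrightarrow> 0) (at_left 1)"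
  proof (rule tendstoI)
    fix e :: real assume e: "0 < e"
    \<comment> \<open>The bound \<open>e / 8\<close> becomes \<open>e / 2\<close> after the factor
      4, which leaves room for the far part of the Poisson integral.\<close>
    obtain d where d: "0 < d" "\<And>w. w \<in> circle \<Longrightarrow> norm (w - w0) < d \<Longrightarrow> norm (H w) \<le> e / 8 * norm (w - w0)"
      using diff[of "e / 8"] e unfolding H_def by auto
    have qd: "\<bar>q w - q w0\<bar> \<le> e / 8" if "w \<in> circle" "norm (w - w0) < d" for w
      using d(2)[OF that] e by (cases "w = w0") (auto simp: qw0 q_def divide_le_eq)
    define A where "A = cmean (\<lambda>w. \<bar>q w\<bar>) + \<bar>q w0\<bar>"
    have "((\<lambda>r. 4 * (e / 8 + 8 * (1 - r) / d\<^sup>2 * A)) \<longlongrightarrow> 4 * (e / 8 + 8 * (1 - 1) / d\<^sup>2 * A)) (at_left 1)"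
      by (intro tendsto_intros) (use d in auto)
    then have "eventually (\<lambda>r. 4 * (e / 8 + 8 * (1 - r) / d\<^sup>2 * A) < e) (at_left 1)"
      by (rule order_tendstoD) (use e in auto)
    moreover have "eventually (\<lambda>r::real. r \<in> {0<..<1}) (at_left 1)"
      by (rule eventually_at_left_real) simp
    ultimately show "eventually (\<lambda>r. dist (deriv G (of_real r * w0) - b) 0 < e) (at_left 1)"
    proof eventually_elim
      case (elim r)
      then have r: "0 < r" "r < 1" by auto
      define T where "T = 8 * (1 - r) / d\<^sup>2 * A"
      have "norm (deriv H (of_real r * w0)) \<le> 4 * Re (herglotz q (of_real r * w0))"
        by (rule norm_derivative_le_poisson[OF H w0 r qi qw q0])
      moreover have "\<bar>Re (herglotz q (of_real r * w0)) - q w0\<bar> \<le> e / 8 + T"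
        unfolding A_def T_def using r e by (intro herglotz_radial_approx[OF qi w0 _ _ d(1) qd]) auto
      moreover have "4 * (e / 8 + T) < e" using elim(1) by (simp only: T_def)
      ultimately have "norm (deriv H (of_real r * w0)) < e" by (simp add: qw0 abs_le_iff)
      then show ?case using dH[OF elim(2)] by simp
    qed
  qed
  then show ?thesis by (rule LIM_zero_cancel)
qed

section \<open>Parseval's identity and convergence of the dilations\<close>

lemma cmean_sums:
  fixes f :: "nat \<Rightarrow> complex \<Rightarrow> complex"
  assumes f: "\<And>n. continuous_on circle (f n)" and M: "\<And>n w. w \<in> circle \<Longrightarrow> norm (f n w) \<le> M n" and s: "summable M"
  shows "(\<lambda>n. cmean (f n)) sums cmean (\<lambda>w. \<Sum>n. f n w)"
proof -
  have fi: "integrable circle_measure (f n)" for n by (rule integrable_circle_cont[OF f])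
  have "(\<lambda>n. integral\<^sup>L circle_measure (f n)) sums (LINT w|circle_measure. (\<Sum>n. f n w))"
  proof (rule sums_integral[OF fi])
    show "AE w in circle_measure. summable (\<lambda>n. norm (f n w))"
      using M by (intro AE_I2 summable_comparison_test'[OF s]) (auto simp: space_circle_measure)
    have "(LINT w|circle_measure. norm (f n w)) \<le> M n * (2 * pi)" for n
    proof -
      have "(LINT w|circle_measure. norm (f n w)) \<le> (LINT w|circle_measure. M n)"
        using fi M by (intro integral_mono integrable_norm) (auto simp: space_circle_measure)
      then show ?thesis by (simp add: space_circle_measure measure_circle_measure mult.commute)
    qed
    then show "summable (\<lambda>n. LINT w|circle_measure. norm (f n w))"
      by (intro summable_comparison_test'[OF summable_mult2[OF s, of "2 * pi"]]) auto
  qed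
  then show ?thesis unfolding cmean_def by (rule sums_scaleR_right)
qed

lemma cmean_cnj: "cmean (\<lambda>w. cnj (g w)) = cnj (cmean g)"
  by (simp add: cmean_def)

lemma cmean_monomial: "cmean (\<lambda>w. w ^ n * cnj w ^ m) = (if n = m then 1 else 0)"
proof -
  have pos: "cmean (\<lambda>w. w ^ n * cnj w ^ m) = 0 ^ (n - m)" if "m \<le> n" for n m
  proof -
    have "cmean (\<lambda>w. w ^ n * cnj w ^ m) = cmean (\<lambda>w. w ^ (n - m))"
    proof (rule cmean_cong)
      fix w assume "w \<in> circle"
      then have "w * cnj w = 1" using complex_norm_square[of w] by simp
      then have "(w * cnj w) ^ m = 1" by simp
      then have "w ^ (n - m) * (w ^ m * cnj w ^ m) = w ^ (n - m)" by (simp only: power_mult_distrib mult_1_right)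
      moreover have "w ^ n = w ^ (n - m) * w ^ m" using that by (simp flip: power_add)
      ultimately show "w ^ n * cnj w ^ m = w ^ (n - m)" by (simp only: mult.assoc)
    qed
    also have "\<dots> = 0 ^ (n - m)"
      by (rule mean_value_holomorphic) (auto intro!: continuous_intros holomorphic_intros)
    finally show ?thesis .
  qed
  show ?thesis
  proof (cases "m \<le> n")
    case True
    then show ?thesis using pos[OF True] by auto
  next
    case False
    have "cmean (\<lambda>w. w ^ n * cnj w ^ m) = cnj (cmean (\<lambda>w. w ^ m * cnj w ^ n))"
      unfolding cmean_cnj[symmetric] by (simp add: mult.commute)
    also have "\<dots> = 0" using pos[of n m] False by (simp add: power_0_left)
    finally show ?thesis using False by simp
  qed
qed

text \<open>Absolute summability of the coefficients makes the series converge uniformly on the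
  circle, so \<open>G * cnj G\<close> can be integrated term by term; the mean of
  \<open>G w * cnj w ^ m\<close> is the coefficient \<open>c m\<close>.\<close>

lemma parseval_circle:
  assumes c: "summable (\<lambda>n. norm (c n))"
  shows "(\<lambda>n. (norm (c n))\<^sup>2) sums cmean (\<lambda>w. (norm (\<Sum>n. c n * w ^ n))\<^sup>2)"
proof -
  define G where "G = (\<lambda>w. \<Sum>n. c n * w ^ n)"
  have bnd: "norm (c n * w ^ n) \<le> norm (c n)" if "w \<in> circle" for n w
    using that by (simp add: norm_mult norm_power)
  have sm: "summable (\<lambda>n. c n * w ^ n)" if "w \<in> circle" for w
    by (rule summable_comparison_test'[OF c]) (use bnd[OF that] in auto)
  have Gc: "continuous_on circle G"
  proof (rule uniform_limit_theorem)
    show "uniform_limit circle (\<lambda>N w. \<Sum>n<N. c n * w ^ n) G sequentially"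
      unfolding G_def by (rule Weierstrass_m_test[OF bnd c])
  qed (auto intro!: always_eventually continuous_intros)
  have GB: "norm (G w) \<le> (\<Sum>n. norm (c n))" if "w \<in> circle" for w
    using summable_norm[of "\<lambda>n. c n * w ^ n"] c that by (simp add: G_def norm_mult norm_power)
  have coeff: "cmean (\<lambda>w. G w * cnj w ^ m) = c m" for m
  proof -
    have "(\<lambda>n. cmean (\<lambda>w. c n * w ^ n * cnj w ^ m)) sums cmean (\<lambda>w. \<Sum>n. c n * w ^ n * cnj w ^ m)"
      by (rule cmean_sums[OF _ _ c]) (auto intro!: continuous_intros simp: norm_mult norm_power)
    moreover have "cmean (\<lambda>w. \<Sum>n. c n * w ^ n * cnj w ^ m) = cmean (\<lambda>w. G w * cnj w ^ m)"
      by (rule cmean_cong) (simp add: G_def suminf_mult2[OF sm])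
    moreover have "cmean (\<lambda>w. c n * w ^ n * cnj w ^ m) = (if n = m then c n else 0)" for n
      using cmean_mult_left[of "c n" "\<lambda>w. w ^ n * cnj w ^ m"] by (simp add: mult.assoc cmean_monomial)
    ultimately have "(\<lambda>n. if n = m then c n else 0) sums cmean (\<lambda>w. G w * cnj w ^ m)" by simp
    then show ?thesis using sums_single[of m c] sums_unique2 by blast
  qed
  have "(\<lambda>m. cmean (\<lambda>w. cnj (c m) * (G w * cnj w ^ m))) sums cmean (\<lambda>w. \<Sum>m. cnj (c m) * (G w * cnj w ^ m))"
  proof (rule cmean_sums)
    show "continuous_on circle (\<lambda>w. cnj (c n) * (G w * cnj w ^ n))" for n
      by (intro continuous_intros Gc)
    show "norm (cnj (c n) * (G w * cnj w ^ n)) \<le> norm (c n) * (\<Sum>n. norm (c n))" if "w \<in> circle" for n w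
      using GB[OF that] that by (simp add: norm_mult norm_power mult_left_mono)
    show "summable (\<lambda>n. norm (c n) * (\<Sum>n. norm (c n)))" by (rule summable_mult2[OF c])
  qed
  moreover have "cmean (\<lambda>w. cnj (c m) * (G w * cnj w ^ m)) = of_real ((norm (c m))\<^sup>2)" for m
    by (simp only: cmean_mult_left coeff) (simp only: complex_norm_square mult.commute)
  moreover have "cmean (\<lambda>w. \<Sum>m. cnj (c m) * (G w * cnj w ^ m)) = of_real (cmean (\<lambda>w. (norm (G w))\<^sup>2))"
  proof -
    have "cmean (\<lambda>w. \<Sum>m. cnj (c m) * (G w * cnj w ^ m)) = cmean (\<lambda>w. of_real ((norm (G w))\<^sup>2))"
    proof (rule cmean_cong)
      fix w assume w: "w \<in> circle"
      have "(\<lambda>m. cnj (c m * w ^ m)) sums cnj (G w)"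
        unfolding sums_cnj G_def by (rule summable_sums[OF sm[OF w]])
      from sums_mult[OF this, of "G w"]
      have "(\<lambda>m. cnj (c m) * (G w * cnj w ^ m)) sums (G w * cnj (G w))" by (simp add: mult_ac)
      then show "(\<Sum>m. cnj (c m) * (G w * cnj w ^ m)) = of_real ((norm (G w))\<^sup>2)"
        unfolding complex_norm_square by (rule sums_unique[symmetric])
    qed
    also have "\<dots> = of_real (cmean (\<lambda>w. (norm (G w))\<^sup>2))"
      by (simp add: cmean_def scaleR_conv_of_real del: of_real_power)
    finally show ?thesis .
  qed
  ultimately have "(\<lambda>m. of_real ((norm (c m))\<^sup>2)) sums (of_real (cmean (\<lambda>w. (norm (G w))\<^sup>2)) :: complex)" by simp
  then show ?thesis unfolding sums_of_real_iff G_def .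
qed

text \<open>Coefficientwise this is \<open>(r^n - s^n)^2 \<le> (r^n)^2 - (s^n)^2\<close> for
  \<open>s \<le> r\<close>. It turns convergence of the increasing square means into a Cauchy
  property of the dilations.\<close>

lemma radial_L2_diff_le:
  assumes hol: "\<phi> holomorphic_on ball 0 1" and r: "0 \<le> s" "s \<le> r" "r < 1"
  shows "cmean (\<lambda>w. (norm (\<phi> (of_real r * w) - \<phi> (of_real s * w)))\<^sup>2)
      \<le> cmean (\<lambda>w. (norm (\<phi> (of_real r * w)))\<^sup>2) - cmean (\<lambda>w. (norm (\<phi> (of_real s * w)))\<^sup>2)"
proof -
  define a where "a = (\<lambda>n. (deriv ^^ n) \<phi> 0 / fact n)"
  have ps: "(\<lambda>n. a n * z ^ n) sums \<phi> z" if "norm z < 1" for z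
    using holomorphic_power_series[OF hol, of z] that by (simp add: a_def)
  have sa: "summable (\<lambda>n. norm (a n * of_real \<rho> ^ n))" if "0 \<le> \<rho>" "\<rho> < 1" for \<rho> :: real
  proof (rule powser_insidea)
    have "norm (of_real ((1 + \<rho>) / 2) :: complex) < 1" using that unfolding norm_of_real by simp
    from sums_summable[OF ps[OF this]] show "summable (\<lambda>n. a n * of_real ((1 + \<rho>) / 2) ^ n)" .
    show "norm (of_real \<rho> :: complex) < norm (of_real ((1 + \<rho>) / 2) :: complex)"
      using that unfolding norm_of_real by simp
  qed
  have P: "(\<lambda>n. (norm (a n * of_real \<rho> ^ n))\<^sup>2) sums cmean (\<lambda>w. (norm (\<phi> (of_real \<rho> * w)))\<^sup>2)"
    if "0 \<le> \<rho>" "\<rho> < 1" for \<rho> :: real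
  proof -
    have "cmean (\<lambda>w. (norm (\<Sum>n. a n * of_real \<rho> ^ n * w ^ n))\<^sup>2) = cmean (\<lambda>w. (norm (\<phi> (of_real \<rho> * w)))\<^sup>2)"
    proof (rule cmean_cong)
      fix w assume "w \<in> circle"
      then have "norm (of_real \<rho> * w) < 1" using that by (simp add: norm_mult)
      from sums_unique[OF ps[OF this]]
      show "(norm (\<Sum>n. a n * of_real \<rho> ^ n * w ^ n))\<^sup>2 = (norm (\<phi> (of_real \<rho> * w)))\<^sup>2"
        by (simp add: power_mult_distrib mult.assoc)
    qed
    then show ?thesis using parseval_circle[OF sa[OF that]] by simp
  qed
  have s1: "s < 1" and r0: "0 \<le> r" using r by auto
  define c where "c = (\<lambda>n. a n * of_real r ^ n - a n * of_real s ^ n)"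
  have "summable (\<lambda>n. norm (c n))"
    by (rule summable_comparison_test'[OF summable_add[OF sa[OF r0 r(3)] sa[OF r(1) s1]]])
       (simp add: c_def norm_triangle_ineq4)
  note Q = parseval_circle[OF this]
  have "cmean (\<lambda>w. (norm (\<Sum>n. c n * w ^ n))\<^sup>2) = cmean (\<lambda>w. (norm (\<phi> (of_real r * w) - \<phi> (of_real s * w)))\<^sup>2)"
  proof (rule cmean_cong)
    fix w assume "w \<in> circle"
    then have "norm (of_real r * w) < 1" "norm (of_real s * w) < 1" using r s1 by (simp_all add: norm_mult)
    from sums_unique[OF sums_diff[OF ps[OF this(1)] ps[OF this(2)]]]
    show "(norm (\<Sum>n. c n * w ^ n))\<^sup>2 = (norm (\<phi> (of_real r * w) - \<phi> (of_real s * w)))\<^sup>2"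
      by (simp add: c_def power_mult_distrib algebra_simps)
  qed
  with Q have Q': "(\<lambda>n. (norm (c n))\<^sup>2) sums cmean (\<lambda>w. (norm (\<phi> (of_real r * w) - \<phi> (of_real s * w)))\<^sup>2)" by simp
  show ?thesis
  proof (rule sums_le[OF _ Q' sums_diff[OF P[OF r0 r(3)] P[OF r(1) s1]]])
    fix n
    have m: "0 \<le> s ^ n" "s ^ n \<le> r ^ n" using r by (auto intro: power_mono)
    have "c n = a n * of_real (r ^ n - s ^ n)" by (simp add: c_def algebra_simps)
    then have "norm (c n) = norm (a n) * (r ^ n - s ^ n)" using m by (simp only: norm_mult norm_of_real)
    then have "(norm (c n))\<^sup>2 = (norm (a n))\<^sup>2 * (r ^ n - s ^ n)\<^sup>2" by (simp add: power_mult_distrib)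
    also have "\<dots> \<le> (norm (a n))\<^sup>2 * ((r ^ n)\<^sup>2 - (s ^ n)\<^sup>2)"
    proof (rule mult_left_mono)
      have "s ^ n * s ^ n \<le> r ^ n * s ^ n" using m by (intro mult_right_mono)
      then show "(r ^ n - s ^ n)\<^sup>2 \<le> (r ^ n)\<^sup>2 - (s ^ n)\<^sup>2" by (simp add: power2_eq_square algebra_simps)
    qed simp
    also have "\<dots> = (norm (a n * of_real r ^ n))\<^sup>2 - (norm (a n * of_real s ^ n))\<^sup>2"
      using r r0 by (simp add: norm_mult norm_power power_mult_distrib algebra_simps)
    finally show "(norm (c n))\<^sup>2 \<le> (norm (a n * of_real r ^ n))\<^sup>2 - (norm (a n * of_real s ^ n))\<^sup>2" .
  qed
qed

text \<open>For bounded \<open>\<phi>\<close> the square means \<open>N\<close> increase to a finite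
  limit, so the dilations are Cauchy in L2. Passing to L1 uses
  \<open>t \<le> \<eta> / 2 + t^2 / (2 * \<eta>)\<close>; the choice
  \<open>\<eta> = e / (2 * pi)\<close> undoes the normalisation of the mean.\<close>

lemma radial_L1_cauchy:
  assumes hol: "\<phi> holomorphic_on ball 0 1" and M: "\<And>z. z \<in> ball 0 1 \<Longrightarrow> norm (\<phi> z) \<le> M"
    and r: "\<And>k::nat. 0 \<le> r k" "\<And>k. r k < 1" "incseq r" and e: "0 < e"
  shows "\<exists>N. \<forall>i\<ge>N. \<forall>j\<ge>N. (LINT w|circle_measure. norm (\<phi> (of_real (r i) * w) - \<phi> (of_real (r j) * w))) < e"
proof -
  define N where "N = (\<lambda>k. cmean (\<lambda>w. (norm (\<phi> (of_real (r k) * w)))\<^sup>2))"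
  have rb: "of_real (r k) * w \<in> ball 0 1" if "w \<in> circle" for k w
    using that r(1)[of k] r(2)[of k] by (simp add: norm_mult)
  have c: "continuous_on circle (\<lambda>w. \<phi> (of_real (r k) * w))" for k
    using in_A_continuous_on_circle[OF in_A_dilate[OF hol r(1) r(2)]] .
  have mono: "N i \<le> N j" if "i \<le> j" for i j
  proof -
    have "cmean (\<lambda>_. 0) \<le> cmean (\<lambda>w. (norm (\<phi> (of_real (r j) * w) - \<phi> (of_real (r i) * w)))\<^sup>2)"
      by (intro cmean_mono integrable_circle_cont continuous_intros c) auto
    also have "\<dots> \<le> N j - N i"
      unfolding N_def using that r by (intro radial_L2_diff_le[OF hol]) (auto simp: incseq_def)
    finally show ?thesis by (simp add: cmean_const)
  qed
  have "N k \<le> M\<^sup>2" for k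
  proof -
    have "N k \<le> cmean (\<lambda>_. M\<^sup>2)" unfolding N_def
      by (intro cmean_mono integrable_circle_cont continuous_intros c power_mono M rb) auto
    then show ?thesis by (simp add: cmean_const)
  qed
  then have "Cauchy N"
    using incseq_convergent[of N "M\<^sup>2"] mono by (metis LIMSEQ_imp_Cauchy incseq_def)
  moreover define \<eta> where "\<eta> = e / (2 * pi)"
  have \<eta>: "0 < \<eta>" using e by (simp add: \<eta>_def)
  ultimately obtain K where K: "\<And>i j. i \<ge> K \<Longrightarrow> j \<ge> K \<Longrightarrow> norm (N i - N j) < \<eta>\<^sup>2"
    using CauchyD[of N "\<eta>\<^sup>2"] by (metis zero_less_power)
  have main: "(LINT w|circle_measure. norm (\<phi> (of_real (r j) * w) - \<phi> (of_real (r i) * w))) < e"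
    if ij: "K \<le> i" "i \<le> j" for i j
  proof -
    let ?g = "\<lambda>w. norm (\<phi> (of_real (r j) * w) - \<phi> (of_real (r i) * w))"
    have gc: "continuous_on circle ?g" by (intro continuous_intros c)
    have "cmean (\<lambda>w. (?g w)\<^sup>2) \<le> N j - N i"
      unfolding N_def using ij r by (intro radial_L2_diff_le[OF hol]) (auto simp: incseq_def)
    also have "\<dots> < \<eta>\<^sup>2" using K[of j i] ij by (simp add: abs_less_iff)
    finally have sq: "cmean (\<lambda>w. (?g w)\<^sup>2) < \<eta>\<^sup>2" .
    have "cmean ?g \<le> cmean (\<lambda>w. \<eta> / 2 + 1 / (2 * \<eta>) * (?g w)\<^sup>2)"
    proof (rule cmean_mono)
      fix w
      have "\<eta> / 2 + 1 / (2 * \<eta>) * (?g w)\<^sup>2 - ?g w = (?g w - \<eta>)\<^sup>2 / (2 * \<eta>)"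
        using \<eta> by (simp add: field_simps power2_eq_square)
      moreover have "0 \<le> (?g w - \<eta>)\<^sup>2 / (2 * \<eta>)" using \<eta> by simp
      ultimately show "?g w \<le> \<eta> / 2 + 1 / (2 * \<eta>) * (?g w)\<^sup>2" by linarith
    qed (intro integrable_circle_cont continuous_intros gc)+
    also have "\<dots> = \<eta> / 2 + 1 / (2 * \<eta>) * cmean (\<lambda>w. (?g w)\<^sup>2)"
    proof -
      have "cmean (\<lambda>w. \<eta> / 2 + 1 / (2 * \<eta>) * (?g w)\<^sup>2) = cmean (\<lambda>_. \<eta> / 2) + cmean (\<lambda>w. 1 / (2 * \<eta>) * (?g w)\<^sup>2)"
        by (intro cmean_add integrable_mult_right integrable_circle_cont continuous_intros gc)
      then show ?thesis by (simp only: cmean_const cmean_mult_left)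
    qed
    also have "\<dots> < \<eta> / 2 + 1 / (2 * \<eta>) * \<eta>\<^sup>2"
      using sq \<eta> by (intro add_strict_left_mono mult_strict_left_mono) auto
    also have "\<dots> = \<eta>" using \<eta> by (simp add: power2_eq_square)
    finally have "cmean ?g < \<eta>" .
    then show ?thesis by (simp add: cmean_def \<eta>_def field_simps)
  qed
  show ?thesis
  proof (intro exI allI impI)
    fix i j assume "K \<le> i" "K \<le> j"
    then show "(LINT w|circle_measure. norm (\<phi> (of_real (r i) * w) - \<phi> (of_real (r j) * w))) < e"
      using main[of i j] main[of j i] by (cases "i \<le> j") (auto simp: norm_minus_commute)
  qed
qed

section \<open>Differentiability of the primitive along the circle and radial limits\<close>

lemma AE_not_negligible: "negligible N \<Longrightarrow> AE t in lborel. t \<notin> N"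
  by (metis AE_completion_iff AE_not_in negligible_iff_null_sets)

text \<open>The derivative from the left is the derivative from the right of the reflected function,
  and reflection maps negligible sets to negligible sets. The difference quotients are cleared to
  fit the definition of a derivative.\<close>

lemma AE_two_sided_derivative:
  fixes h :: "real \<Rightarrow> complex"
  assumes h: "\<And>a b. h integrable_on {a..b}"
  shows "AE t in lborel. \<forall>e>0. \<exists>d>0. \<forall>s. 0 < s \<and> s < d \<longrightarrow>
      norm (integral {t..t+s} h - s *\<^sub>R h t) \<le> e * s \<and> norm (integral {t-s..t} h - s *\<^sub>R h t) \<le> e * s"
proof -
  obtain N1 where N1: "negligible N1"
    "\<And>x e. x \<notin> N1 \<Longrightarrow> 0 < e \<Longrightarrow> \<exists>d>0. \<forall>s. 0 < s \<and> s < d \<longrightarrow>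
       norm (integral (cbox x (x + s *\<^sub>R One)) h /\<^sub>R s ^ DIM(real) - h x) < e"
    by (rule integrable_ccontinuous_explicit[of h]) (use h in auto)
  have hm: "(\<lambda>x. h (- x)) integrable_on cbox a b" for a b
    using h[of "- b" "- a"] Henstock_Kurzweil_Integration.integrable_reflect_real[where f=h and a="- b" and b="- a"] by simp
  obtain N2 where N2: "negligible N2"
    "\<And>x e. x \<notin> N2 \<Longrightarrow> 0 < e \<Longrightarrow> \<exists>d>0. \<forall>s. 0 < s \<and> s < d \<longrightarrow>
       norm (integral (cbox x (x + s *\<^sub>R One)) (\<lambda>x. h (- x)) /\<^sub>R s ^ DIM(real) - h (- x)) < e"
    by (rule integrable_ccontinuous_explicit[OF hm]) auto
  have "negligible (uminus ` N2)"
    by (rule negligible_differentiable_image_negligible[OF order_refl N2(1)]) (auto intro!: derivative_intros simp: differentiable_on_def)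
  have scale: "norm (I - s *\<^sub>R c) \<le> e * s" if "norm (I /\<^sub>R s - c) < e" "0 < s" for I c :: complex and s e :: real
  proof -
    have "I - s *\<^sub>R c = s *\<^sub>R (I /\<^sub>R s - c)" using that by (simp add: scaleR_diff_right)
    then have "norm (I - s *\<^sub>R c) = s * norm (I /\<^sub>R s - c)" using that by simp
    also have "\<dots> \<le> s * e" using that by (intro mult_left_mono) auto
    finally show ?thesis by (simp add: mult.commute)
  qed
  have "AE t in lborel. t \<notin> N1 \<and> t \<notin> uminus ` N2"
    using AE_not_negligible[OF N1(1)] AE_not_negligible[OF \<open>negligible (uminus ` N2)\<close>] by eventually_elim simp
  then show ?thesis
  proof eventually_elim
    case (elim t)
    show ?case
    proof (intro allI impI)
      fix e :: real assume e: "0 < e"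
      obtain d1 where d1: "0 < d1" "\<forall>s. 0 < s \<and> s < d1 \<longrightarrow>
          norm (integral (cbox t (t + s *\<^sub>R One)) h /\<^sub>R s ^ DIM(real) - h t) < e"
        using N1(2)[of t e] elim e by blast
      have "- t \<notin> N2" using elim by (metis image_eqI minus_minus)
      then obtain d2 where d2: "0 < d2" "\<forall>s. 0 < s \<and> s < d2 \<longrightarrow>
          norm (integral (cbox (- t) (- t + s *\<^sub>R One)) (\<lambda>x. h (- x)) /\<^sub>R s ^ DIM(real) - h (- (- t))) < e"
        using N2(2)[of "- t" e] e by blast
      show "\<exists>d>0. \<forall>s. 0 < s \<and> s < d \<longrightarrow>
          norm (integral {t..t+s} h - s *\<^sub>R h t) \<le> e * s \<and> norm (integral {t-s..t} h - s *\<^sub>R h t) \<le> e * s"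
      proof (intro exI[of _ "min d1 d2"] conjI allI impI)
        fix s assume s: "0 < s \<and> s < min d1 d2"
        have "norm (integral {t..t+s} h /\<^sub>R s - h t) < e" using d1(2)[rule_format, of s] s by simp
        then show "norm (integral {t..t+s} h - s *\<^sub>R h t) \<le> e * s" using s by (intro scale) auto
        have "integral {- t..- t + s} (\<lambda>x. h (- x)) = integral {t - s..t} h"
          using Henstock_Kurzweil_Integration.integral_reflect_real[where b=t and a="t - s" and f=h] by (simp add: add.commute)
        then have "norm (integral {t-s..t} h /\<^sub>R s - h t) < e" using d2(2)[rule_format, of s] s by simp
        then show "norm (integral {t-s..t} h - s *\<^sub>R h t) \<le> e * s" using s by (intro scale) auto
      qed (use d1 d2 in auto)
    qed
  qed
qed

text \<open>Since \<open>\<phi>\<close> is bounded, its primitive is Lipschitz and extends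
  continuously to the closed disk as \<open>G\<close>. Along the circle \<open>G\<close> is the
  indefinite integral of a bounded function \<open>h\<close>, hence differentiable at almost every
  angle; there the derivative of \<open>G\<close>, which is \<open>\<phi>\<close> inside the disk,
  has a radial limit. The dilations converging almost everywhere along a subsequence of radii serve
  to construct \<open>h\<close>; by themselves they say nothing about the full radius.\<close>

lemma fatou_radial_limits:
  assumes hol: "\<phi> holomorphic_on ball 0 1" and M: "\<And>z. z \<in> ball 0 1 \<Longrightarrow> norm (\<phi> z) \<le> M"
  shows "AE w in circle_measure. \<exists>l. ((\<lambda>r. \<phi> (of_real r * w)) \<longlongrightarrow> l) (at_left 1)"
proof -
  have M0: "0 \<le> M" using order_trans[OF norm_ge_zero M[of 0]] by simp
  obtain F where F: "\<And>z. z \<in> ball 0 1 \<Longrightarrow> (F has_field_derivative \<phi> z) (at z within ball 0 1)"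
    by (rule holomorphic_convex_primitive'[OF convex_ball open_ball hol]) blast
  have FL: "norm (F x - F y) \<le> M * norm (x - y)" if "x \<in> ball 0 1" "y \<in> ball 0 1" for x y
    by (rule field_differentiable_bound[OF convex_ball F M that])
  have "uniformly_continuous_on (ball 0 1) F"
    unfolding uniformly_continuous_on_def
  proof (intro allI impI)
    fix e :: real assume e: "0 < e"
    show "\<exists>d>0. \<forall>x\<in>ball 0 1. \<forall>x'\<in>ball 0 1. dist x' x < d \<longrightarrow> dist (F x') (F x) < e"
    proof (intro exI[of _ "e / (M + 1)"] conjI ballI impI)
      show "0 < e / (M + 1)" using e M0 by simp
      fix x x' :: complex assume x: "x \<in> ball 0 1" "x' \<in> ball 0 1" and d: "dist x' x < e / (M + 1)"
      have "dist (F x') (F x) \<le> M * dist x' x" unfolding dist_norm by (rule FL[OF x(2,1)])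
      also have "\<dots> \<le> M * (e / (M + 1))" using d M0 by (intro mult_left_mono) auto
      also have "\<dots> < e" using M0 e by (simp add: field_simps)
      finally show "dist (F x') (F x) < e" .
    qed
  qed
  then obtain G where G: "uniformly_continuous_on (closure (ball 0 1)) G" "\<And>x. x \<in> ball 0 1 \<Longrightarrow> F x = G x"
    by (rule uniformly_continuous_on_extension_on_closure) blast
  have Gc: "continuous_on (cball 0 1) G" using uniformly_continuous_imp_continuous[OF G(1)] by simp
  have dG: "(G has_field_derivative \<phi> z) (at z)" if z: "z \<in> ball 0 1" for z
  proof (rule has_field_derivative_transform_within_open[OF _ open_ball z G(2)])
    show "(F has_field_derivative \<phi> z) (at z)" using F[OF z] at_within_open[OF z open_ball] by simp
  qed
  have GA: "in_A G"
    unfolding in_A_def using Gc dG by (auto simp: holomorphic_on_open intro!: exI)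
  have Glim: "((\<lambda>r. G (of_real r * x)) \<longlongrightarrow> G x) (at_left 1)" if x: "norm x \<le> 1" for x
  proof -
    have "continuous_on {0..1} (\<lambda>r. G (complex_of_real r * x))"
    proof (rule continuous_on_compose2[OF Gc])
      show "(\<lambda>r. complex_of_real r * x) ` {0..1} \<subseteq> cball 0 1"
        using x by (auto simp: norm_mult intro!: mult_le_one)
    qed (intro continuous_intros)
    then have "((\<lambda>r. G (complex_of_real r * x)) \<longlongrightarrow> G (complex_of_real 1 * x)) (at 1 within {0..1})"
      unfolding continuous_on_def by (rule bspec) simp
    moreover have "at_left (1::real) \<le> at 1 within {0..1}"
      unfolding at_within_Icc_at_left[OF zero_less_one] by simp
    ultimately show ?thesis by (simp add: filterlim_mono)
  qed
  have ev01: "eventually (\<lambda>r::real. r \<in> {0<..<1}) (at_left 1)" by (rule eventually_at_left_real) simp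
  have GL: "norm (G x - G y) \<le> M * norm (x - y)" if xy: "norm x \<le> 1" "norm y \<le> 1" for x y
  proof (rule tendsto_upperbound)
    show "((\<lambda>r. norm (G (of_real r * x) - G (of_real r * y))) \<longlongrightarrow> norm (G x - G y)) (at_left 1)"
      by (intro tendsto_intros Glim xy)
    show "eventually (\<lambda>r. norm (G (of_real r * x) - G (of_real r * y)) \<le> M * norm (x - y)) (at_left 1)"
      using ev01
    proof eventually_elim
      case (elim r)
      then have r: "0 < r" "r < 1" by auto
      have b: "of_real r * u \<in> ball 0 1" if "norm u \<le> 1" for u :: complex
      proof -
        have "r * norm u \<le> r * 1" using that r by (intro mult_left_mono) auto
        then have "r * norm u < 1" using r by linarith
        then show ?thesis using r by (simp add: norm_mult)
      qed
      have "norm (G (of_real r * x) - G (of_real r * y)) \<le> M * norm (of_real r * x - of_real r * y)"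
        using FL[OF b[OF xy(1)] b[OF xy(2)]] G(2)[OF b[OF xy(1)]] G(2)[OF b[OF xy(2)]] by simp
      also have "norm (of_real r * x - of_real r * y) = r * norm (x - y)"
        using r by (simp add: norm_mult flip: right_diff_distrib)
      also have "M * (r * norm (x - y)) \<le> M * (1 * norm (x - y))"
        using r M0 by (intro mult_left_mono mult_right_mono) auto
      finally show ?case by simp
    qed
  qed simp
  define r where "r = (\<lambda>k::nat. 1 - 1 / (real k + 2))"
  have r: "0 \<le> r k" "r k < 1" for k by (auto simp: r_def field_simps)
  have "incseq r" by (rule incseq_SucI) (simp add: r_def frac_le)
  have rlim: "r \<longlonglongrightarrow> 1" unfolding r_def by real_asymp
  have rlim': "filterlim r (at_left 1) sequentially" unfolding r_def by real_asymp
  have ci: "integrable circle_measure (\<lambda>w. \<phi> (of_real (r n) * w))" for n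
    using in_A_continuous_on_circle[OF in_A_dilate[OF hol r]] by (rule integrable_circle_cont)
  obtain \<rho> where \<rho>: "strict_mono \<rho>" "AE w in circle_measure. Cauchy (\<lambda>i. \<phi> (of_real (r (\<rho> i)) * w))"
    by (rule cauchy_L1_AE_cauchy_subseq[OF ci radial_L1_cauchy[OF hol M r \<open>incseq r\<close>]]) auto
  have R: "filterlim (\<lambda>i. r (\<rho> i)) (at_left 1) sequentially"
    using filterlim_compose[OF rlim' filterlim_subseq[OF \<rho>(1)]] .
  have R1: "(\<lambda>i. r (\<rho> i)) \<longlonglongrightarrow> 1"
    using LIMSEQ_subseq_LIMSEQ[OF rlim \<rho>(1)] by (simp add: o_def)
  have AEC: "AE t in lborel. t \<in> {0..<2*pi} \<longrightarrow> Cauchy (\<lambda>i. \<phi> (of_real (r (\<rho> i)) * cis t))"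
    using \<rho>(2) unfolding AE_circle_measure_iff .
  have rb: "of_real (r k) * cis t \<in> ball 0 1" for k t using r[of k] by (simp add: norm_mult)
  define p where "p = (\<lambda>i t. \<phi> (of_real (r (\<rho> i)) * cis t))"
  have pc: "continuous_on UNIV (p i)" for i
    unfolding p_def
    by (rule continuous_on_compose2[OF holomorphic_on_imp_continuous_on[OF hol]])
       (use rb in \<open>auto intro!: continuous_intros\<close>)
  have pM: "norm (p i t) \<le> M" for i t unfolding p_def by (intro M rb)
  have [measurable]: "p i \<in> borel_measurable borel" for i
    by (rule borel_measurable_continuous_onI[OF pc])
  define h0 where "h0 = (\<lambda>t. lim (\<lambda>i. p i t))"
  have [measurable]: "h0 \<in> borel_measurable borel"
    unfolding h0_def by (rule borel_measurable_lim_metric) measurable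
  have cis_m [measurable]: "cis \<in> borel_measurable borel"
    by (intro borel_measurable_continuous_onI continuous_intros)
  \<comment> \<open>The cut-off by \<open>M\<close> bounds \<open>h\<close> at the angles where the
    subsequence fails to converge and \<open>h0\<close> is arbitrary. The factor
    \<open>\<i> * cis t\<close> is the derivative of \<open>cis\<close>.\<close>
  define h where "h = (\<lambda>t. if t \<in> {0..2*pi} \<and> norm (h0 t) \<le> M then h0 t * (\<i> * cis t) else 0)"
  have [measurable]: "h \<in> borel_measurable borel" unfolding h_def by measurable
  have hM: "norm (h t) \<le> M" for t using M0 by (simp add: h_def norm_mult)
  have hsi: "set_integrable lborel {a..b} h" for a b
    unfolding set_integrable_def
    by (rule integrableI_bounded_set_indicator[where B = M]) (use hM in \<open>auto simp: emeasure_lborel_Icc_eq\<close>)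
  have hint: "h integrable_on {a..b}" for a b by (rule set_borel_integral_eq_integral(1)[OF hsi])

  have hlim: "(\<lambda>i. p i t) \<longlonglongrightarrow> h0 t" "norm (h0 t) \<le> M" if "Cauchy (\<lambda>i. p i t)" for t
  proof -
    show l: "(\<lambda>i. p i t) \<longlonglongrightarrow> h0 t"
      using that unfolding h0_def by (simp add: Cauchy_convergent_iff convergent_LIMSEQ_iff)
    show "norm (h0 t) \<le> M"
      by (rule tendsto_upperbound[OF tendsto_norm[OF l]]) (auto intro!: always_eventually pM)
  qed
  \<comment> \<open>The fundamental theorem of calculus holds on each circle of radius
    \<open>r (\<rho> i)\<close>; dominated convergence with bound \<open>M\<close> carries it to the
    unit circle.\<close>
  have Gint0: "G (cis t) - G 1 = integral {0..t} h" if t: "0 \<le> t" "t \<le> 2 * pi" for t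
  proof -
    define g where "g = (\<lambda>i s. p i s * (of_real (r (\<rho> i)) * (\<i> * cis s)))"
    have gc: "continuous_on UNIV (g i)" for i unfolding g_def by (intro continuous_intros pc)
    have [measurable]: "g i \<in> borel_measurable borel" for i
      by (rule borel_measurable_continuous_onI[OF gc])
    have ftc: "(g i has_integral G (of_real (r (\<rho> i)) * cis t) - G (of_real (r (\<rho> i)) * cis 0)) {0..t}" for i
    proof (rule fundamental_theorem_of_calculus[OF t(1)])
      fix s
      have "((\<lambda>s. of_real (r (\<rho> i)) * cis s) has_vector_derivative of_real (r (\<rho> i)) * (\<i> * cis s)) (at s within {0..t})"
        by (auto intro!: derivative_eq_intros simp: has_vector_derivative_def scaleR_conv_of_real algebra_simps)
      from field_vector_diff_chain_within[OF this DERIV_subset[OF dG[OF rb[of "\<rho> i" s]]]]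
      show "((\<lambda>s. G (of_real (r (\<rho> i)) * cis s)) has_vector_derivative g i s) (at s within {0..t})"
        by (simp add: o_def g_def p_def mult.commute)
    qed
    have gsi: "set_integrable lborel {0..t} (g i)" for i
      unfolding set_integrable_def using gc by (intro borel_integrable_compact) (auto intro: continuous_on_subset)
    have Ig: "(LINT s:{0..t}|lborel. g i s) = G (of_real (r (\<rho> i)) * cis t) - G (of_real (r (\<rho> i)))" for i
      using set_borel_integral_eq_integral(2)[OF gsi] integral_unique[OF ftc] by simp
    have "(\<lambda>i. LINT s:{0..t}|lborel. g i s) \<longlonglongrightarrow> (LINT s:{0..t}|lborel. h s)"
      unfolding set_lebesgue_integral_def
    proof (rule integral_dominated_convergence[where w = "\<lambda>s. indicator {0..t} s * M"])
      show "integrable lborel (\<lambda>s. indicat_real {0..t} s * M)"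
        by (intro integrable_mult_left integrable_real_indicator) (auto simp: emeasure_lborel_Icc_eq)
      show "AE s in lborel. (\<lambda>i. indicat_real {0..t} s *\<^sub>R g i s) \<longlonglongrightarrow> indicat_real {0..t} s *\<^sub>R h s"
        using AEC AE_lborel_singleton[of "2 * pi"]
      proof eventually_elim
        case (elim s)
        show ?case
        proof (cases "s \<in> {0..t}")
          case True
          then have "Cauchy (\<lambda>i. p i s)" using elim t by (auto simp: p_def)
          note l = hlim[OF this]
          have "(\<lambda>i. g i s) \<longlonglongrightarrow> h0 s * (of_real 1 * (\<i> * cis s))"
            unfolding g_def by (intro tendsto_intros l R1)
          then show ?thesis using True t l(2) by (simp add: h_def)
        qed simp
      qed
      show "AE s in lborel. norm (indicat_real {0..t} s *\<^sub>R g i s) \<le> indicat_real {0..t} s * M" for i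
      proof (rule AE_I2)
        fix s
        have "norm (g i s) = norm (p i s) * r (\<rho> i)" using r[of "\<rho> i"] by (simp add: g_def norm_mult)
        also have "\<dots> \<le> M * 1" using pM r[of "\<rho> i"] M0 by (intro mult_mono) auto
        finally show "norm (indicat_real {0..t} s *\<^sub>R g i s) \<le> indicat_real {0..t} s * M"
          by (simp add: indicator_def)
      qed
    qed measurable
    moreover have "(\<lambda>i. LINT s:{0..t}|lborel. g i s) \<longlonglongrightarrow> G (cis t) - G 1"
      unfolding Ig
      using filterlim_compose[OF Glim[of "cis t"] R] filterlim_compose[OF Glim[of 1] R]
      by (intro tendsto_diff) auto
    ultimately have "G (cis t) - G 1 = (LINT s:{0..t}|lborel. h s)" using LIMSEQ_unique by blast
    then show ?thesis using set_borel_integral_eq_integral(2)[OF hsi] by simp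
  qed
  have Gint: "G (cis b) - G (cis a) = integral {a..b} h" if ab: "0 \<le> a" "a \<le> b" "b \<le> 2 * pi" for a b
  proof -
    have "integral {0..a} h + integral {a..b} h = integral {0..b} h"
      by (rule Henstock_Kurzweil_Integration.integral_combine[OF ab(1,2) hint])
    then have "(G (cis a) - G 1) + integral {a..b} h = G (cis b) - G 1"
      using Gint0[of a] Gint0[of b] ab by simp
    then show ?thesis by (simp add: algebra_simps)
  qed
  have "AE t in lborel. t \<in> {0..<2*pi} \<longrightarrow> (\<exists>l. ((\<lambda>r. \<phi> (of_real r * cis t)) \<longlongrightarrow> l) (at_left 1))"
    using AEC AE_lborel_singleton[of 0] AE_two_sided_derivative[OF hint]
  proof eventually_elim
    case (elim t)
    show ?case
    proof
      assume "t \<in> {0..<2*pi}"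
      then have t: "0 < t" "t < 2 * pi" using elim(2) by auto
      have "Cauchy (\<lambda>i. p i t)" using elim(1) t by (simp add: p_def)
      note bl = hlim[OF this]
      define b where "b = h0 t"
      have bM: "norm b \<le> M" using bl(2) by (simp add: b_def)
      define w0 where "w0 = cis t"
      have w0: "w0 \<in> circle" "w0 \<noteq> 0" by (auto simp: w0_def)
      have ht: "h t = b * (\<i> * w0)" using t bl(2) by (simp add: h_def b_def w0_def)
      define \<beta> where "\<beta> = (\<lambda>y. G (cis y))"
      have d\<beta>: "(\<beta> has_derivative (\<lambda>s. s *\<^sub>R h t)) (at t)"
        unfolding has_derivative_at_alt
      proof (intro conjI allI impI bounded_linear_scaleR_left)
        fix e :: real assume "0 < e"
        with elim(3) obtain d where d: "0 < d" "\<And>s. 0 < s \<Longrightarrow> s < d \<Longrightarrow>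
          norm (integral {t..t+s} h - s *\<^sub>R h t) \<le> e * s \<and> norm (integral {t-s..t} h - s *\<^sub>R h t) \<le> e * s" by blast
        show "\<exists>d>0. \<forall>y. norm (y - t) < d \<longrightarrow> norm (\<beta> y - \<beta> t - (y - t) *\<^sub>R h t) \<le> e * norm (y - t)"
        proof (intro exI[of _ "min d (min t (2 * pi - t))"] conjI allI impI)
          fix y assume y: "norm (y - t) < min d (min t (2 * pi - t))"
          consider "y = t" | "t < y" | "y < t" by linarith
          then show "norm (\<beta> y - \<beta> t - (y - t) *\<^sub>R h t) \<le> e * norm (y - t)"
          proof cases
            case 2
            then have "\<beta> y - \<beta> t = integral {t..t + (y - t)} h" using Gint[of t y] t y by (simp add: \<beta>_def)
            then show ?thesis using d(2)[of "y - t"] 2 y by simp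
          next
            case 3
            then have "\<beta> t - \<beta> y = integral {t - (t - y)..t} h" using Gint[of y t] t y by (simp add: \<beta>_def)
            then have "norm (\<beta> t - \<beta> y - (t - y) *\<^sub>R h t) \<le> e * (t - y)" using d(2)[of "t - y"] 3 y by simp
            moreover have "\<beta> y - \<beta> t - (y - t) *\<^sub>R h t = - (\<beta> t - \<beta> y - (t - y) *\<^sub>R h t)"
              by (simp add: algebra_simps)
            ultimately show ?thesis using 3 by (simp only: norm_minus_cancel) simp
          qed simp
        qed (use d t in auto)
      qed
      \<comment> \<open>An angular coordinate around \<open>w0\<close>, defined in the plane so that
        the chain rule applies; on the circle \<open>cis (\<tau> w) = w\<close>.\<close>
      define \<tau> where "\<tau> = (\<lambda>w. t + Im (Ln (w / w0)))"
      have \<tau>0: "\<tau> w0 = t" using w0 by (simp add: \<tau>_def)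
      have "((\<lambda>w. Ln (w / w0)) has_field_derivative 1 / w0) (at w0)"
        using w0 by (auto intro!: derivative_eq_intros)
      then have "((\<lambda>w. Ln (w / w0)) has_derivative (\<lambda>v. 1 / w0 * v)) (at w0)"
        by (simp only: has_field_derivative_def)
      from bounded_linear.has_derivative[OF bounded_linear_Im this]
      have d\<tau>: "(\<tau> has_derivative (\<lambda>v. Im (1 / w0 * v))) (at w0)"
        unfolding \<tau>_def using has_derivative_add[OF has_derivative_const[of t]] by simp
      have "((\<beta> \<circ> \<tau>) has_derivative ((\<lambda>s. s *\<^sub>R h t) \<circ> (\<lambda>v. Im (1 / w0 * v)))) (at w0)"
        by (rule diff_chain_at[OF d\<tau>]) (simp add: \<tau>0 d\<beta>)
      then have alt: "\<exists>d>0. \<forall>w. norm (w - w0) < d \<longrightarrow>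
          norm (\<beta> (\<tau> w) - \<beta> (\<tau> w0) - Im (1 / w0 * (w - w0)) *\<^sub>R h t) \<le> e * norm (w - w0)" if "0 < e" for e
        using that unfolding has_derivative_at_alt o_def by blast
      have G\<tau>: "\<beta> (\<tau> w) = G w" if w: "w \<in> circle" for w
      proof -
        define u where "u = w / w0"
        have u: "norm u = 1" "u \<noteq> 0" using w w0 by (auto simp: u_def norm_divide)
        have "u = exp (Ln u)" using u by simp
        also have "\<dots> = cis (Im (Ln u))" using u by (simp add: exp_eq_polar)
        finally have cu: "cis (Im (Ln u)) = u" by (rule sym)
        have "\<tau> w = t + Im (Ln u)" by (simp add: \<tau>_def u_def)
        then have "cis (\<tau> w) = w0 * cis (Im (Ln u))" by (simp add: w0_def cis_mult)
        then have "cis (\<tau> w) = w0 * u" by (simp only: cu)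
        then show ?thesis using w0 by (simp add: \<beta>_def u_def)
      qed
      have "((\<lambda>r. deriv G (of_real r * w0)) \<longlongrightarrow> b) (at_left 1)"
      proof (rule deriv_radial_limit[OF GA w0(1)])
        show "norm (G w - G w0) \<le> M * norm (w - w0)" if "w \<in> circle" for w
          using that w0 by (intro GL) auto
        fix e :: real assume e: "0 < e"
        obtain d where d: "0 < d" "\<And>w. norm (w - w0) < d \<Longrightarrow>
          norm (\<beta> (\<tau> w) - \<beta> (\<tau> w0) - Im (1 / w0 * (w - w0)) *\<^sub>R h t) \<le> e / 2 * norm (w - w0)"
          using alt[of "e / 2"] e by auto
        show "\<exists>d>0. \<forall>w\<in>circle. norm (w - w0) < d \<longrightarrow> norm (G w - G w0 - b * (w - w0)) \<le> e * norm (w - w0)"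
        proof (intro exI[of _ "min d (e / (M + 1))"] conjI ballI impI)
          fix w assume w: "w \<in> circle" and wd: "norm (w - w0) < min d (e / (M + 1))"
          \<comment> \<open>For \<open>w\<close> on the circle, \<open>|1 + x| = 1\<close> forces
            \<open>Re x = - |x|^2 / 2\<close>. The tangential increment \<open>Im x\<close>
            therefore agrees with \<open>x / i\<close> up to second order, and the radius
            \<open>e / (M + 1)\<close> keeps the resulting error within half of the permitted
            one.\<close>
          define x where "x = 1 / w0 * (w - w0)"
          have nx: "norm x = norm (w - w0)" using w0 by (simp add: x_def norm_mult norm_divide)
          have wx: "w - w0 = w0 * x" using w0 by (simp add: x_def)
          have "norm (1 + x) = 1" using w w0 by (simp add: x_def norm_divide field_simps)
          then have "(1 + Re x)\<^sup>2 + (Im x)\<^sup>2 = 1" using cmod_power2[of "1 + x"] by simp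
          then have "2 * Re x = - ((Re x)\<^sup>2 + (Im x)\<^sup>2)" by (simp add: power2_eq_square algebra_simps)
          moreover have "a = - (s / 2)" if "2 * a = - s" for a s :: real using that by simp
          ultimately have "Re x = - ((norm x)\<^sup>2 / 2)" unfolding cmod_power2 by blast
          then have rex: "\<bar>Re x\<bar> = (norm x)\<^sup>2 / 2" by simp
          have "Im x *\<^sub>R h t - b * (w - w0) = - (b * w0 * of_real (Re x))"
          proof -
            have "b * (w0 * x) = b * (w0 * (of_real (Re x) + \<i> * of_real (Im x)))"
              by (rule arg_cong[OF complex_eq])
            then show ?thesis unfolding ht wx by (simp only:) (simp add: scaleR_conv_of_real algebra_simps)
          qed
          then have "norm (Im x *\<^sub>R h t - b * (w - w0)) = norm b * \<bar>Re x\<bar>"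
            using w0 by (simp add: norm_mult)
          also have "\<dots> \<le> M * ((norm x)\<^sup>2 / 2)" unfolding rex by (intro mult_right_mono bM) simp
          also have "\<dots> = (M * norm x) / 2 * norm x" by (simp add: power2_eq_square)
          also have "\<dots> \<le> e / 2 * norm x"
          proof (intro mult_right_mono divide_right_mono)
            have "M * norm x \<le> (M + 1) * (e / (M + 1))" using wd M0 by (intro mult_mono) (auto simp: nx)
            then show "M * norm x \<le> e" using M0 by simp
          qed auto
          finally have 2: "norm (Im x *\<^sub>R h t - b * (w - w0)) \<le> e / 2 * norm (w - w0)" by (simp only: nx)
          have 1: "norm (G w - G w0 - Im x *\<^sub>R h t) \<le> e / 2 * norm (w - w0)"
            using d(2)[of w] wd unfolding G\<tau>[OF w] G\<tau>[OF w0(1)] x_def by simp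
          have "G w - G w0 - b * (w - w0) = (G w - G w0 - Im x *\<^sub>R h t) + (Im x *\<^sub>R h t - b * (w - w0))" by simp
          then have "norm (G w - G w0 - b * (w - w0)) \<le> norm (G w - G w0 - Im x *\<^sub>R h t) + norm (Im x *\<^sub>R h t - b * (w - w0))"
            by (simp only: norm_triangle_ineq)
          also have "\<dots> \<le> e / 2 * norm (w - w0) + e / 2 * norm (w - w0)" by (rule add_mono[OF 1 2])
          finally show "norm (G w - G w0 - b * (w - w0)) \<le> e * norm (w - w0)" by (simp add: field_simps)
        qed (use d e M0 in auto)
      qed
      moreover have "eventually (\<lambda>r. deriv G (of_real r * w0) = \<phi> (of_real r * w0)) (at_left 1)"
        using ev01
      proof eventually_elim
        case (elim r)
        then have "of_real r * w0 \<in> ball 0 1" using w0 by (simp add: norm_mult)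
        then show ?case by (rule DERIV_imp_deriv[OF dG])
      qed
      ultimately have "((\<lambda>r. \<phi> (of_real r * w0)) \<longlongrightarrow> b) (at_left 1)" by (rule Lim_transform_eventually)
      then show "\<exists>l. ((\<lambda>r. \<phi> (of_real r * cis t)) \<longlongrightarrow> l) (at_left 1)" unfolding w0_def by blast
    qed
  qed
  then show ?thesis unfolding AE_circle_measure_iff .
qed

section \<open>Integrable logarithm and modulus of boundary values\<close>

lemma log_integrable_iff_boundary_modulus:
  assumes f: "continuous_on circle f" "\<And>w. w \<in> circle \<Longrightarrow> 0 \<le> f w"
  shows "log_integrable f \<longleftrightarrow>
         (\<exists>\<phi>\<in>H_infinity. \<exists>b. (\<exists>z\<in>ball 0 1. \<phi> z \<noteq> 0) \<and> has_boundary_values \<phi> b \<and>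
            (AE w in circle_measure. f w = cmod (b w)))"
proof
  assume "\<exists>\<phi>\<in>H_infinity. \<exists>b. (\<exists>z\<in>ball 0 1. \<phi> z \<noteq> 0) \<and> has_boundary_values \<phi> b \<and>
            (AE w in circle_measure. f w = cmod (b w))"
  then obtain \<phi> b z where \<phi>: "\<phi> \<in> H_infinity" "z \<in> ball 0 1" "\<phi> z \<noteq> 0" "has_boundary_values \<phi> b"
    and "AE w in circle_measure. f w = cmod (b w)" by blast
  then have "AE w in circle_measure. cmod (b w) \<le> f w" by (auto elim: eventually_mono)
  from log_integrable_of_boundary_values[OF f(1) f(2) \<phi> this]
  show "log_integrable f" .
next
  assume log: "log_integrable f"
  define u where "u = (\<lambda>w. ln (f w))"
  have ui: "integrable circle_measure u" and fpos: "AE w in circle_measure. 0 < f w"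
    using log by (auto simp: log_integrable_def u_def)
  have "compact (f ` circle)" using f(1) by (intro compact_continuous_image) auto
  then obtain B where B: "\<forall>x\<in>f ` circle. norm x \<le> B" using compact_imp_bounded bounded_iff by blast
  have B0: "0 \<le> B" using B order_trans[OF norm_ge_zero, of "f 1" B] by auto
  \<comment> \<open>At zeros of \<open>f\<close> the HOL value \<open>ln 0 = 0\<close> still
    satisfies the bound, since \<open>B\<close> is nonnegative.\<close>
  have uB: "u w \<le> ln (B + 1)" if w: "w \<in> circle" for w
  proof (cases "f w = 0")
    case False
    then have "0 < f w" using f(2)[OF w] by simp
    moreover have "f w \<le> B + 1" using B w f(2)[OF w] by force
    ultimately show ?thesis using B0 unfolding u_def by (subst ln_le_cancel_iff) auto
  qed (use B0 in \<open>simp add: u_def\<close>)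
  define \<phi> where "\<phi> = (\<lambda>z. exp (herglotz u z))"
  have hol: "\<phi> holomorphic_on ball 0 1"
    unfolding \<phi>_def by (intro holomorphic_intros holomorphic_herglotz ui)
  have bnd: "norm (\<phi> z) \<le> B + 1" if z: "z \<in> ball 0 1" for z
  proof -
    have z1: "norm z < 1" using z by simp
    have "Re (herglotz u z) \<le> cmean (\<lambda>w. ln (B + 1) * poisson z w)"
      unfolding Re_herglotz[OF ui z1]
    proof (rule cmean_mono)
      show "integrable circle_measure (\<lambda>w. poisson z w * u w)"
        by (intro integrable_circle_mult_cont_real ui continuous_on_poisson z1)
      show "integrable circle_measure (\<lambda>w. ln (B + 1) * poisson z w)"
        by (intro integrable_mult_right integrable_circle_cont continuous_on_poisson z1)
      fix w assume w: "w \<in> circle"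
      have "0 \<le> poisson z w" using w z1 by (intro poisson_nonneg) auto
      from mult_left_mono[OF uB[OF w] this]
      show "poisson z w * u w \<le> ln (B + 1) * poisson z w" by (simp add: mult.commute)
    qed
    also have "\<dots> = ln (B + 1)" by (simp add: cmean_mult_left cmean_poisson[OF z1])
    finally have "exp (Re (herglotz u z)) \<le> exp (ln (B + 1))" by simp
    then show ?thesis using B0 by (simp add: \<phi>_def)
  qed
  have H: "\<phi> \<in> H_infinity"
    unfolding H_infinity_def using hol bnd by (auto simp: bounded_iff intro!: exI[of _ "B + 1"])
  \<comment> \<open>\<open>Lim\<close> is meaningful only where the radial limit exists, which is
    almost everywhere by Fatou's theorem; \<open>has_boundary_values\<close> asks for no
    more.\<close>
  define b where "b = (\<lambda>w. Lim (at_left 1) (\<lambda>r. \<phi> (of_real r * w)))"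
  have lim: "AE w in circle_measure. ((\<lambda>r. \<phi> (of_real r * w)) \<longlongrightarrow> b w) (at_left 1)"
  proof -
    have "AE w in circle_measure. \<exists>l. ((\<lambda>r. \<phi> (of_real r * w)) \<longlongrightarrow> l) (at_left 1)"
      by (rule fatou_radial_limits[OF hol bnd])
    then show ?thesis
    proof eventually_elim
      case (elim w)
      then obtain l where l: "((\<lambda>r. \<phi> (of_real r * w)) \<longlongrightarrow> l) (at_left 1)" by blast
      then have "b w = l" unfolding b_def by (intro tendsto_Lim) auto
      then show ?case using l by simp
    qed
  qed
  have "AE w in circle_measure. f w = cmod (b w)"
    using lim fpos AE_space
  proof eventually_elim
    case (elim w)
    then have w: "w \<in> circle" by (simp add: space_circle_measure)
    \<comment> \<open>Continuity of \<open>f\<close> and \<open>f w > 0\<close> make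
      \<open>u\<close> continuous at \<open>w\<close> along the circle, so the local form of the
      radial approximation applies. It identifies the modulus of \<open>b w\<close> and leaves the
      argument open.\<close>
    have "((\<lambda>r. Re (herglotz u (of_real r * w))) \<longlongrightarrow> u w) (at_left 1)"
    proof (rule tendstoI)
      fix e :: real assume e: "0 < e"
      have "((\<lambda>v. ln (f v)) \<longlongrightarrow> ln (f w)) (at w within circle)"
        using f(1) w elim(2) by (intro tendsto_ln) (auto simp: continuous_on_def)
      then have "eventually (\<lambda>v. dist (ln (f v)) (ln (f w)) < e / 2) (at w within circle)"
        by (rule tendstoD) (use e in simp)
      then obtain d where d: "0 < d" "\<And>v. v \<in> circle \<Longrightarrow> v \<noteq> w \<Longrightarrow> dist v w < d \<Longrightarrow> dist (ln (f v)) (ln (f w)) < e / 2"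
        unfolding eventually_at by blast
      have close: "\<bar>u v - u w\<bar> \<le> e / 2" if "v \<in> circle" "norm (v - w) < d" for v
        using d(2)[of v] that e by (cases "v = w") (auto simp: u_def dist_norm dist_real_def)
      define A where "A = cmean (\<lambda>w. \<bar>u w\<bar>) + \<bar>u w\<bar>"
      have "((\<lambda>r. e / 2 + 8 * (1 - r) / d\<^sup>2 * A) \<longlongrightarrow> e / 2 + 8 * (1 - 1) / d\<^sup>2 * A) (at_left 1)"
        by (intro tendsto_intros) (use d in auto)
      then have "eventually (\<lambda>r. e / 2 + 8 * (1 - r) / d\<^sup>2 * A < e) (at_left 1)"
        by (rule order_tendstoD) (use e in auto)
      moreover have "eventually (\<lambda>r::real. r \<in> {0<..<1}) (at_left 1)"
        by (rule eventually_at_left_real) simp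
      ultimately show "eventually (\<lambda>r. dist (Re (herglotz u (of_real r * w))) (u w) < e) (at_left 1)"
      proof eventually_elim
        case (elim r)
        have "\<bar>Re (herglotz u (of_real r * w)) - u w\<bar> \<le> e / 2 + 8 * (1 - r) / d\<^sup>2 * A"
          unfolding A_def using elim(2) e by (intro herglotz_radial_approx[OF ui w _ _ d(1) close]) auto
        then show ?case using elim(1) unfolding dist_real_def by (rule order_le_less_trans)
      qed
    qed
    then have "((\<lambda>r. norm (\<phi> (of_real r * w))) \<longlongrightarrow> exp (u w)) (at_left 1)"
      unfolding \<phi>_def norm_exp_eq_Re by (rule tendsto_exp)
    moreover have "((\<lambda>r. norm (\<phi> (of_real r * w))) \<longlongrightarrow> norm (b w)) (at_left 1)"
      by (rule tendsto_norm[OF elim(1)])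
    ultimately have "norm (b w) = exp (u w)"
      using tendsto_unique[OF trivial_limit_at_left_real] by blast
    then show ?case using elim(2) by (simp add: u_def)
  qed
  moreover have "\<exists>z\<in>ball 0 1. \<phi> z \<noteq> 0" by (intro bexI[of _ 0]) (auto simp: \<phi>_def)
  ultimately show "\<exists>\<phi>\<in>H_infinity. \<exists>b. (\<exists>z\<in>ball 0 1. \<phi> z \<noteq> 0) \<and> has_boundary_values \<phi> b \<and>
            (AE w in circle_measure. f w = cmod (b w))"
    using H lim unfolding has_boundary_values_def by blast
qed

theorem theorem8p15:
  shows "(\<forall>f\<in>C_circle_nonneg.
      (log_integrable f \<longleftrightarrow>
         (\<exists>\<phi>\<in>H_infinity. \<exists>b. (\<exists>z\<in>ball 0 1. \<phi> z \<noteq> 0) \<and> has_boundary_values \<phi> b \<and>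
            (AE w in circle_measure. f w = cmod (b w)))) \<and>
      (rigged (closed_submodule f) \<longleftrightarrow> f \<in> R_class) \<and>
      ((\<exists>w\<in>circle. f w \<noteq> 0) \<longrightarrow> (log_integrable f \<longleftrightarrow> rigged (closed_submodule f)))) \<and>
    (\<forall>X :: 'x::ab_group_add opmodule. rigged X \<and> singly_generated X \<longrightarrow>
      (\<exists>f\<in>C_circle_nonneg. rigged (closed_submodule f) \<and> A_isometric X (closed_submodule f)))"
proof (intro conjI ballI allI impI)
  fix f assume "f \<in> C_circle_nonneg"
  then have f: "continuous_on circle f" "\<And>w. w \<in> circle \<Longrightarrow> 0 \<le> f w"
    by (auto simp: C_circle_nonneg_def)
  show "log_integrable f \<longleftrightarrow>
         (\<exists>\<phi>\<in>H_infinity. \<exists>b. (\<exists>z\<in>ball 0 1. \<phi> z \<noteq> 0) \<and> has_boundary_values \<phi> b \<and>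
            (AE w in circle_measure. f w = cmod (b w)))"
    by (rule log_integrable_iff_boundary_modulus[OF f])
  show "rigged (closed_submodule f) \<longleftrightarrow> f \<in> R_class"
    by (rule rigged_iff_R_class[OF f])
  assume "\<exists>w\<in>circle. f w \<noteq> 0"
  then show "log_integrable f \<longleftrightarrow> rigged (closed_submodule f)"
    using log_integrable_iff_rigged[OF f] by blast
next
  fix X :: "'x opmodule"
  assume "rigged X \<and> singly_generated X"
  then show "\<exists>f\<in>C_circle_nonneg. rigged (closed_submodule f) \<and> A_isometric X (closed_submodule f)"
    using singly_generated_rigged_isometric by blast
qed

end
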